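(* Let $A \in \mathcal{B}(H^2(\mathbb{T}))$. Then $A$ is a sum of a Toeplitz operator and a non-injective Hankel operator if and only if $T_z^* A T_z - A$ is a non-injective Hankel operator. Additionally, if \[ T_z^* A T_z - A = H_{\psi_1} \] for some $\psi_1 \in L^\infty(\mathbb{T})$ with $H_{\psi_1}$ non-injective, then there exist an inner function $\theta \in H^\infty(\mathbb{D})$ and a symbol $\varphi_2 \in L^\infty(\mathbb{T})$ such that \[ \ker H_{\psi_1} = \theta H^2(\mathbb{T}) \quad\text{and}\quad A T_\theta = T_{\varphi_2}, \] and $A = T_\varphi + H_\psi$ for some symbol $\psi \in L^\infty(\mathbb{T})$, where $\varphi = \overline{\theta}\,\varphi_2$.
   Context: $\mathbb{T}$ is the unit circle and $\mathbb{D}$ the open unit disc in $\mathbb{C}$; $\mathcal{B}(\mathcal{H})$ denotes the bounded linear operators on a Hilbert space $\mathcal{H}$. $L^2(\mathbb{T})$ and $L^\infty(\mathbb{T})$ are the usual scalar spaces with respect to normalized arc length measure, and $H^2(\mathbb{T})$ is the closed subspace of $L^2(\mathbb{T})$ of functions whose Fourier coefficients of negative index all vanish; $P_{H^2(\mathbb{T})}$ is the orthogonal projection of $L^2(\mathbb{T})$ onto it. For $\varphi\in L^\infty(\mathbb{T})$, $M_\varphi$ is multiplication by $\varphi$ on $L^2(\mathbb{T})$; the Toeplitz operator with symbol $\varphi$ is $T_\varphi = P_{H^2(\mathbb{T})}M_\varphi|_{H^2(\mathbb{T})}$; the Hankel operator with symbol $\varphi$ is $H_\varphi = P_{H^2(\mathbb{T})}M_\varphi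 J|_{H^2(\mathbb{T})}$, where $(Jf)(z) = f(\bar z)$ for $f \in L^2(\mathbb{T})$, $z\in\mathbb{T}$. An operator on $H^2(\mathbb{T})$ is called a Toeplitz (respectively Hankel) operator if it equals $T_\varphi$ (respectively $H_\varphi$) for some $\varphi\in L^\infty(\mathbb{T})$. $T_z$ is the Toeplitz operator with symbol $z$. A Hankel operator is non-injective if its kernel is not $\{0\}$. $H^\infty(\mathbb{D})$ is the algebra of bounded analytic functions on $\mathbb{D}$, identified via radial limits with a subspace of $L^\infty(\mathbb{T})$. A function $\theta\in H^\infty(\mathbb{D})$ is inner if its radial limit function satisfies $|\theta(z)|=1$ for almost all $z\in\mathbb{T}$. *)

theory Defs
  imports "HOL-Complex_Analysis.Complex_Analysis"
begin

text \<open>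
  Elements of \<open>L\<^sup>2(\<T>)\<close> and \<open>L\<^sup>\<infinity>(\<T>)\<close> are represented by functions \<open>complex \<Rightarrow> complex\<close>; two
  functions that agree almost everywhere on the circle represent the same element (values off
  the circle are irrelevant). All sets of functions below are closed under
  almost-everywhere equality, and every equation between elements is an almost-everywhere
  equation.
\<close>

definition circle_measure :: "complex measure" where
  "circle_measure =
     distr (uniform_measure lborel {0..<2 * pi}) (restrict_space borel (sphere 0 1)) cis"

definition L2 :: "(complex \<Rightarrow> complex) set" where
  "L2 = {f \<in> borel_measurable circle_measure. integrable circle_measure (\<lambda>z. (norm (f z))\<^sup>2)}"

definition Linf :: "(complex \<Rightarrow> complex) set" where
  "Linf = {f \<in> borel_measurable circle_measure. \<exists>C. AE z in circle_measure. norm (f z) \<le> C}"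

definition L2_inner :: "(complex \<Rightarrow> complex) \<Rightarrow> (complex \<Rightarrow> complex) \<Rightarrow> complex" where
  "L2_inner f g = (LINT z|circle_measure. f z * cnj (g z))"

definition L2_norm :: "(complex \<Rightarrow> complex) \<Rightarrow> real" where
  "L2_norm f = sqrt (LINT z|circle_measure. (norm (f z))\<^sup>2)"

definition fourier_coeff :: "(complex \<Rightarrow> complex) \<Rightarrow> int \<Rightarrow> complex" where
  "fourier_coeff f n = (LINT z|circle_measure. f z * z powi (- n))"

definition H2 :: "(complex \<Rightarrow> complex) set" where
  "H2 = {f \<in> L2. \<forall>n<0. fourier_coeff f n = 0}"

text \<open>
  The orthogonal projection of \<open>L\<^sup>2(\<T>)\<close> onto the closed subspace \<open>H\<^sup>2(\<T>)\<close>: the element is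
  unique up to almost-everywhere equality, and the choice operator selects a representative.
\<close>

definition proj_H2 :: "(complex \<Rightarrow> complex) \<Rightarrow> complex \<Rightarrow> complex" where
  "proj_H2 f = (SOME g. g \<in> H2 \<and> (\<forall>h\<in>H2. L2_inner (\<lambda>z. f z - g z) h = 0))"

text \<open>
  An operator on \<open>H\<^sup>2(\<T>)\<close> is a map on representatives, of which only the values on \<^const>\<open>H2\<close>
  matter, and these only up to almost-everywhere equality.
\<close>

type_synonym operator = "(complex \<Rightarrow> complex) \<Rightarrow> complex \<Rightarrow> complex"

definition op_eq :: "operator \<Rightarrow> operator \<Rightarrow> bool" where
  "op_eq A B \<longleftrightarrow> (\<forall>f\<in>H2. AE z in circle_measure. A f z = B f z)"

definition bounded_operator_H2 :: "operator \<Rightarrow> bool" where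
  "bounded_operator_H2 A \<longleftrightarrow>
     (\<forall>f\<in>H2. A f \<in> H2) \<and>
     (\<forall>f\<in>H2. \<forall>g\<in>H2. (AE z in circle_measure. f z = g z) \<longrightarrow>
        (AE z in circle_measure. A f z = A g z)) \<and>
     (\<forall>f\<in>H2. \<forall>g\<in>H2. AE z in circle_measure. A (\<lambda>w. f w + g w) z = A f z + A g z) \<and>
     (\<forall>c. \<forall>f\<in>H2. AE z in circle_measure. A (\<lambda>w. c * f w) z = c * A f z) \<and>
     (\<exists>C. \<forall>f\<in>H2. L2_norm (A f) \<le> C * L2_norm f)"

definition adjoint_H2 :: "operator \<Rightarrow> operator" where
  "adjoint_H2 A f = (SOME g. g \<in> H2 \<and> (\<forall>h\<in>H2. L2_inner (A h) f = L2_inner h g))"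

definition ker_H2 :: "operator \<Rightarrow> (complex \<Rightarrow> complex) set" where
  "ker_H2 A = {f \<in> H2. AE z in circle_measure. A f z = 0}"

text \<open>The zero subspace consists of all representatives of the zero element.\<close>

definition zero_H2 :: "(complex \<Rightarrow> complex) set" where
  "zero_H2 = {f \<in> H2. AE z in circle_measure. f z = 0}"

definition toeplitz :: "(complex \<Rightarrow> complex) \<Rightarrow> operator" where
  "toeplitz \<phi> f = proj_H2 (\<lambda>z. \<phi> z * f z)"

definition flip :: operator where
  "flip f z = f (cnj z)"

definition hankel :: "(complex \<Rightarrow> complex) \<Rightarrow> operator" where
  "hankel \<phi> f = proj_H2 (\<lambda>z. \<phi> z * flip f z)"

definition is_toeplitz :: "operator \<Rightarrow> bool" where
  "is_toeplitz A \<longleftrightarrow> (\<exists>\<phi>\<in>Linf. op_eq A (toeplitz \<phi>))"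

definition is_hankel :: "operator \<Rightarrow> bool" where
  "is_hankel A \<longleftrightarrow> (\<exists>\<phi>\<in>Linf. op_eq A (hankel \<phi>))"

definition noninjective_hankel :: "operator \<Rightarrow> bool" where
  "noninjective_hankel A \<longleftrightarrow> is_hankel A \<and> ker_H2 A \<noteq> zero_H2"

abbreviation shift :: operator where
  "shift \<equiv> toeplitz (\<lambda>z. z)"

definition Hinf :: "(complex \<Rightarrow> complex) set" where
  "Hinf = {\<theta>. \<theta> holomorphic_on ball 0 1 \<and> bounded (\<theta> ` ball 0 1)}"

text \<open>
  For \<open>\<theta>\<close> in \<^const>\<open>Hinf\<close> the limit exists for almost every \<open>z\<close> on the circle (Fatou);
  elsewhere its value is arbitrary.
\<close>

definition radial_limit :: "(complex \<Rightarrow> complex) \<Rightarrow> complex \<Rightarrow> complex" where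
  "radial_limit \<theta> z = Lim (at_left 1) (\<lambda>r::real. \<theta> (of_real r * z))"

definition inner_function :: "(complex \<Rightarrow> complex) \<Rightarrow> bool" where
  "inner_function \<theta> \<longleftrightarrow>
     \<theta> \<in> Hinf \<and> (AE z in circle_measure. norm (radial_limit \<theta> z) = 1)"

text \<open>The subspace \<open>\<theta> H\<^sup>2(\<T>)\<close>; here \<open>u\<close> is the boundary function of \<open>\<theta>\<close>.\<close>

definition mult_H2 :: "(complex \<Rightarrow> complex) \<Rightarrow> (complex \<Rightarrow> complex) set" where
  "mult_H2 u = {f \<in> L2. \<exists>g\<in>H2. AE z in circle_measure. f z = u z * g z}"

end

theory Submission
  imports Defs
begin

text \<open>
Write \<open>S\<close> for the shift \<open>T\<^sub>z\<close>. In the basis \<open>1, z, z\<^sup>2, \<dots>\<close> a bounded operator \<open>A\<close> is a Toeplitz operator if and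
only if its matrix entries depend on the difference of the indices, that is \<open>S\<^sup>* A S = A\<close> (Brown and Halmos), and
a Hankel operator if and only if they depend on the sum of the indices, that is \<open>A S = S\<^sup>* A\<close> (Nehari). Hence
\<open>S\<^sup>* A S - A\<close> removes a Toeplitz summand of \<open>A\<close> and turns a Hankel summand with symbol \<open>\<psi>\<close> into the Hankel operator
with symbol \<open>(z\<^sup>-\<^sup>2 - 1) \<psi>\<close>, whose kernel contains that of the summand. This is one half of the equivalence.

For the other half, let \<open>S\<^sup>* A S - A = H\<close> be a Hankel operator with a nontrivial kernel. This kernel is closed and
invariant under \<open>S\<close>, so it is \<open>\<theta> H\<^sup>2\<close> with \<open>\<theta>\<close> inner, by Beurling's theorem. On \<open>\<theta> H\<^sup>2\<close> the operator \<open>A\<close> satisfies the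
Toeplitz equation, so \<open>A T\<^sub>\<theta>\<close> is a Toeplitz operator with some symbol \<open>\<phi>2\<close>. For \<open>\<phi> = cnj \<theta> \<phi>2\<close> the operator
\<open>D = A - T\<^sub>\<phi>\<close> annihilates \<open>\<theta> H\<^sup>2\<close>, and still \<open>S\<^sup>* D S - D = H\<close>. Let \<open>E = S\<^sup>* D - D S\<close>. Then
\<open>S\<^sup>* E S - E = S\<^sup>* H - H S = 0\<close>, so \<open>E\<close> is a Toeplitz operator with some symbol \<open>e\<close>. But \<open>E\<close> also annihilates \<open>\<theta> H\<^sup>2\<close>,
so \<open>e \<theta> = 0\<close> and \<open>e = 0\<close>. Thus \<open>S\<^sup>* D = D S\<close>, and Nehari's theorem provides a symbol of \<open>D\<close>. The kernel of \<open>D\<close>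
contains \<open>\<theta> H\<^sup>2\<close>, so \<open>D\<close> is not injective.

The analytic input is Fatou's theorem, that Poisson integrals of integrable functions converge radially almost
everywhere (\<open>fatou_radial_limit\<close>). It provides the boundary values of \<open>\<theta>\<close> and the uniqueness of Fourier coefficients,
and it reduces the boundedness of a symbol to that of its Poisson integral. In the theorem of Brown and Halmos
(\<open>brown_halmos\<close>) the Poisson integral of the symbol is the quadratic form of the operator at normalized reproducing
kernels. In Nehari's theorem (\<open>nehari\<close>) the Hankel operator defines a functional on analytic polynomials. It is bounded in
the \<open>L\<^sup>1\<close> norm, because every polynomial is a product \<open>g h\<close> with \<open>\<bar>g\<bar>\<^sup>2 = \<bar>h\<bar>\<^sup>2\<close> on the circle; the Hahn-Banach theorem
extends it to trigonometric polynomials, and the extension, evaluated at Poisson kernels, is the Poisson integral of a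
symbol.
\<close>

section \<open>Normalized arc length\<close>

abbreviation \<mu> :: "complex measure" where "\<mu> \<equiv> circle_measure"

lemma measurable_cis_sphere [measurable]: "cis \<in> borel \<rightarrow>\<^sub>M restrict_space borel (sphere 0 1)"
  by (intro measurable_restrict_space2 borel_measurable_continuous_onI continuous_intros) auto

lemma emeasure_period [simp]: "emeasure lborel {0..<2 * pi} = ennreal (2 * pi)"
  by simp

lemma space_circle [simp]: "space \<mu> = sphere 0 1"
  by (simp add: circle_measure_def space_restrict_space)

lemma sets_circle: "sets \<mu> = sets (restrict_space borel (sphere 0 1))"
  by (simp add: circle_measure_def)

lemma borel_measurable_circle_iff:
  "f \<in> borel_measurable \<mu> \<longleftrightarrow> f \<in> borel_measurable (restrict_space borel (sphere 0 1))"
  by (rule arg_cong2[where f="(\<in>)"] refl measurable_cong_sets sets_circle)+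

lemma measurable_cis_uniform:
  "cis \<in> uniform_measure lborel {0..<2 * pi} \<rightarrow>\<^sub>M restrict_space borel (sphere 0 1)"
  using measurable_cis_sphere by simp

lemma borel_measurable_circle_cis:
  assumes "f \<in> borel_measurable \<mu>"
  shows "(\<lambda>t. f (cis t)) \<in> borel_measurable borel"
  by (rule measurable_compose[OF measurable_cis_sphere]) (use assms borel_measurable_circle_iff in blast)

text \<open>
The link to integrals over one period of the angle, in which invariance and differentiation are proved.
\<close>

lemma nn_integral_circle:
  fixes f :: "complex \<Rightarrow> ennreal"
  assumes [measurable]: "f \<in> borel_measurable \<mu>"
  shows "(\<integral>\<^sup>+z. f z \<partial>\<mu>) = (\<integral>\<^sup>+t. f (cis t) * indicator {0..<2 * pi} t \<partial>lborel) / ennreal (2 * pi)"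
proof -
  have f[measurable]: "f \<in> borel_measurable (restrict_space borel (sphere 0 1))"
    using assms by (simp add: borel_measurable_circle_iff)
  have "(\<integral>\<^sup>+z. f z \<partial>\<mu>) = (\<integral>\<^sup>+t. f (cis t) \<partial>uniform_measure lborel {0..<2 * pi})"
    unfolding circle_measure_def by (rule nn_integral_distr[OF measurable_cis_uniform]) (use f in simp)
  also have "\<dots> = (\<integral>\<^sup>+t. f (cis t) * indicator {0..<2 * pi} t \<partial>lborel) / emeasure lborel {0..<2 * pi}"
    using borel_measurable_circle_cis[OF assms] by (intro nn_integral_uniform_measure) simp_all
  finally show ?thesis by simp
qed

lemma borel_measurable_circle_continuous:
  assumes "continuous_on (sphere 0 1) f"
  shows "f \<in> borel_measurable \<mu>"
  unfolding borel_measurable_circle_iff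
  by (rule borel_measurable_continuous_on_restrict[OF assms])

lemma borel_measurable_circle_borel:
  assumes "f \<in> borel_measurable borel"
  shows "f \<in> borel_measurable \<mu>"
  unfolding borel_measurable_circle_iff using assms by (rule measurable_restrict_space1)

lemma emeasure_circle [simp]: "emeasure \<mu> (sphere 0 1) = 1"
proof -
  have "emeasure \<mu> (space \<mu>) = (\<integral>\<^sup>+z. 1 \<partial>\<mu>)" by simp
  also have "\<dots> = (\<integral>\<^sup>+t. indicator {0..<2 * pi} t \<partial>lborel) / ennreal (2 * pi)"
    by (subst nn_integral_circle) simp_all
  also have "\<dots> = 1" by (subst nn_integral_indicator) (simp_all add: divide_ennreal flip: ennreal_1)
  finally show ?thesis by simp
qed

interpretation circle: finite_measure \<mu>
  by standard simp

lemma measure_circle [simp]: "measure \<mu> (sphere 0 1) = 1"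
  by (simp add: measure_def)

lemma integral_circle:
  fixes f :: "complex \<Rightarrow> 'a :: {banach, second_countable_topology}"
  assumes f: "f \<in> borel_measurable \<mu>"
  shows integrable_circle_iff: "integrable \<mu> f \<longleftrightarrow> set_integrable lborel {0..<2 * pi} (\<lambda>t. f (cis t))"
    and integral_circle_eq: "integral\<^sup>L \<mu> f = (1 / (2 * pi)) *\<^sub>R (LINT t:{0..<2 * pi}|lborel. f (cis t))"
proof -
  have f': "f \<in> borel_measurable (restrict_space borel (sphere 0 1))"
    using f by (simp add: borel_measurable_circle_iff)
  have m: "(\<lambda>t. f (cis t)) \<in> borel_measurable lborel"
    using borel_measurable_circle_cis[OF f] by simp
  have dens: "uniform_measure lborel {0..<2 * pi} = density lborel (\<lambda>t. ennreal (indicator {0..<2 * pi} t / (2 * pi)))"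
    unfolding uniform_measure_def
    by (rule arg_cong2[where f=density] refl ext)+
       (auto simp: indicator_def divide_ennreal simp flip: ennreal_1)
  have I1: "integrable \<mu> f \<longleftrightarrow> integrable (uniform_measure lborel {0..<2 * pi}) (\<lambda>t. f (cis t))"
    unfolding circle_measure_def by (rule integrable_distr_eq[OF measurable_cis_uniform f'])
  also have "\<dots> \<longleftrightarrow> integrable lborel (\<lambda>t. (indicator {0..<2 * pi} t / (2 * pi)) *\<^sub>R f (cis t))"
    unfolding dens by (rule integrable_density[OF m]) auto
  also have "(\<lambda>t. (indicator {0..<2 * pi} t / (2 * pi)) *\<^sub>R f (cis t)) =
      (\<lambda>t. (1 / (2 * pi)) *\<^sub>R (indicator {0..<2 * pi} t *\<^sub>R f (cis t)))"
    by (auto simp: fun_eq_iff)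
  also have "integrable lborel \<dots> \<longleftrightarrow> set_integrable lborel {0..<2 * pi} (\<lambda>t. f (cis t))"
    unfolding set_integrable_def
  proof
    assume "integrable lborel (\<lambda>t. (1 / (2 * pi)) *\<^sub>R (indicator {0..<2 * pi} t *\<^sub>R f (cis t)))"
    from integrable_scaleR_right[OF this, of "2 * pi"]
    show "integrable lborel (\<lambda>t. indicator {0..<2 * pi} t *\<^sub>R f (cis t))" by simp
  qed (rule integrable_scaleR_right)
  finally show "integrable \<mu> f \<longleftrightarrow> set_integrable lborel {0..<2 * pi} (\<lambda>t. f (cis t))" .
  have "integral\<^sup>L \<mu> f = integral\<^sup>L (uniform_measure lborel {0..<2 * pi}) (\<lambda>t. f (cis t))"
    unfolding circle_measure_def by (rule integral_distr[OF measurable_cis_uniform f'])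
  also have "\<dots> = integral\<^sup>L lborel (\<lambda>t. (indicator {0..<2 * pi} t / (2 * pi)) *\<^sub>R f (cis t))"
    unfolding dens by (rule integral_density[OF m]) auto
  also have "(\<lambda>t. (indicator {0..<2 * pi} t / (2 * pi)) *\<^sub>R f (cis t)) =
      (\<lambda>t. (1 / (2 * pi)) *\<^sub>R (indicator {0..<2 * pi} t *\<^sub>R f (cis t)))"
    by (auto simp: fun_eq_iff)
  also have "integral\<^sup>L lborel \<dots> = (1 / (2 * pi)) *\<^sub>R (LINT t:{0..<2 * pi}|lborel. f (cis t))"
    unfolding set_lebesgue_integral_def by (rule integral_scaleR_right) 
  finally show "integral\<^sup>L \<mu> f = (1 / (2 * pi)) *\<^sub>R (LINT t:{0..<2 * pi}|lborel. f (cis t))" .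
qed

lemma Arg2pi_cis: "0 \<le> t \<Longrightarrow> t < 2 * pi \<Longrightarrow> Arg2pi (cis t) = t"
  by (rule Arg2pi_unique[of 1]) (auto simp: cis_conv_exp)

lemma cis_Arg2pi: "norm z = 1 \<Longrightarrow> cis (Arg2pi z) = z"
  by (simp add: complex_norm_eq_1_exp cis_conv_exp)

lemma borel_measurable_Arg2pi [measurable]: "Arg2pi \<in> borel_measurable borel"
proof -
  have "Arg2pi = (\<lambda>z. if z \<in> \<real>\<^sub>\<ge>\<^sub>0 then 0 else Arg2pi z)"
    by (auto simp: fun_eq_iff Arg2pi_eq_0 complex_nonneg_Reals_iff complex_is_Real_iff)
  also have "\<dots> \<in> borel_measurable borel"
  proof (subst measurable_If_restrict_space_iff)
    show "{z \<in> space borel. z \<in> (\<real>\<^sub>\<ge>\<^sub>0 :: complex set)} \<in> sets borel"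
      by (simp add: closed_nonneg_Reals_complex borel_closed)
    have "continuous_on {z. z \<notin> (\<real>\<^sub>\<ge>\<^sub>0 :: complex set)} Arg2pi"
      by (auto intro!: continuous_at_imp_continuous_on continuous_at_Arg2pi)
    then have "Arg2pi \<in> borel_measurable (restrict_space borel {z. z \<notin> \<real>\<^sub>\<ge>\<^sub>0})"
      by (rule borel_measurable_continuous_on_restrict)
    then show "(\<lambda>x. 0) \<in> borel_measurable (restrict_space borel {z. z \<in> (\<real>\<^sub>\<ge>\<^sub>0 :: complex set)}) \<and>
        Arg2pi \<in> borel_measurable (restrict_space borel {z. z \<notin> \<real>\<^sub>\<ge>\<^sub>0})"
      by simp
  qed
  finally show ?thesis .
qed

text \<open>
A null set of angles has to be carried to a null set of the circle. The image of a Borel set under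
\<open>cis\<close> is the preimage of that set under the Borel function \<^const>\<open>Arg2pi\<close>, and this makes the
image measurable.
\<close>

lemma AE_circleI:
  assumes "AE t in lborel. 0 \<le> t \<and> t < 2 * pi \<longrightarrow> P (cis t)"
  shows "AE z in \<mu>. P z"
proof -
  obtain N where N: "N \<in> null_sets lborel" "{t. \<not> (0 \<le> t \<and> t < 2 * pi \<longrightarrow> P (cis t))} \<subseteq> N"
    using AE_E3[OF assms] by (metis (no_types, lifting) Diff_iff UNIV_I mem_Collect_eq space_borel space_lborel subsetI)
  have Nb [measurable]: "N \<in> sets borel" using N(1) by auto
  have [measurable]: "(\<lambda>z. indicator N (Arg2pi z) :: ennreal) \<in> borel_measurable \<mu>"
    by (intro borel_measurable_circle_borel) measurable
  have "(\<integral>\<^sup>+z. indicator N (Arg2pi z) \<partial>\<mu>) =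
      (\<integral>\<^sup>+t. indicator N (Arg2pi (cis t)) * indicator {0..<2 * pi} t \<partial>lborel) / ennreal (2 * pi)"
    by (rule nn_integral_circle) measurable
  also have "(\<integral>\<^sup>+t. indicator N (Arg2pi (cis t)) * indicator {0..<2 * pi} t \<partial>lborel) \<le> (\<integral>\<^sup>+t. indicator N t \<partial>lborel)"
    by (intro nn_integral_mono) (auto simp: indicator_def Arg2pi_cis)
  also have "(\<integral>\<^sup>+t. indicator N t \<partial>lborel) = 0" using N(1) by (auto simp: null_sets_def)
  finally have "(\<integral>\<^sup>+z. indicator N (Arg2pi z) \<partial>\<mu>) = 0" by (simp add: divide_right_mono_ennreal)
  then have "AE z in \<mu>. indicator N (Arg2pi z) = (0::ennreal)"
    by (subst (asm) nn_integral_0_iff_AE) auto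
  moreover have "AE z in \<mu>. z \<in> sphere 0 1" using AE_space[of \<mu>] by simp
  ultimately show ?thesis
  proof eventually_elim
    case (elim z)
    then have "Arg2pi z \<notin> N" by (auto simp: indicator_def split: if_splits)
    then have "0 \<le> Arg2pi z \<and> Arg2pi z < 2 * pi \<longrightarrow> P (cis (Arg2pi z))" using N(2) by blast
    then show "P z" using elim Arg2pi_ge_0[of z] Arg2pi_lt_2pi[of z] by (auto simp: cis_Arg2pi)
  qed
qed

lemma measurable_circle_mult:
  assumes "norm a = 1"
  shows "(\<lambda>z. a * z) \<in> \<mu> \<rightarrow>\<^sub>M \<mu>"
proof -
  have "(\<lambda>z. a * z) \<in> restrict_space borel (sphere 0 1) \<rightarrow>\<^sub>M restrict_space borel (sphere 0 1)"
    using assms by (intro measurable_restrict_space2 borel_measurable_continuous_on_restrict continuous_intros)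
      (auto simp: space_restrict_space norm_mult)
  then show ?thesis by (simp add: measurable_cong_sets[OF sets_circle sets_circle])
qed

lemma measurable_circle_cnj: "cnj \<in> \<mu> \<rightarrow>\<^sub>M \<mu>"
proof -
  have "cnj \<in> restrict_space borel (sphere 0 1) \<rightarrow>\<^sub>M restrict_space borel (sphere 0 1)"
    by (intro measurable_restrict_space2 borel_measurable_continuous_on_restrict continuous_intros)
      (auto simp: space_restrict_space norm_mult)
  then show ?thesis by (simp add: measurable_cong_sets[OF sets_circle sets_circle])
qed

text \<open>
Rotation invariance: a rotation shifts the window \<open>[0, 2\<pi>)\<close> to \<open>[s, s + 2\<pi>)\<close>, and the part
beyond \<open>2\<pi>\<close> moves back by periodicity. Integrals with values in \<open>[0, \<infinity>]\<close> need no integrability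
condition when the window is cut, so the invariance of the measure is derived here first and the
statement about complex functions follows from it.
\<close>

lemma nn_integral_circle_mult:
  fixes f :: "complex \<Rightarrow> ennreal"
  assumes f: "f \<in> borel_measurable \<mu>" and a: "norm a = 1"
  shows "(\<integral>\<^sup>+z. f (a * z) \<partial>\<mu>) = (\<integral>\<^sup>+z. f z \<partial>\<mu>)"
proof -
  define s where "s = Arg2pi a"
  have s: "0 \<le> s" "s < 2 * pi" and a_eq: "a = cis s"
    using a by (auto simp: s_def Arg2pi_ge_0 Arg2pi_lt_2pi cis_Arg2pi)
  define F where "F t = f (cis t)" for t
  have F[measurable]: "F \<in> borel_measurable borel"
    unfolding F_def by (rule borel_measurable_circle_cis[OF f])
  have per: "F (t + 2 * pi) = F t" for t
    by (simp add: F_def flip: cis_mult)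
  have m: "(\<lambda>z. f (a * z)) \<in> borel_measurable \<mu>"
    by (rule measurable_compose[OF measurable_circle_mult[OF a] f])
  have "(\<integral>\<^sup>+t. f (a * cis t) * indicator {0..<2 * pi} t \<partial>lborel) = (\<integral>\<^sup>+t. F (s + 1 * t) * indicator {s..<s + 2 * pi} (s + 1 * t) \<partial>lborel)"
    by (intro nn_integral_cong) (auto simp: F_def a_eq cis_mult indicator_def)
  also have "\<dots> = (\<integral>\<^sup>+t. F t * indicator {s..<s + 2 * pi} t \<partial>lborel)"
    using nn_integral_real_affine[of "\<lambda>t. F t * indicator {s..<s + 2 * pi} t" 1 s] by simp
  also have "\<dots> = (\<integral>\<^sup>+t. F t * indicator {s..<2 * pi} t + F t * indicator {2 * pi..<2 * pi + s} t \<partial>lborel)"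
    using s by (intro nn_integral_cong) (auto simp: indicator_def)
  also have "\<dots> = (\<integral>\<^sup>+t. F t * indicator {s..<2 * pi} t \<partial>lborel) + (\<integral>\<^sup>+t. F t * indicator {2 * pi..<2 * pi + s} t \<partial>lborel)"
    by (rule nn_integral_add) auto
  also have "(\<integral>\<^sup>+t. F t * indicator {2 * pi..<2 * pi + s} t \<partial>lborel) =
      (\<integral>\<^sup>+t. F (2 * pi + 1 * t) * indicator {2 * pi..<2 * pi + s} (2 * pi + 1 * t) \<partial>lborel)"
    using nn_integral_real_affine[of "\<lambda>t. F t * indicator {2 * pi..<2 * pi + s} t" 1 "2 * pi"] by simp
  also have "\<dots> = (\<integral>\<^sup>+t. F t * indicator {0..<s} t \<partial>lborel)"
    using per by (intro nn_integral_cong) (auto simp: indicator_def add.commute)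
  also have "(\<integral>\<^sup>+t. F t * indicator {s..<2 * pi} t \<partial>lborel) + (\<integral>\<^sup>+t. F t * indicator {0..<s} t \<partial>lborel) =
      (\<integral>\<^sup>+t. F t * indicator {s..<2 * pi} t + F t * indicator {0..<s} t \<partial>lborel)"
    by (rule nn_integral_add[symmetric]) auto
  also have "\<dots> = (\<integral>\<^sup>+t. f (cis t) * indicator {0..<2 * pi} t \<partial>lborel)"
    using s by (intro nn_integral_cong) (auto simp: indicator_def F_def)
  finally show ?thesis by (simp add: nn_integral_circle[OF m] nn_integral_circle[OF f])
qed

lemma nn_integral_circle_cnj:
  fixes f :: "complex \<Rightarrow> ennreal"
  assumes f: "f \<in> borel_measurable \<mu>"
  shows "(\<integral>\<^sup>+z. f (cnj z) \<partial>\<mu>) = (\<integral>\<^sup>+z. f z \<partial>\<mu>)"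
proof -
  define F where "F t = f (cis t)" for t
  have F[measurable]: "F \<in> borel_measurable borel"
    unfolding F_def by (rule borel_measurable_circle_cis[OF f])
  have m: "(\<lambda>z. f (cnj z)) \<in> borel_measurable \<mu>"
    by (rule measurable_compose[OF measurable_circle_cnj f])
  have "(\<integral>\<^sup>+t. f (cnj (cis t)) * indicator {0..<2 * pi} t \<partial>lborel) = (\<integral>\<^sup>+t. F (2 * pi + (-1) * t) * indicator {0<..2 * pi} (2 * pi + (-1) * t) \<partial>lborel)"
    by (intro nn_integral_cong) (auto simp: F_def cis_cnj indicator_def cis_divide[symmetric] cis_inverse[symmetric] inverse_eq_divide)
  also have "\<dots> = (\<integral>\<^sup>+t. F t * indicator {0<..2 * pi} t \<partial>lborel)"
    using nn_integral_real_affine[of "\<lambda>t. F t * indicator {0<..2 * pi} t" "-1" "2 * pi"] by simp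
  also have "\<dots> = (\<integral>\<^sup>+t. F t * indicator {0..<2 * pi} t \<partial>lborel)"
    using AE_lborel_singleton[of 0] AE_lborel_singleton[of "2 * pi"]
    by (intro nn_integral_cong_AE, eventually_elim) (auto simp: indicator_def)
  finally show ?thesis by (simp add: nn_integral_circle[OF m] nn_integral_circle[OF f] F_def)
qed

lemma distr_circle_mult: 
  assumes "norm a = 1"
  shows "distr \<mu> \<mu> (\<lambda>z. a * z) = \<mu>"
proof (rule measure_eqI)
  fix X assume "X \<in> sets (distr \<mu> \<mu> (\<lambda>z. a * z))"
  then have X [measurable]: "X \<in> sets \<mu>" by simp
  have "emeasure (distr \<mu> \<mu> (\<lambda>z. a * z)) X = (\<integral>\<^sup>+z. indicator X z \<partial>distr \<mu> \<mu> (\<lambda>z. a * z))"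
    by simp
  also have "\<dots> = (\<integral>\<^sup>+z. indicator X (a * z) \<partial>\<mu>)"
    by (rule nn_integral_distr[OF measurable_circle_mult[OF assms]]) simp
  also have "\<dots> = emeasure \<mu> X"
    using nn_integral_circle_mult[of "indicator X" a] assms by simp
  finally show "emeasure (distr \<mu> \<mu> (\<lambda>z. a * z)) X = emeasure \<mu> X" .
qed simp

lemma distr_circle_cnj: "distr \<mu> \<mu> cnj = \<mu>"
proof (rule measure_eqI)
  fix X assume "X \<in> sets (distr \<mu> \<mu> cnj)"
  then have X [measurable]: "X \<in> sets \<mu>" by simp
  have "emeasure (distr \<mu> \<mu> cnj) X = (\<integral>\<^sup>+z. indicator X z \<partial>distr \<mu> \<mu> cnj)"
    by simp
  also have "\<dots> = (\<integral>\<^sup>+z. indicator X (cnj z) \<partial>\<mu>)"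
    by (rule nn_integral_distr[OF measurable_circle_cnj]) simp
  also have "\<dots> = emeasure \<mu> X"
    using nn_integral_circle_cnj[of "indicator X"] by simp
  finally show "emeasure (distr \<mu> \<mu> cnj) X = emeasure \<mu> X" .
qed simp

lemma integral_circle_mult:
  fixes f :: "complex \<Rightarrow> 'a :: {banach, second_countable_topology}"
  assumes "f \<in> borel_measurable \<mu>" "norm a = 1"
  shows "integral\<^sup>L \<mu> (\<lambda>z. f (a * z)) = integral\<^sup>L \<mu> f" "integrable \<mu> (\<lambda>z. f (a * z)) \<longleftrightarrow> integrable \<mu> f"
  using integral_distr[OF measurable_circle_mult[OF assms(2)] assms(1)]
    integrable_distr_eq[OF measurable_circle_mult[OF assms(2)] assms(1)]
  by (simp_all add: assms distr_circle_mult)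

lemma integral_circle_cnj:
  fixes f :: "complex \<Rightarrow> 'a :: {banach, second_countable_topology}"
  assumes "f \<in> borel_measurable \<mu>"
  shows "integral\<^sup>L \<mu> (\<lambda>z. f (cnj z)) = integral\<^sup>L \<mu> f" "integrable \<mu> (\<lambda>z. f (cnj z)) \<longleftrightarrow> integrable \<mu> f"
  using integral_distr[OF measurable_circle_cnj assms(1)] integrable_distr_eq[OF measurable_circle_cnj assms(1)]
  by (simp_all add: assms distr_circle_cnj)

lemma AE_circle_cnj:
  assumes "AE z in \<mu>. P z"
  shows "AE z in \<mu>. P (cnj z)"
  using AE_distrD[OF measurable_circle_cnj, of P] assms unfolding distr_circle_cnj by blast

section \<open>Poisson integrals and their radial limits\<close>

text \<open>
The estimate behind every approximate identity with a decreasing kernel \<open>p\<close>. If the primitive of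
\<open>G\<close> is at most \<open>e x\<close> near \<open>0\<close>, then integration by parts moves the derivative \<open>- q\<close> of \<open>p\<close> to
this primitive, where \<open>\<integral> x q(x) dx \<le> \<integral> p\<close> absorbs the factor \<open>x\<close>; away from \<open>0\<close> the kernel is at most
\<open>p \<delta>\<close>. As \<open>G\<close> is only integrable, the integration by parts is Fubini applied to
\<open>p s = p a + \<integral>\<^bsub>s\<^esub>\<^bsup>a\<^esup> q\<close>.
\<close>

lemma decreasing_kernel_bound:
  fixes p q :: "real \<Rightarrow> real" and G :: "real \<Rightarrow> complex"
  assumes G: "integrable lborel (\<lambda>s. indicator {0..a} s *\<^sub>R G s)"
    and dp: "\<And>x. (p has_real_derivative - q x) (at x)" and cq: "continuous_on UNIV q"
    and q0: "\<And>x. 0 \<le> x \<Longrightarrow> x \<le> a \<Longrightarrow> 0 \<le> q x" and pa: "0 \<le> p a"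
    and \<delta>: "0 < \<delta>" "\<delta> \<le> a" and e: "0 \<le> e"
    and \<Phi>: "\<And>x. 0 < x \<Longrightarrow> x < \<delta> \<Longrightarrow> norm (LINT s|lborel. indicator {0..x} s *\<^sub>R G s) \<le> e * x"
  shows "norm (LINT s|lborel. indicator {0..a} s *\<^sub>R (p s *\<^sub>R G s)) \<le>
    e * (LINT s|lborel. indicator {0..a} s *\<^sub>R p s) + p \<delta> * (LINT s|lborel. norm (indicator {0..a} s *\<^sub>R G s))"
proof -
  define G' where "G' s = indicator {0..a} s *\<^sub>R G s" for s
  define q' where "q' x = indicator {0..a} x *\<^sub>R q x" for x
  \<comment> \<open>The integrand over the triangle \<open>s \<le> x\<close>; integrating first in \<open>x\<close> or first in \<open>s\<close> gives the two sides of the integration by parts.\<close>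
  define K where "K s x = (if s \<le> x then q' x *\<^sub>R G' s else 0)" for s x
  define K0 where "K0 = (LINT s|lborel. norm (G' s))"
  define \<Psi> where "\<Psi> x = (LINT s|lborel. indicator {0..x} s *\<^sub>R G s)" for x
  have a: "0 < a" using \<delta> by simp
  have cp: "continuous_on UNIV p"
    using dp by (auto intro!: DERIV_continuous continuous_at_imp_continuous_on)
  have intc: "integrable lborel (\<lambda>x. indicator {u..v} x *\<^sub>R g x)" if "continuous_on UNIV g" for u v and g :: "real \<Rightarrow> real"
    by (rule borel_integrable_compact) (use that continuous_on_subset in auto)
  have [measurable]: "G' \<in> borel_measurable borel" "q' \<in> borel_measurable borel"
    using borel_measurable_integrable[OF G] borel_measurable_integrable[OF intc[OF cq, of 0 a]]
    by (simp_all add: G'_def[abs_def] q'_def[abs_def])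
  have iG: "integrable lborel G'" using G by (simp add: G'_def[abs_def])
  have iq: "integrable lborel q'" using intc[OF cq, of 0 a] by (simp add: q'_def[abs_def])
  have FTC: "(LINT x|lborel. indicator {u..v} x *\<^sub>R q x) = p u - p v" if "u \<le> v" for u v
  proof -
    have "(LINT x|lborel. indicator {u..v} x *\<^sub>R (- q x)) = p v - p u"
    proof (rule integral_FTC_Icc[OF that])
      show "(p has_vector_derivative - q x) (at x within {u..v})" for x
        using has_field_derivative_at_within[OF dp] by (simp add: has_real_derivative_iff_has_vector_derivative)
      show "continuous_on {u..v} (\<lambda>x. - q x)"
        by (rule continuous_on_minus[OF continuous_on_subset[OF cq]]) simp
    qed
    then show ?thesis by simp
  qed
  have FTC2: "(LINT x|lborel. indicator {0..a} x *\<^sub>R (x * q x)) \<le> (LINT x|lborel. indicator {0..a} x *\<^sub>R p x)"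
  proof -
    have "(LINT x|lborel. indicator {0..a} x *\<^sub>R (p x - x * q x)) = a * p a - 0 * p 0"
    proof (rule integral_FTC_Icc)
      have "((\<lambda>x. x * p x) has_real_derivative (1 * p x + - q x * x)) (at x)" for x
        by (rule DERIV_mult[OF DERIV_ident dp])
      from has_field_derivative_at_within[OF this]
      show "((\<lambda>x. x * p x) has_vector_derivative (p x - x * q x)) (at x within {0..a})" for x
        by (simp add: has_real_derivative_iff_has_vector_derivative algebra_simps)
      have "continuous_on UNIV (\<lambda>x. p x - x * q x)"
        by (intro continuous_intros cp cq)
      then show "continuous_on {0..a} (\<lambda>x. p x - x * q x)"
        by (rule continuous_on_subset) simp
    qed (use a in simp)
    moreover have "(LINT x|lborel. indicator {0..a} x *\<^sub>R (p x - x * q x)) =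
      (LINT x|lborel. indicator {0..a} x *\<^sub>R p x) - (LINT x|lborel. indicator {0..a} x *\<^sub>R (x * q x))"
      unfolding scaleR_diff_right
      by (rule Bochner_Integration.integral_diff) (intro intc continuous_intros cp cq)+
    ultimately show ?thesis using mult_nonneg_nonneg[of a "p a"] a pa by simp
  qed
  have iK: "integrable (lborel \<Otimes>\<^sub>M lborel) (case_prod K)"
  proof (rule lborel_pair.Fubini_integrable)
    show meas: "case_prod K \<in> borel_measurable (lborel \<Otimes>\<^sub>M lborel)"
      unfolding K_def by measurable
    have b: "norm (K s x) \<le> norm (G' s) * norm (q' x)" for s x
      by (auto simp: K_def)
    have iKs: "integrable lborel (\<lambda>x. K s x)" for s
      by (rule Bochner_Integration.integrable_bound[OF integrable_mult_right[of "norm (G' s)", OF integrable_norm[OF iq]]])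
         (use b in \<open>auto simp: K_def\<close>)
    show "AE s in lborel. integrable lborel (\<lambda>x. case (s, x) of (x, xa) \<Rightarrow> K x xa)"
      using iKs by simp
    have "integrable lborel (\<lambda>s. LINT x|lborel. norm (K s x))"
    proof (rule Bochner_Integration.integrable_bound)
      show "integrable lborel (\<lambda>s. norm (G' s) * (LINT x|lborel. norm (q' x)))"
        using iG by simp
      show "(\<lambda>s. LINT x|lborel. norm (K s x)) \<in> borel_measurable lborel"
        using meas by (intro lborel.borel_measurable_lebesgue_integral) (simp add: case_prod_unfold)
      have "norm (LINT x|lborel. norm (K s x)) \<le> norm (norm (G' s) * (LINT x|lborel. norm (q' x)))" for s
      proof -
        have "(LINT x|lborel. norm (K s x)) \<le> (LINT x|lborel. norm (G' s) * norm (q' x))"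
          using b iKs iq by (intro integral_mono) auto
        also have "\<dots> = norm (G' s) * (LINT x|lborel. norm (q' x))" by simp
        finally show ?thesis by (simp add: abs_mult)
      qed
      then show "AE s in lborel. norm (LINT x|lborel. norm (K s x)) \<le> norm (norm (G' s) * (LINT x|lborel. norm (q' x)))"
        by simp
    qed
    then show "integrable lborel (\<lambda>s. LINT x|lborel. norm (case (s, x) of (x, xa) \<Rightarrow> K x xa))" by simp
  qed
  have K1: "(LINT x|lborel. K s x) = indicator {0..a} s *\<^sub>R ((p s - p a) *\<^sub>R G s)" for s
  proof (cases "s \<in> {0..a}")
    case True
    have "(LINT x|lborel. K s x) = (LINT x|lborel. (indicator {s..a} x *\<^sub>R q x) *\<^sub>R G s)"
      by (rule Bochner_Integration.integral_cong) (use True in \<open>auto simp: K_def q'_def G'_def indicator_def\<close>)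
    also have "\<dots> = (LINT x|lborel. indicator {s..a} x *\<^sub>R q x) *\<^sub>R G s"
      by (rule integral_scaleR_left) (rule intc[OF cq])
    also have "\<dots> = (p s - p a) *\<^sub>R G s" using True by (simp only: FTC atLeastAtMost_iff)
    finally show ?thesis using True by simp
  next
    case False
    then have "K s x = 0" for x by (simp add: K_def G'_def)
    then show ?thesis using False by simp
  qed
  have K2: "(LINT s|lborel. K s x) = q' x *\<^sub>R \<Psi> x" for x
  proof -
    have "(LINT s|lborel. K s x) = (LINT s|lborel. q' x *\<^sub>R (indicator {0..x} s *\<^sub>R G s))"
      by (rule Bochner_Integration.integral_cong) (auto simp: K_def q'_def G'_def indicator_def)
    also have "\<dots> = q' x *\<^sub>R \<Psi> x" unfolding \<Psi>_def by (rule integral_scaleR_right)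
    finally show ?thesis .
  qed
  have eqK: "(LINT s|lborel. indicator {0..a} s *\<^sub>R ((p s - p a) *\<^sub>R G s)) = (LINT x|lborel. q' x *\<^sub>R \<Psi> x)"
    using lborel_pair.Fubini_integral[OF iK] by (simp add: K1 K2)
  have i1: "integrable lborel (\<lambda>s. indicator {0..a} s *\<^sub>R ((p s - p a) *\<^sub>R G s))"
    using lborel_pair.integrable_fst[OF iK] by (simp add: K1)
  have i2: "integrable lborel (\<lambda>x. q' x *\<^sub>R \<Psi> x)"
    using lborel_pair.integrable_snd[OF iK] by (simp add: K2)
  have "(LINT s|lborel. indicator {0..a} s *\<^sub>R (p s *\<^sub>R G s)) =
      (LINT s|lborel. indicator {0..a} s *\<^sub>R ((p s - p a) *\<^sub>R G s) + p a *\<^sub>R G' s)"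
    by (rule Bochner_Integration.integral_cong) (auto simp: G'_def indicator_def algebra_simps)
  also have "\<dots> = (LINT x|lborel. q' x *\<^sub>R \<Psi> x) + p a *\<^sub>R (LINT s|lborel. G' s)"
    by (simp only: Bochner_Integration.integral_add[OF i1 integrable_scaleR_right[OF iG]] eqK integral_scaleR_right)
  finally have "norm (LINT s|lborel. indicator {0..a} s *\<^sub>R (p s *\<^sub>R G s)) \<le>
      norm (LINT x|lborel. q' x *\<^sub>R \<Psi> x) + norm (p a *\<^sub>R (LINT s|lborel. G' s))"
    by (simp only: norm_triangle_ineq)
  also have "norm (p a *\<^sub>R (LINT s|lborel. G' s)) \<le> p a * K0"
    using pa iG integral_norm_bound[of lborel G'] by (auto simp: K0_def intro!: mult_left_mono)
  also have "norm (LINT x|lborel. q' x *\<^sub>R \<Psi> x) \<le>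
     (LINT x|lborel. e * (indicator {0..a} x *\<^sub>R (x * q x)) + K0 * (indicator {\<delta>..a} x *\<^sub>R q x))"
  proof -
    have \<Psi>b: "norm (\<Psi> x) \<le> K0" if "x \<le> a" for x
    proof -
      have "\<Psi> x = (LINT s|lborel. indicator {0..x} s *\<^sub>R G' s)"
        unfolding \<Psi>_def by (rule Bochner_Integration.integral_cong) (use that in \<open>auto simp: indicator_def G'_def\<close>)
      then have "norm (\<Psi> x) \<le> (LINT s|lborel. norm (indicator {0..x} s *\<^sub>R G' s))"
        by (simp only: integral_norm_bound)
      also have "\<dots> \<le> K0" unfolding K0_def
      proof (rule integral_mono)
        show "integrable lborel (\<lambda>s. norm (indicator {0..x} s *\<^sub>R G' s))"
          by (rule integrable_norm[OF integrable_mult_indicator[OF _ iG]]) simp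
      qed (use iG in \<open>auto simp: indicator_def\<close>)
      finally show ?thesis .
    qed
    have K0: "0 \<le> K0" by (simp add: K0_def)
    have "norm (q' x *\<^sub>R \<Psi> x) \<le> e * (indicator {0..a} x *\<^sub>R (x * q x)) + K0 * (indicator {\<delta>..a} x *\<^sub>R q x)" for x
    proof (cases "0 \<le> x \<and> x \<le> a")
      case True
      have "norm (q' x *\<^sub>R \<Psi> x) = q x * norm (\<Psi> x)" using True q0[of x] by (simp add: q'_def)
      also have "\<dots> \<le> e * (x * q x) + K0 * (indicator {\<delta>..a} x * q x)"
      proof (cases "x < \<delta>")
        case T: True
        have "norm (\<Psi> x) \<le> e * x"
        proof (cases "x = 0")
          case True
          have "\<Psi> 0 = 0" unfolding \<Psi>_def
            by (rule integral_eq_zero_AE, rule AE_mp[OF AE_lborel_singleton[of 0]]) (auto simp: indicator_def)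
          then show ?thesis using True by simp
        qed (use \<Phi>[of x] T True in \<open>auto simp: \<Psi>_def\<close>)
        then have "q x * norm (\<Psi> x) \<le> q x * (e * x)" using q0[of x] True by (intro mult_left_mono) auto
        then show ?thesis using T by (auto simp: indicator_def mult_ac)
      next
        case False
        then have "q x * norm (\<Psi> x) \<le> q x * K0" using q0[of x] True \<Psi>b[of x] by (intro mult_left_mono) auto
        moreover have "0 \<le> e * (x * q x)" using e True q0[of x] by simp
        ultimately show ?thesis using False True by (auto simp: mult_ac)
      qed
      finally show ?thesis using True by simp
    qed (auto simp: q'_def indicator_def \<delta> order.trans[OF less_imp_le[OF \<delta>(1)]] dest: order.trans[OF less_imp_le[OF \<delta>(1)]])
    moreover have "integrable lborel (\<lambda>x. e * (indicator {0..a} x *\<^sub>R (x * q x)) + K0 * (indicator {\<delta>..a} x *\<^sub>R q x))"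
      by (intro Bochner_Integration.integrable_add integrable_mult_right intc continuous_intros cq)
    ultimately show ?thesis
      by (intro order_trans[OF integral_norm_bound] integral_mono integrable_norm i2)
  qed
  also have "(LINT x|lborel. e * (indicator {0..a} x *\<^sub>R (x * q x)) + K0 * (indicator {\<delta>..a} x *\<^sub>R q x)) =
      e * (LINT x|lborel. indicator {0..a} x *\<^sub>R (x * q x)) + K0 * (p \<delta> - p a)"
  proof -
    have i1: "integrable lborel (\<lambda>x. e * (indicator {0..a} x *\<^sub>R (x * q x)))"
      and i2: "integrable lborel (\<lambda>x. K0 * (indicator {\<delta>..a} x *\<^sub>R q x))"
      by (intro integrable_mult_right intc continuous_intros cq)+
    show ?thesis
      by (simp only: Bochner_Integration.integral_add[OF i1 i2] integral_mult_right_zero FTC[OF \<delta>(2)])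
  qed
  also have "e * (LINT x|lborel. indicator {0..a} x *\<^sub>R (x * q x)) \<le> e * (LINT x|lborel. indicator {0..a} x *\<^sub>R p x)"
    using FTC2 e by (rule mult_left_mono)
  finally show ?thesis by (simp add: K0_def G'_def algebra_simps)
qed


definition poisson_kernel :: "complex \<Rightarrow> complex \<Rightarrow> real" where
  "poisson_kernel w z = (1 - (norm w)\<^sup>2) / (norm (z - w))\<^sup>2"

definition poisson :: "(complex \<Rightarrow> complex) \<Rightarrow> complex \<Rightarrow> complex" where
  "poisson f w = (LINT z|\<mu>. of_real (poisson_kernel w z) * f z)"

lemma AE_circle_norm: "AE z in \<mu>. norm z = 1"
  using AE_space[of \<mu>] by simp

lemma integral_circle_cong:
  "(\<And>z. norm z = 1 \<Longrightarrow> f z = g z) \<Longrightarrow> integral\<^sup>L \<mu> f = integral\<^sup>L \<mu> g"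
  by (rule Bochner_Integration.integral_cong) auto

lemma circle_mult_cnj: "norm z = 1 \<Longrightarrow> z * cnj z = 1" "norm z = 1 \<Longrightarrow> cnj z * z = 1"
  by (simp_all add: complex_norm_square[symmetric] mult.commute[of "cnj z"])

lemma inverse_circle: "norm z = 1 \<Longrightarrow> inverse z = cnj z"
  by (rule inverse_unique[OF circle_mult_cnj(1)])

lemma powi_uminus_circle: "norm z = 1 \<Longrightarrow> z powi (- n) = cnj z powi n"
  by (simp add: power_int_minus power_int_inverse flip: inverse_circle)

lemma poisson_kernel_nonneg: "norm w < 1 \<Longrightarrow> 0 \<le> poisson_kernel w z"
  by (simp add: poisson_kernel_def abs_square_le_1)

text \<open>
With \<open>x = w z\<^sup>-\<^sup>1\<close> the two geometric series add up to \<open>1/(1 - x) + cnj x/(1 - cnj x)\<close>, which is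
\<open>(1 - \<bar>x\<bar>\<^sup>2)/\<bar>1 - x\<bar>\<^sup>2\<close>.
\<close>

lemma poisson_kernel_sums:
  assumes z: "norm z = 1" and w: "norm w < 1"
  shows "(\<lambda>n. w ^ n * cnj z ^ n + cnj w ^ Suc n * z ^ Suc n) sums of_real (poisson_kernel w z)"
proof -
  define x where "x = w * cnj z"
  have nx: "norm x < 1" using z w by (simp add: x_def norm_mult)
  have zz: "z * cnj z = 1" using z by (rule circle_mult_cnj) 
  have n1: "norm (z - w) = norm (1 - x)"
  proof -
    have "z - w = z * (1 - x)" using zz by (simp add: x_def algebra_simps)
    then show ?thesis using z by (simp add: norm_mult)
  qed
  have ne: "1 - x \<noteq> 0" using nx by auto
  have s1: "(\<lambda>n. x ^ n) sums (1 / (1 - x))" using geometric_sums[OF nx] .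
  have s2: "(\<lambda>n. cnj x * cnj x ^ n) sums (cnj x * (1 / (1 - cnj x)))"
    using nx by (intro sums_mult geometric_sums) simp
  have "of_real (poisson_kernel w z) = (1 / (1 - x)) + cnj x * (1 / (1 - cnj x))"
  proof -
    have a: "of_real ((norm (1 - x))\<^sup>2) = (1 - x) * (1 - cnj x)"
      by (simp add: complex_norm_square[of "1 - x"] del: of_real_power)
    have b: "of_real ((norm w)\<^sup>2) = x * cnj x"
    proof -
      have "x * cnj x = (w * cnj w) * (z * cnj z)" by (simp add: x_def)
      then show ?thesis by (simp add: zz complex_norm_square del: of_real_power)
    qed
    have "1 - cnj x \<noteq> 0" using ne by (metis complex_cnj_one complex_cnj_diff complex_cnj_zero_iff)
    then show ?thesis using ne
      by (simp add: poisson_kernel_def n1 a b of_real_divide field_simps del: of_real_power)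
  qed
  moreover have "(\<lambda>n. x ^ n + cnj x * cnj x ^ n) = (\<lambda>n. w ^ n * cnj z ^ n + cnj w ^ Suc n * z ^ Suc n)"
    by (simp add: fun_eq_iff x_def power_mult_distrib)
  ultimately show ?thesis using sums_add[OF s1 s2] by simp
qed

lemma integrable_circle_mult_bounded:
  fixes f g :: "complex \<Rightarrow> complex"
  assumes f: "integrable \<mu> f" and g: "g \<in> borel_measurable \<mu>" and b: "AE z in \<mu>. norm (g z) \<le> C"
  shows "integrable \<mu> (\<lambda>z. g z * f z)"
proof (rule Bochner_Integration.integrable_bound)
  show "integrable \<mu> (\<lambda>z. C * norm (f z))" using f by simp
  show "(\<lambda>z. g z * f z) \<in> borel_measurable \<mu>" using f g by simp
  show "AE z in \<mu>. norm (g z * f z) \<le> norm (C * norm (f z))"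
    using b
  proof eventually_elim
    case (elim z)
    then have "norm (g z) * norm (f z) \<le> C * norm (f z)" by (rule mult_right_mono) simp
    also have "\<dots> \<le> norm (C * norm (f z))" by (simp del: norm_mult)
    finally show ?case by (simp add: norm_mult)
  qed
qed

lemma fourier_coeff_nat: "fourier_coeff f (int n) = (LINT z|\<mu>. f z * cnj z ^ n)"
  unfolding fourier_coeff_def by (rule integral_circle_cong) (simp add: powi_uminus_circle)

lemma fourier_coeff_neg: "fourier_coeff f (- int n) = (LINT z|\<mu>. f z * z ^ n)"
  unfolding fourier_coeff_def by (rule integral_circle_cong) simp

lemma measurable_id_circle [measurable]: "(\<lambda>z. z) \<in> borel_measurable \<mu>"
  by (rule borel_measurable_circle_borel) simp

lemma measurable_cnj_circle [measurable]: "cnj \<in> borel_measurable \<mu>"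
  by (rule borel_measurable_circle_continuous) (intro continuous_intros)

lemma integrable_circle_monomials:
  assumes f: "integrable \<mu> f"
  shows "integrable \<mu> (\<lambda>z. cnj z ^ n * f z)" "integrable \<mu> (\<lambda>z. z ^ n * f z)"
  by (rule integrable_circle_mult_bounded[OF f, where C=1]; use AE_circle_norm in \<open>auto simp: norm_power elim!: eventually_mono\<close>)+

text \<open>
The Poisson integral at \<open>w\<close> depends on the Fourier coefficients only. This is how statements about
coefficients become statements about functions.
\<close>

lemma poisson_sums:
  assumes f: "integrable \<mu> f" and w: "norm w < 1"
  shows "(\<lambda>n. w ^ n * fourier_coeff f (int n) + cnj w ^ Suc n * fourier_coeff f (- int (Suc n))) sums poisson f w"
proof -
  define g where "g n z = w ^ n * (cnj z ^ n * f z) + cnj w ^ Suc n * (z ^ Suc n * f z)" for n z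
  have ig: "integrable \<mu> (g n)" for n
    unfolding g_def by (intro Bochner_Integration.integrable_add integrable_mult_right integrable_circle_monomials f)
  have Ig: "integral\<^sup>L \<mu> (g n) = w ^ n * fourier_coeff f (int n) + cnj w ^ Suc n * fourier_coeff f (- int (Suc n))" for n
    unfolding g_def fourier_coeff_nat fourier_coeff_neg
    by (subst Bochner_Integration.integral_add)
       (auto intro!: integrable_mult_right integrable_circle_monomials f simp del: power_Suc of_nat_Suc simp: mult.commute[of "f _"])
  have b: "norm (g n z) \<le> 2 * norm (f z) * norm w ^ n" if "norm z = 1" for n z
  proof -
    have "norm (g n z) \<le> norm w ^ n * norm (f z) + norm w ^ Suc n * norm (f z)"
      unfolding g_def using that by (intro order_trans[OF norm_triangle_ineq]) (simp add: norm_mult norm_power)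
    also have "\<dots> \<le> norm w ^ n * norm (f z) + norm w ^ n * norm (f z)"
      using w power_decreasing[of n "Suc n" "norm w"] by (intro add_mono mult_right_mono) auto
    finally show ?thesis by (simp add: mult_ac)
  qed
  have "(\<lambda>n. integral\<^sup>L \<mu> (g n)) sums (LINT z|\<mu>. (\<Sum>n. g n z))"
  proof (rule sums_integral)
    show "integrable \<mu> (g n)" for n by (rule ig)
    show "AE z in \<mu>. summable (\<lambda>n. norm (g n z))"
      using AE_circle_norm
    proof eventually_elim
      case (elim z)
      have "summable (\<lambda>n. 2 * norm (f z) * norm w ^ n)" using w by (intro summable_mult summable_geometric) simp
      then show ?case by (rule summable_comparison_test'[where N=0]) (use b[OF elim] in simp)
    qed
    have "summable (\<lambda>n. (2 * (LINT z|\<mu>. norm (f z))) * norm w ^ n)" using w by (intro summable_mult summable_geometric) simp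
    then show "summable (\<lambda>n. LINT z|\<mu>. norm (g n z))"
    proof (rule summable_comparison_test'[where N=0])
      fix n
      have "(LINT z|\<mu>. norm (g n z)) \<le> (LINT z|\<mu>. 2 * norm (f z) * norm w ^ n)"
        using ig f b by (intro integral_mono) auto
      then show "norm (LINT z|\<mu>. norm (g n z)) \<le> (2 * (LINT z|\<mu>. norm (f z))) * norm w ^ n" by simp
    qed
  qed
  also have "(LINT z|\<mu>. (\<Sum>n. g n z)) = poisson f w"
    unfolding poisson_def
  proof (rule integral_circle_cong)
    fix z :: complex assume z: "norm z = 1"
    have "(\<lambda>n. (w ^ n * cnj z ^ n + cnj w ^ Suc n * z ^ Suc n) * f z) sums (of_real (poisson_kernel w z) * f z)"
      by (rule sums_mult2[OF poisson_kernel_sums[OF z w]])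
    moreover have "g n z = (w ^ n * cnj z ^ n + cnj w ^ Suc n * z ^ Suc n) * f z" for n
      by (simp add: g_def algebra_simps)
    ultimately show "(\<Sum>n. g n z) = of_real (poisson_kernel w z) * f z" by (simp add: sums_iff)
  qed
  finally show ?thesis by (simp only: Ig)
qed

text \<open>
Substituting \<open>a z\<close> for \<open>z\<close> multiplies the integral by \<open>a\<^sup>n\<close>; for \<open>a = cis (1/n)\<close> this factor is
\<open>cis 1 \<noteq> 1\<close>.
\<close>

lemma integral_circle_powi: "(LINT z|\<mu>. z powi n) = (if n = 0 then 1 else 0)"
proof (cases "n = 0")
  case False
  define a where "a = cis (1 / real_of_int n)"
  have a: "norm a = 1" by (simp add: a_def)
  have m: "(\<lambda>z. z powi n) \<in> borel_measurable \<mu>"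
    by (rule borel_measurable_circle_continuous) (auto intro!: continuous_intros)
  have "(LINT z|\<mu>. z powi n) = (LINT z|\<mu>. (a * z) powi n)"
    using integral_circle_mult(1)[OF m a] by simp
  also have "\<dots> = a powi n * (LINT z|\<mu>. z powi n)"
    by (simp add: power_int_mult_distrib)
  also have "a powi n = cis 1" using False by (simp add: a_def cis_power_int)
  finally have "(1 - cis 1) * (LINT z|\<mu>. z powi n) = 0" by (simp add: algebra_simps)
  moreover have "cis 1 \<noteq> 1"
  proof
    assume "cis 1 = 1"
    then have "sin (1::real) = 0" by (metis cis.sel(2) one_complex.sel(2))
    moreover have "sin (1::real) > 0" using pi_gt3 by (intro sin_gt_zero) auto
    ultimately show False by simp
  qed
  ultimately show ?thesis using False by simp
qed simp

lemma poisson_one: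
  assumes "norm w < 1"
  shows "(LINT z|\<mu>. poisson_kernel w z) = 1"
proof -
  have "fourier_coeff (\<lambda>z. 1) n = (if n = 0 then 1 else 0)" for n
    using integral_circle_powi[of "- n"] by (simp add: fourier_coeff_def)
  then have "(\<lambda>n. if n = 0 then 1 else 0) sums poisson (\<lambda>z. 1) w"
    using poisson_sums[of "\<lambda>z. 1" w] assms by (simp cong: if_cong add: if_distrib[of "(*) _"])
  moreover have "(\<lambda>n::nat. if n = 0 then 1 else 0) sums (1::complex)"
    using sums_single[of 0 "\<lambda>_. 1::complex"] by simp
  ultimately have "poisson (\<lambda>z. 1) w = 1" using sums_unique2 by blast
  then have "of_real (LINT z|\<mu>. poisson_kernel w z) = (1::complex)"
    by (simp add: poisson_def)
  then show ?thesis using of_real_eq_1_iff by blast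
qed


text \<open>
For a function that is invariant under conjugation the lower half circle contributes as much as the
upper one.
\<close>

lemma integral_circle_even:
  fixes g :: "complex \<Rightarrow> complex"
  assumes g: "g \<in> borel_measurable \<mu>" "integrable \<mu> g" and even: "\<And>z. norm z = 1 \<Longrightarrow> g (cnj z) = g z"
  shows "integrable lborel (\<lambda>s. indicator {0..pi} s *\<^sub>R g (cis s))" (is ?int)
    and "integral\<^sup>L \<mu> g = (1 / pi) *\<^sub>R (LINT s|lborel. indicator {0..pi} s *\<^sub>R g (cis s))" (is ?eq)
proof -
  define F where "F s = g (cis s)" for s
  have sym: "F (2 * pi - s) = F s" for s
    using even[of "cis s"] by (simp add: F_def cis_cnj cis_divide[symmetric] cis_inverse[symmetric] inverse_eq_divide)
  have iF: "integrable lborel (\<lambda>s. indicator {0..<2 * pi} s *\<^sub>R F s)"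
    using integrable_circle_iff[OF g(1)] g(2) by (simp add: set_integrable_def F_def)
  have sub: "integrable lborel (\<lambda>s. indicator {u..v} s *\<^sub>R F s)" if "0 \<le> u" "v < 2 * pi" for u v
    by (rule Bochner_Integration.integrable_cong[THEN iffD2, OF refl _ integrable_mult_indicator[OF _ iF, of "{u..v}"]])
       (use that in \<open>auto simp: indicator_def\<close>)
  show ?int using sub[of 0 pi] by (simp add: F_def)
  have m: "(\<lambda>s. indicator {0..<2 * pi} s *\<^sub>R F s) \<in> borel_measurable borel"
    using borel_measurable_integrable[OF iF] by simp
  have i2: "integrable lborel (\<lambda>s. indicator {pi<..<2 * pi} s *\<^sub>R F s)"
    by (rule Bochner_Integration.integrable_cong[THEN iffD2, OF refl _ integrable_mult_indicator[OF _ iF, of "{pi<..<2 * pi}"]])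
       (auto simp: indicator_def)
  have "(LINT s|lborel. indicator {0..<2 * pi} s *\<^sub>R F s) =
     (LINT s|lborel. indicator {0..pi} s *\<^sub>R F s + indicator {pi<..<2 * pi} s *\<^sub>R F s)"
    using pi_gt3 by (intro Bochner_Integration.integral_cong) (auto simp: indicator_def)
  also have "\<dots> = (LINT s|lborel. indicator {0..pi} s *\<^sub>R F s) + (LINT s|lborel. indicator {pi<..<2 * pi} s *\<^sub>R F s)"
    by (rule Bochner_Integration.integral_add[OF sub i2]) auto
  also have "(LINT s|lborel. indicator {pi<..<2 * pi} s *\<^sub>R F s) =
      (LINT s|lborel. indicator {pi<..<2 * pi} (2 * pi + (-1) * s) *\<^sub>R F (2 * pi + (-1) * s))"
    by (subst lborel_integral_real_affine[of "-1" _ "2 * pi"]) auto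
  also have "\<dots> = (LINT s|lborel. indicator {0..pi} s *\<^sub>R F s)"
  proof (rule integral_cong_AE)
    show "AE s in lborel. indicator {pi<..<2 * pi} (2 * pi + (-1) * s) *\<^sub>R F (2 * pi + (-1) * s) = indicator {0..pi} s *\<^sub>R F s"
      using AE_lborel_singleton[of 0] AE_lborel_singleton[of pi]
      by eventually_elim (auto simp: indicator_def sym)
    have "(\<lambda>s. indicator {pi<..<2 * pi} s *\<^sub>R F s) \<in> borel_measurable borel"
      using borel_measurable_integrable[OF i2] by simp
    then show "(\<lambda>s. indicator {pi<..<2 * pi} (2 * pi + (-1) * s) *\<^sub>R F (2 * pi + (-1) * s)) \<in> borel_measurable lborel"
      by measurable
    show "(\<lambda>s. indicator {0..pi} s *\<^sub>R F s) \<in> borel_measurable lborel"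
      using borel_measurable_integrable[OF sub[of 0 pi]] by simp
  qed
  finally have "(LINT s|lborel. indicator {0..<2 * pi} s *\<^sub>R F s) = 2 *\<^sub>R (LINT s|lborel. indicator {0..pi} s *\<^sub>R F s)"
    by (simp add: scaleR_2)
  then show ?eq
    by (simp add: integral_circle_eq[OF g(1)] set_lebesgue_integral_def F_def)
qed

text \<open>
Lebesgue's differentiation theorem to the right of the point. Differentiation to the left follows by applying it to
the reflected function.
\<close>

lemma lebesgue_differentiation_real:
  fixes f :: "real \<Rightarrow> complex"
  assumes f: "integrable lborel f"
  shows "AE x in lborel. \<forall>e>0. \<exists>d>0. \<forall>h. 0 < h \<and> h < d \<longrightarrow>
     norm ((LINT s|lborel. indicator {0..h} s *\<^sub>R f (x + s)) - of_real h * f x) \<le> e * h"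
proof -
  have fl: "integrable lebesgue f" using f by (simp add: integrable_completion)
  have hk: "f integrable_on cbox a b" "integral (cbox a b) f = (LINT s|lborel. indicator {a..b} s *\<^sub>R f s)" for a b
  proof -
    have "set_integrable lebesgue {a..b} f"
      unfolding set_integrable_def using fl by (intro integrable_mult_indicator) auto
    from set_lebesgue_integral_eq_integral[OF this]
    have 1: "f integrable_on {a..b}" and 2: "(LINT x:{a..b}|lebesgue. f x) = integral {a..b} f" by auto
    show "f integrable_on cbox a b" using 1 by simp
    have "(\<lambda>s. indicator {a..b} s *\<^sub>R f s) \<in> borel_measurable lborel"
      using borel_measurable_integrable[OF f] by (intro borel_measurable_scaleR) auto
    from integral_completion[OF this] 2
    show "integral (cbox a b) f = (LINT s|lborel. indicator {a..b} s *\<^sub>R f s)"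
      by (simp add: set_lebesgue_integral_def)
  qed
  obtain N where N: "negligible N" "\<And>x e. x \<notin> N \<Longrightarrow> 0 < e \<Longrightarrow>
      \<exists>d>0. \<forall>h. 0 < h \<and> h < d \<longrightarrow> norm (integral (cbox x (x + h *\<^sub>R One)) f /\<^sub>R h ^ DIM(real) - f x) < e"
    using integrable_ccontinuous_explicit[of f] hk(1) by blast
  have "AE x in lebesgue. x \<notin> N"
    using N(1) by (simp add: AE_not_in negligible_iff_null_sets)
  then have "AE x in lborel. x \<notin> N" by (simp add: AE_completion_iff)
  then show ?thesis
  proof eventually_elim
    case (elim x)
    show ?case
    proof (intro allI impI)
      fix e :: real assume "e > 0"
      then obtain d where d: "d > 0" "\<And>h. 0 < h \<and> h < d \<Longrightarrow> norm (integral (cbox x (x + h *\<^sub>R One)) f /\<^sub>R h ^ DIM(real) - f x) < e"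
        using N(2)[OF elim] by meson
      show "\<exists>d>0. \<forall>h. 0 < h \<and> h < d \<longrightarrow> norm ((LINT s|lborel. indicator {0..h} s *\<^sub>R f (x + s)) - of_real h * f x) \<le> e * h"
      proof (intro exI[of _ d] conjI allI impI d)
        fix h assume h: "0 < h \<and> h < d"
        have "integral (cbox x (x + h)) f = (LINT s|lborel. indicator {x..x+h} (x + 1 * s) *\<^sub>R f (x + 1 * s))"
          unfolding hk(2) by (subst lborel_integral_real_affine[of 1 _ x]) auto
        also have "\<dots> = (LINT s|lborel. indicator {0..h} s *\<^sub>R f (x + s))"
          by (rule Bochner_Integration.integral_cong) (auto simp: indicator_def)
        finally have I: "integral (cbox x (x + h)) f = (LINT s|lborel. indicator {0..h} s *\<^sub>R f (x + s))" .
        have "(LINT s|lborel. indicator {0..h} s *\<^sub>R f (x + s)) - of_real h * f x = h *\<^sub>R (integral (cbox x (x + h)) f /\<^sub>R h - f x)"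
          unfolding I[symmetric] using h by (simp add: scaleR_conv_of_real field_simps)
        then have "norm ((LINT s|lborel. indicator {0..h} s *\<^sub>R f (x + s)) - of_real h * f x) =
           h * norm (integral (cbox x (x + h)) f /\<^sub>R h - f x)" using h by simp
        also have "\<dots> \<le> h * e" using d(2)[OF h] h by (intro mult_left_mono) auto
        finally show "norm ((LINT s|lborel. indicator {0..h} s *\<^sub>R f (x + s)) - of_real h * f x) \<le> e * h"
          by (simp add: mult.commute)
      qed
    qed
  qed
qed


lemma poisson_kernel_real:
  "poisson_kernel (of_real r) (cis s) = (1 - r\<^sup>2) / (1 - 2 * r * cos s + r\<^sup>2)"
proof -
  have "(norm (cis s - of_real r))\<^sup>2 = (cos s - r)\<^sup>2 + (sin s)\<^sup>2"
    by (simp add: cmod_power2)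
  also have "\<dots> = 1 - 2 * r * cos s + r\<^sup>2"
    using sin_cos_squared_add[of s] by (simp add: power2_eq_square algebra_simps)
  finally show ?thesis by (simp add: poisson_kernel_def)
qed

lemma measurable_poisson_kernel: "norm w < 1 \<Longrightarrow> poisson_kernel w \<in> borel_measurable \<mu>"
  unfolding poisson_kernel_def
  by (rule borel_measurable_circle_continuous) (auto intro!: continuous_intros)

lemma poisson_kernel_bounded:
  assumes "norm w < 1" "norm z = 1"
  shows "poisson_kernel w z \<le> 1 / (1 - norm w)\<^sup>2"
proof -
  have "1 - norm w \<le> norm (z - w)" using norm_triangle_ineq2[of z w] assms by simp
  then have "(1 - norm w)\<^sup>2 \<le> (norm (z - w))\<^sup>2" using assms by (intro power_mono) auto
  then show ?thesis unfolding poisson_kernel_def using assms by (intro frac_le) auto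
qed

lemma integrable_poisson:
  fixes f :: "complex \<Rightarrow> complex"
  assumes "integrable \<mu> f" "norm w < 1"
  shows "integrable \<mu> (\<lambda>z. of_real (poisson_kernel w z) * f z)"
proof (rule integrable_circle_mult_bounded[OF assms(1), where C="1 / (1 - norm w)\<^sup>2"])
  show "(\<lambda>z. complex_of_real (poisson_kernel w z)) \<in> borel_measurable \<mu>"
    using measurable_poisson_kernel[OF assms(2)] by simp
  show "AE z in \<mu>. norm (complex_of_real (poisson_kernel w z)) \<le> 1 / (1 - norm w)\<^sup>2"
    using AE_circle_norm
    by eventually_elim (use assms poisson_kernel_bounded poisson_kernel_nonneg in simp)
qed

lemma poisson_rotate:
  assumes f: "f \<in> borel_measurable \<mu>" and \<zeta>: "norm \<zeta> = 1" and w: "norm w < 1"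
  shows "poisson f (w * \<zeta>) = poisson (\<lambda>z. f (\<zeta> * z)) w"
proof -
  have m: "(\<lambda>z. of_real (poisson_kernel (w * \<zeta>) z) * f z) \<in> borel_measurable \<mu>"
    using measurable_poisson_kernel[of "w * \<zeta>"] f assms by (simp add: norm_mult)
  have "poisson f (w * \<zeta>) = (LINT z|\<mu>. of_real (poisson_kernel (w * \<zeta>) (\<zeta> * z)) * f (\<zeta> * z))"
    unfolding poisson_def using integral_circle_mult(1)[OF m \<zeta>] by simp
  moreover have "poisson_kernel (w * \<zeta>) (\<zeta> * z) = poisson_kernel w z" for z
  proof -
    have "\<zeta> * z - w * \<zeta> = \<zeta> * (z - w)" by (simp add: algebra_simps)
    then show ?thesis using \<zeta> by (simp add: poisson_kernel_def norm_mult)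
  qed
  ultimately show ?thesis by (simp add: poisson_def)
qed

lemma poisson_kernel_cnj: "poisson_kernel (of_real r) (cnj z) = poisson_kernel (of_real r) z"
proof -
  have "cnj z - of_real r = cnj (z - of_real r)" by simp
  then show ?thesis unfolding poisson_kernel_def by (simp only: complex_mod_cnj)
qed

lemma poisson_kernel_DERIV:
  assumes r: "0 \<le> r" "r < 1"
  defines "q \<equiv> \<lambda>x. (1 - r\<^sup>2) * (2 * r * sin x) / (1 - 2 * r * cos x + r\<^sup>2)\<^sup>2"
  shows "((\<lambda>s. poisson_kernel (of_real r) (cis s)) has_real_derivative - q x) (at x)"
    and "continuous_on UNIV q"
proof -
  have pos: "1 - 2 * r * cos x + r\<^sup>2 > 0" for x
  proof -
    have "0 < (1 - r)\<^sup>2" using r by simp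
    also have "\<dots> = 1 - 2 * r * 1 + r\<^sup>2" by (simp add: power2_eq_square algebra_simps)
    also have "\<dots> \<le> 1 - 2 * r * cos x + r\<^sup>2"
      using r mult_left_mono[OF cos_le_one[of x], of "2 * r"] by simp
    finally show ?thesis .
  qed
  then have ne: "1 - 2 * r * cos x + r\<^sup>2 \<noteq> 0" for x by (metis less_irrefl)
  show "((\<lambda>s. poisson_kernel (of_real r) (cis s)) has_real_derivative - q x) (at x)"
  proof -
    have d: "((\<lambda>s. 1 - 2 * r * cos s + r\<^sup>2) has_real_derivative 2 * r * sin x) (at x)"
      by (auto intro!: derivative_eq_intros)
    show ?thesis
      using DERIV_divide[OF DERIV_const d ne, of "1 - r\<^sup>2"]
      by (simp add: poisson_kernel_real q_def power2_eq_square)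
  qed
  show "continuous_on UNIV q" unfolding q_def
    by (intro continuous_intros) (use ne in simp)
qed

lemma integrable_circle_cis:
  fixes f :: "complex \<Rightarrow> complex"
  assumes "integrable \<mu> f"
  shows "integrable lborel (\<lambda>t. indicator {0..<2 * pi} t *\<^sub>R f (cis t))"
  using integrable_circle_iff[of f] assms by (auto simp: set_integrable_def)

text \<open>
Fatou's theorem: Poisson integrals of integrable functions have radial limits almost everywhere. By
rotation and by the symmetry of the kernel, the error at \<open>\<zeta> = cis t\<close> is half the Poisson average of
\<open>h(z) = f(\<zeta> z) + f(\<zeta> cnj z) - 2 f(\<zeta>)\<close> over the upper half circle. At almost every \<open>t\<close> the primitive of
\<open>s \<mapsto> h(cis s)\<close> is \<open>o(s)\<close>, by Lebesgue differentiation to the right and to the left of \<open>t\<close>, and the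
bound for decreasing kernels applies, because the kernel decreases on \<open>[0, \<pi>]\<close> and tends to \<open>0\<close> at every
fixed \<open>\<delta> > 0\<close>.
\<close>

theorem fatou_radial_limit:
  assumes f: "integrable \<mu> f"
  shows "AE \<zeta> in \<mu>. ((\<lambda>r. poisson f (of_real r * \<zeta>)) \<longlongrightarrow> f \<zeta>) (at_left 1)"
proof (rule AE_circleI)
  have fm [measurable]: "f \<in> borel_measurable \<mu>" using f by simp
  define F where "F t = f (cis t)" for t
  have per: "F (t + 2 * pi) = F t" "F (t - 2 * pi) = F t" for t
    by (simp_all add: F_def flip: cis_mult cis_divide)
  define F0 where "F0 t = indicator {0..<2 * pi} t *\<^sub>R F t" for t
  have iF0: "integrable lborel F0"
    using integrable_circle_cis[OF f] by (simp add: F0_def[abs_def] F_def)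
  \<comment> \<open>\<open>F\<close> is only locally integrable; three periods suffice, since \<open>t + s\<close> and \<open>t - s\<close> stay in \<open>[- \<pi>, 3\<pi>)\<close>.\<close>
  define F1 where "F1 t = F0 t + F0 (2 * pi + 1 * t) + F0 (- 2 * pi + 1 * t)" for t
  have iF1: "integrable lborel F1" unfolding F1_def
    by (intro Bochner_Integration.integrable_add iF0 lborel_integrable_real_affine) auto
  have F1: "F1 t = F t" if "- 2 * pi \<le> t" "t < 4 * pi" for t
    using that per[of t] by (auto simp: F1_def F0_def indicator_def algebra_simps)
  have iF2: "integrable lborel (\<lambda>t. F1 (0 + (-1) * t))"
    by (rule lborel_integrable_real_affine[OF iF1]) simp
  have AE1: "AE x in lborel. \<forall>e>0. \<exists>d>0. \<forall>h. 0 < h \<and> h < d \<longrightarrow>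
     norm ((LINT s|lborel. indicator {0..h} s *\<^sub>R F1 (x + s)) - of_real h * F1 x) \<le> e * h"
    by (rule lebesgue_differentiation_real[OF iF1])
  define Q where "Q x \<longleftrightarrow> (\<forall>e>0. \<exists>d>0. \<forall>h. 0 < h \<and> h < d \<longrightarrow>
     norm ((LINT s|lborel. indicator {0..h} s *\<^sub>R F1 (0 + (-1) * (x + s))) - of_real h * F1 (0 + (-1) * x)) \<le> e * h)" for x
  have AE0: "AE x in lborel. Q x"
    unfolding Q_def by (rule lebesgue_differentiation_real[OF iF2])
  then have "AE x in distr lborel borel uminus. Q x"
    by (simp only: lborel_distr_uminus)
  then have AE3: "AE x in lborel. Q (- x)"
    by (rule AE_distrD[rotated]) simp
  have AE2: "AE x in lborel. \<forall>e>0. \<exists>d>0. \<forall>h. 0 < h \<and> h < d \<longrightarrow>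
     norm ((LINT s|lborel. indicator {0..h} s *\<^sub>R F1 (x - s)) - of_real h * F1 x) \<le> e * h"
    using AE3 by eventually_elim (simp add: Q_def)
  from AE1 AE2 show "AE t in lborel. 0 \<le> t \<and> t < 2 * pi \<longrightarrow>
      ((\<lambda>r. poisson f (of_real r * cis t)) \<longlongrightarrow> f (cis t)) (at_left 1)"
  proof eventually_elim
    case (elim t)
    show ?case
    proof
      assume t: "0 \<le> t \<and> t < 2 * pi"
      define \<zeta> where "\<zeta> = cis t"
      have \<zeta>: "norm \<zeta> = 1" by (simp add: \<zeta>_def)
      define h where "h z = f (\<zeta> * z) + f (\<zeta> * cnj z) - 2 * f \<zeta>" for z
      have f1: "integrable \<mu> (\<lambda>z. f (\<zeta> * z))" using integral_circle_mult(2)[OF fm \<zeta>] f by simp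
      have f1m: "(\<lambda>z. f (\<zeta> * z)) \<in> borel_measurable \<mu>" using f1 by simp
      have f2: "integrable \<mu> (\<lambda>z. f (\<zeta> * cnj z))" using integral_circle_cnj(2)[OF f1m] f1 by simp
      have ih: "integrable \<mu> h" unfolding h_def using f1 f2 by simp
      have hm: "h \<in> borel_measurable \<mu>" using ih by simp
      have heven: "h (cnj z) = h z" for z by (simp add: h_def)
      have ihc: "integrable lborel (\<lambda>s. indicator {0..pi} s *\<^sub>R h (cis s))"
        by (rule integral_circle_even(1)[OF hm ih heven])
      define P where "P r s = poisson_kernel (of_real r) (cis s)" for r s
      define K where "K = (LINT s|lborel. norm (indicator {0..pi} s *\<^sub>R h (cis s)))"
      have h_small: "\<exists>d>0. \<forall>x. 0 < x \<and> x < d \<longrightarrow> norm (LINT s|lborel. indicator {0..x} s *\<^sub>R h (cis s)) \<le> e * x" if "e > 0" for e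
      proof -
        obtain d1 where d1: "d1 > 0" "\<And>x. 0 < x \<and> x < d1 \<Longrightarrow>
            norm ((LINT s|lborel. indicator {0..x} s *\<^sub>R F1 (t + s)) - of_real x * F1 t) \<le> e / 2 * x"
          using elim(1) \<open>e > 0\<close> by (meson half_gt_zero)
        obtain d2 where d2: "d2 > 0" "\<And>x. 0 < x \<and> x < d2 \<Longrightarrow>
            norm ((LINT s|lborel. indicator {0..x} s *\<^sub>R F1 (t - s)) - of_real x * F1 t) \<le> e / 2 * x"
          using elim(2) \<open>e > 0\<close> by (meson half_gt_zero)
        show ?thesis
        proof (intro exI[of _ "min (min d1 d2) pi"] conjI allI impI)
          fix x assume x: "0 < x \<and> x < min (min d1 d2) pi"
          have i1: "integrable lborel (\<lambda>s. indicator {0..x} s *\<^sub>R F1 (t + 1 * s))"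
            by (intro integrable_mult_indicator lborel_integrable_real_affine iF1) auto
          have i2: "integrable lborel (\<lambda>s. indicator {0..x} s *\<^sub>R F1 (t + (-1) * s))"
            by (intro integrable_mult_indicator lborel_integrable_real_affine iF1) auto
          have i3: "integrable lborel (\<lambda>s. indicator {0..x} s *\<^sub>R (2 * F1 t))"
            using x by (intro integrable_scaleR_left integrable_real_indicator) auto
          have "(LINT s|lborel. indicator {0..x} s *\<^sub>R h (cis s)) =
             (LINT s|lborel. indicator {0..x} s *\<^sub>R F1 (t + 1 * s) + indicator {0..x} s *\<^sub>R F1 (t + (-1) * s) - indicator {0..x} s *\<^sub>R (2 * F1 t))"
            by (rule Bochner_Integration.integral_cong)
               (use t x in \<open>auto simp: indicator_def F1 F_def h_def \<zeta>_def cis_mult cis_cnj\<close>)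
          also have "\<dots> = (LINT s|lborel. indicator {0..x} s *\<^sub>R F1 (t + 1 * s)) + (LINT s|lborel. indicator {0..x} s *\<^sub>R F1 (t + (-1) * s)) - (LINT s|lborel. indicator {0..x} s *\<^sub>R (2 * F1 t))"
            by (simp only: Bochner_Integration.integral_diff[OF Bochner_Integration.integrable_add[OF i1 i2] i3] Bochner_Integration.integral_add[OF i1 i2])
          also have "(LINT s|lborel. indicator {0..x} s *\<^sub>R (2 * F1 t)) = 2 * (of_real x * F1 t)"
            using x by (subst integral_scaleR_left) (auto simp: scaleR_conv_of_real)
          finally have E: "(LINT s|lborel. indicator {0..x} s *\<^sub>R h (cis s)) =
             (((LINT s|lborel. indicator {0..x} s *\<^sub>R F1 (t + s)) - of_real x * F1 t)
              + ((LINT s|lborel. indicator {0..x} s *\<^sub>R F1 (t - s)) - of_real x * F1 t))"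
            by (simp add: algebra_simps)
          have "norm (LINT s|lborel. indicator {0..x} s *\<^sub>R h (cis s)) \<le> e / 2 * x + e / 2 * x"
            unfolding E
            by (rule order_trans[OF norm_triangle_ineq add_mono[OF d1(2) d2(2)]]) (use x in auto)
          then show "norm (LINT s|lborel. indicator {0..x} s *\<^sub>R h (cis s)) \<le> e * x" by (simp add: algebra_simps)
        qed (use d1 d2 in auto)
      qed
      have key: "poisson f (of_real r * \<zeta>) - f \<zeta> = (1 / (2 * pi)) *\<^sub>R (LINT s|lborel. indicator {0..pi} s *\<^sub>R (P r s *\<^sub>R h (cis s)))"
        and Pint: "(LINT s|lborel. indicator {0..pi} s *\<^sub>R P r s) = pi" if r: "0 \<le> r" "r < 1" for r
      proof -
        have w: "norm (complex_of_real r) < 1" using r by simp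
        let ?k = "\<lambda>z. poisson_kernel (complex_of_real r) z"
        have km: "(\<lambda>z. of_real (?k z) * f (\<zeta> * z)) \<in> borel_measurable \<mu>"
          using integrable_poisson[OF f1 w] by simp
        have e1: "poisson f (of_real r * \<zeta>) = (LINT z|\<mu>. of_real (?k z) * f (\<zeta> * z))"
          using poisson_rotate[OF fm \<zeta> w] by (simp add: poisson_def)
        have e2: "poisson f (of_real r * \<zeta>) = (LINT z|\<mu>. of_real (?k z) * f (\<zeta> * cnj z))"
          unfolding e1 using integral_circle_cnj(1)[OF km] by (simp add: poisson_kernel_cnj)
        have e3: "(LINT z|\<mu>. of_real (?k z) * f \<zeta>) = f \<zeta>"
          using poisson_one[OF w] by simp
        have ik: "integrable \<mu> (\<lambda>z. of_real (?k z) * f \<zeta>)"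
          by (rule integrable_poisson[OF _ w]) simp
        have "(LINT z|\<mu>. of_real (?k z) * h z) = (LINT z|\<mu>. of_real (?k z) * f (\<zeta> * z) + of_real (?k z) * f (\<zeta> * cnj z) - 2 * (of_real (?k z) * f \<zeta>))"
          by (rule integral_circle_cong) (simp add: h_def algebra_simps)
        also have "\<dots> = (LINT z|\<mu>. of_real (?k z) * f (\<zeta> * z)) + (LINT z|\<mu>. of_real (?k z) * f (\<zeta> * cnj z)) - 2 * (LINT z|\<mu>. of_real (?k z) * f \<zeta>)"
          using integrable_poisson[OF f1 w] integrable_poisson[OF f2 w] ik
          by (subst Bochner_Integration.integral_diff, simp, simp, subst Bochner_Integration.integral_add) simp_all
        also have "\<dots> = 2 * (poisson f (of_real r * \<zeta>) - f \<zeta>)"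
          unfolding e3 e1[symmetric] e2[symmetric] by simp
        finally have "2 * (poisson f (of_real r * \<zeta>) - f \<zeta>) = (LINT z|\<mu>. of_real (?k z) * h z)" ..
        also have "\<dots> = (1 / pi) *\<^sub>R (LINT s|lborel. indicator {0..pi} s *\<^sub>R (of_real (?k (cis s)) * h (cis s)))"
        proof (rule integral_circle_even(2))
          show "integrable \<mu> (\<lambda>z. of_real (?k z) * h z)" by (rule integrable_poisson[OF ih w])
          then show "(\<lambda>z. of_real (?k z) * h z) \<in> borel_measurable \<mu>" by simp
        qed (simp add: heven poisson_kernel_cnj)
        finally have "poisson f (of_real r * \<zeta>) - f \<zeta> = (1 / 2) *\<^sub>R ((1 / pi) *\<^sub>R (LINT s|lborel. indicator {0..pi} s *\<^sub>R (of_real (?k (cis s)) * h (cis s))))"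
          by (simp add: scaleR_conv_of_real field_simps)
        then show "poisson f (of_real r * \<zeta>) - f \<zeta> = (1 / (2 * pi)) *\<^sub>R (LINT s|lborel. indicator {0..pi} s *\<^sub>R (P r s *\<^sub>R h (cis s)))"
          by (simp add: P_def scaleR_conv_of_real)
        have ik1: "integrable \<mu> (\<lambda>z. complex_of_real (?k z))"
          using integrable_poisson[of "\<lambda>_. 1", OF _ w] by simp
        have "(LINT z|\<mu>. complex_of_real (?k z)) = (1 / pi) *\<^sub>R (LINT s|lborel. indicator {0..pi} s *\<^sub>R complex_of_real (?k (cis s)))"
          by (rule integral_circle_even(2)) (use ik1 in \<open>simp_all add: poisson_kernel_cnj\<close>)
        also have "(LINT s|lborel. indicator {0..pi} s *\<^sub>R complex_of_real (?k (cis s))) = of_real (LINT s|lborel. indicator {0..pi} s *\<^sub>R P r s)"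
          unfolding P_def by (simp add: scaleR_conv_of_real del: integral_complex_of_real flip: integral_complex_of_real)
        finally have "complex_of_real 1 = of_real ((1 / pi) * (LINT s|lborel. indicator {0..pi} s *\<^sub>R P r s))"
          using poisson_one[OF w] by (simp add: scaleR_conv_of_real)
        then have "1 = (1 / pi) * (LINT s|lborel. indicator {0..pi} s *\<^sub>R P r s)"
          by (simp only: of_real_eq_iff)
        then show "(LINT s|lborel. indicator {0..pi} s *\<^sub>R P r s) = pi" by (simp add: field_simps)
      qed
      have "((\<lambda>r. poisson f (of_real r * \<zeta>) - f \<zeta>) \<longlongrightarrow> 0) (at_left 1)"
      proof (rule tendstoI)
        fix \<epsilon> :: real assume "\<epsilon> > 0"
        then obtain d where d: "d > 0" "\<And>x. 0 < x \<and> x < d \<Longrightarrow> norm (LINT s|lborel. indicator {0..x} s *\<^sub>R h (cis s)) \<le> \<epsilon> * x"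
          using h_small[of "\<epsilon>"] by auto
        define \<delta> where "\<delta> = min d pi"
        have \<delta>: "0 < \<delta>" "\<delta> \<le> pi" "\<delta> \<le> d" using d by (auto simp: \<delta>_def)
        have "cos \<delta> < cos 0" using \<delta> by (intro cos_monotone_0_pi) auto
        then have "((\<lambda>r. (1 - r\<^sup>2) / (1 - 2 * r * cos \<delta> + r\<^sup>2) * K) \<longlongrightarrow> ((1 - 1\<^sup>2) / (1 - 2 * 1 * cos \<delta> + 1\<^sup>2) * K)) (at_left 1)"
          by (intro tendsto_intros) auto
        then have "((\<lambda>r. P r \<delta> * K) \<longlongrightarrow> 0) (at_left 1)"
          by (simp add: P_def poisson_kernel_real)
        then have "\<forall>\<^sub>F r in at_left 1. P r \<delta> * K < \<epsilon>"
          using \<open>\<epsilon> > 0\<close> by (simp add: order_tendsto_iff)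
        moreover have "\<forall>\<^sub>F r in at_left 1. 0 \<le> r \<and> r < (1::real)"
          using eventually_at_left_real[of 0 1] by (auto elim!: eventually_mono)
        ultimately show "\<forall>\<^sub>F r in at_left 1. dist (poisson f (of_real r * \<zeta>) - f \<zeta>) 0 < \<epsilon>"
        proof eventually_elim
          case (elim r)
          have "norm (LINT s|lborel. indicator {0..pi} s *\<^sub>R (P r s *\<^sub>R h (cis s))) \<le>
            \<epsilon> * (LINT s|lborel. indicator {0..pi} s *\<^sub>R P r s) + P r \<delta> * (LINT s|lborel. norm (indicator {0..pi} s *\<^sub>R h (cis s)))"
            unfolding P_def
          proof (rule decreasing_kernel_bound[OF ihc])
            show "((\<lambda>s. poisson_kernel (of_real r) (cis s)) has_real_derivative - ((1 - r\<^sup>2) * (2 * r * sin x) / (1 - 2 * r * cos x + r\<^sup>2)\<^sup>2)) (at x)" for x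
              by (rule poisson_kernel_DERIV) (use elim in auto)
            show "continuous_on UNIV (\<lambda>x. (1 - r\<^sup>2) * (2 * r * sin x) / (1 - 2 * r * cos x + r\<^sup>2)\<^sup>2)"
              by (rule poisson_kernel_DERIV) (use elim in auto)
            show "0 \<le> (1 - r\<^sup>2) * (2 * r * sin x) / (1 - 2 * r * cos x + r\<^sup>2)\<^sup>2" if "0 \<le> x" "x \<le> pi" for x
              using that elim sin_ge_zero[of x] by (auto intro!: divide_nonneg_nonneg mult_nonneg_nonneg simp: abs_square_le_1)
            show "0 \<le> poisson_kernel (complex_of_real r) (cis pi)"
              by (rule poisson_kernel_nonneg) (use elim in auto)
          qed (use \<delta> d \<open>\<epsilon> > 0\<close> in auto)
          also have "\<dots> = \<epsilon> * pi + P r \<delta> * K" using elim by (simp only: Pint K_def)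
          also have "\<dots> < \<epsilon> * pi + \<epsilon>" using elim by simp
          finally have "norm (poisson f (of_real r * \<zeta>) - f \<zeta>) < (\<epsilon> * pi + \<epsilon>) / (2 * pi)"
            using elim by (simp add: key divide_strict_right_mono)
          also have "\<dots> \<le> \<epsilon>" using \<open>\<epsilon> > 0\<close> pi_gt3 by (simp add: field_simps)
          finally show ?case by simp
        qed
      qed
      then show "((\<lambda>r. poisson f (of_real r * cis t)) \<longlongrightarrow> f (cis t)) (at_left 1)"
        by (simp add: LIM_zero_iff \<zeta>_def)
    qed
  qed
qed

text \<open>
Equal coefficients give equal Poisson integrals, hence equal radial limits.
\<close>

lemma fourier_coeff_unique:
  assumes f: "integrable \<mu> f" and g: "integrable \<mu> g" and eq: "\<And>n. fourier_coeff f n = fourier_coeff g n"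
  shows "AE z in \<mu>. f z = g z"
proof -
  have "poisson f w = poisson g w" if "norm w < 1" for w
    using poisson_sums[OF f that] poisson_sums[OF g that] by (simp add: eq sums_unique2 sums_iff)
  then have *: "poisson f (of_real r * z) = poisson g (of_real r * z)" if "norm z = 1" "0 < r" "r < 1" for r z
    using that by (simp add: norm_mult)
  show ?thesis
    using fatou_radial_limit[OF f] fatou_radial_limit[OF g] AE_circle_norm
  proof eventually_elim
    case (elim z)
    have "\<forall>\<^sub>F r in at_left (1::real). poisson f (of_real r * z) = poisson g (of_real r * z)"
      using eventually_at_left_real[of 0 "1::real"] by (auto elim!: eventually_mono simp: * elim(3))
    then have "((\<lambda>r. poisson g (of_real r * z)) \<longlongrightarrow> f z) (at_left 1)"
      using elim(1) by (simp add: tendsto_cong)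
    then show ?case using elim(2) by (rule tendsto_unique[rotated]) simp
  qed
qed

section \<open>Square integrable functions\<close>

lemma L2_measurable: "f \<in> L2 \<Longrightarrow> f \<in> borel_measurable \<mu>"
  by (simp add: L2_def)

lemma L2_integrable_square: "f \<in> L2 \<Longrightarrow> integrable \<mu> (\<lambda>z. (norm (f z))\<^sup>2)"
  by (simp add: L2_def)

lemma L2_norm_nonneg [simp]: "0 \<le> L2_norm f"
  by (simp add: L2_norm_def)

lemma L2_norm_square: "(L2_norm f)\<^sup>2 = (LINT z|\<mu>. (norm (f z))\<^sup>2)"
  by (simp add: L2_norm_def)

lemma L2_bounded:
  assumes "f \<in> borel_measurable \<mu>" "AE z in \<mu>. norm (f z) \<le> C"
  shows "f \<in> L2"
proof -
  have "integrable \<mu> (\<lambda>z. (norm (f z))\<^sup>2)"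
  proof (rule circle.integrable_const_bound[of _ "C\<^sup>2"])
    show "AE z in \<mu>. norm ((norm (f z))\<^sup>2) \<le> C\<^sup>2"
      using assms(2) by eventually_elim (simp add: power_mono)
  qed (use assms in simp)
  then show ?thesis using assms by (simp add: L2_def)
qed

lemma Linf_subset_L2: "Linf \<subseteq> L2"
  by (auto simp: Linf_def intro: L2_bounded)

lemma Linf_continuous: "continuous_on (sphere 0 1) f \<Longrightarrow> f \<in> Linf"
proof -
  assume c: "continuous_on (sphere 0 1) f"
  then have "bounded (f ` sphere 0 1)"
    by (intro compact_imp_bounded compact_continuous_image) auto
  then obtain C where "\<And>z. norm z = 1 \<Longrightarrow> norm (f z) \<le> C"
    by (auto simp: bounded_iff) (metis mem_sphere_0)
  then have "AE z in \<mu>. norm (f z) \<le> C" using AE_circle_norm by (auto elim: eventually_mono)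
  then show "f \<in> Linf" using borel_measurable_circle_continuous[OF c] by (auto simp: Linf_def)
qed

lemma L2_add:
  assumes "f \<in> L2" "g \<in> L2"
  shows "(\<lambda>z. f z + g z) \<in> L2"
proof -
  have "integrable \<mu> (\<lambda>z. (norm (f z + g z))\<^sup>2)"
  proof (rule Bochner_Integration.integrable_bound)
    show "integrable \<mu> (\<lambda>z. 2 * (norm (f z))\<^sup>2 + 2 * (norm (g z))\<^sup>2)"
      using assms by (simp add: L2_integrable_square)
    have "(norm (f z + g z))\<^sup>2 \<le> 2 * (norm (f z))\<^sup>2 + 2 * (norm (g z))\<^sup>2" for z
    proof -
      have "(norm (f z + g z))\<^sup>2 \<le> (norm (f z) + norm (g z))\<^sup>2" by (intro power_mono norm_triangle_ineq) auto
      then show ?thesis using sum_squares_bound[of "norm (f z)" "norm (g z)"] by (simp add: power2_sum)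
    qed
    then show "AE z in \<mu>. norm ((norm (f z + g z))\<^sup>2) \<le> norm (2 * (norm (f z))\<^sup>2 + 2 * (norm (g z))\<^sup>2)"
      by (simp add: order_trans[OF _ abs_ge_self])
  qed (use assms in \<open>auto simp: L2_def\<close>)
  then show ?thesis using borel_measurable_add[OF assms[THEN L2_measurable]] by (simp add: L2_def)
qed

lemma L2_mult:
  assumes "f \<in> L2" "\<phi> \<in> Linf"
  shows "(\<lambda>z. \<phi> z * f z) \<in> L2"
proof -
  from assms obtain C where C: "\<phi> \<in> borel_measurable \<mu>" "AE z in \<mu>. norm (\<phi> z) \<le> C" by (auto simp: Linf_def)
  have "integrable \<mu> (\<lambda>z. (norm (\<phi> z * f z))\<^sup>2)"
  proof (rule Bochner_Integration.integrable_bound)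
    show "integrable \<mu> (\<lambda>z. C\<^sup>2 * (norm (f z))\<^sup>2)" using assms by (simp add: L2_integrable_square)
    show "AE z in \<mu>. norm ((norm (\<phi> z * f z))\<^sup>2) \<le> norm (C\<^sup>2 * (norm (f z))\<^sup>2)"
      using C(2) by eventually_elim (auto simp: norm_mult power_mult_distrib abs_mult intro!: mult_right_mono power_mono)
  qed (use C assms in \<open>auto simp: L2_def\<close>)
  then show ?thesis using borel_measurable_times[OF C(1) L2_measurable[OF assms(1)]] by (simp add: L2_def)
qed

lemma Linf_const [simp]: "(\<lambda>z. c) \<in> Linf"
  by (auto simp: Linf_def)

lemma L2_const [simp]: "(\<lambda>z. c) \<in> L2"
  using Linf_const Linf_subset_L2 by blast

lemma L2_cmult: "f \<in> L2 \<Longrightarrow> (\<lambda>z. c * f z) \<in> L2"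
  by (rule L2_mult) simp_all

lemma L2_uminus: "f \<in> L2 \<Longrightarrow> (\<lambda>z. - f z) \<in> L2"
  using L2_cmult[of f "-1"] by simp

lemma L2_diff: "f \<in> L2 \<Longrightarrow> g \<in> L2 \<Longrightarrow> (\<lambda>z. f z - g z) \<in> L2"
  using L2_add[of f "\<lambda>z. - g z"] L2_uminus[of g] by simp

lemma L2_sum: "(\<And>i. i \<in> I \<Longrightarrow> f i \<in> L2) \<Longrightarrow> (\<lambda>z. \<Sum>i\<in>I. f i z) \<in> L2"
  by (induction I rule: infinite_finite_induct) (auto intro: L2_add)

lemma L2_cnj: "f \<in> L2 \<Longrightarrow> (\<lambda>z. cnj (f z)) \<in> L2"
  by (auto simp: L2_def intro!: measurable_compose[of f \<mu> borel cnj borel] borel_measurable_continuous_onI continuous_intros)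

lemma Linf_mult:
  assumes "f \<in> Linf" "g \<in> Linf"
  shows "(\<lambda>z. f z * g z) \<in> Linf"
proof -
  obtain B C where f: "f \<in> borel_measurable \<mu>" "AE z in \<mu>. norm (f z) \<le> B"
    and g: "g \<in> borel_measurable \<mu>" "AE z in \<mu>. norm (g z) \<le> C" using assms by (auto simp: Linf_def)
  have "AE z in \<mu>. norm (f z * g z) \<le> B * C"
    using f(2) g(2) by eventually_elim (metis mult_mono' norm_ge_zero norm_mult)
  then show ?thesis using borel_measurable_times[OF f(1) g(1)] by (auto simp: Linf_def)
qed

lemma Linf_diff:
  assumes "f \<in> Linf" "g \<in> Linf"
  shows "(\<lambda>z. f z - g z) \<in> Linf"
proof -
  obtain B C where f: "f \<in> borel_measurable \<mu>" "AE z in \<mu>. norm (f z) \<le> B"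
    and g: "g \<in> borel_measurable \<mu>" "AE z in \<mu>. norm (g z) \<le> C" using assms by (auto simp: Linf_def)
  have "AE z in \<mu>. norm (f z - g z) \<le> B + C"
    using f(2) g(2) by eventually_elim (metis add_mono norm_triangle_ineq4 order_trans)
  then show ?thesis using borel_measurable_diff[OF f(1) g(1)] by (auto simp: Linf_def)
qed

lemma Linf_cnj: "f \<in> Linf \<Longrightarrow> (\<lambda>z. cnj (f z)) \<in> Linf"
  using L2_measurable[OF L2_cnj[of f]] Linf_subset_L2 by (auto simp: Linf_def)

lemma L2_powi [simp]: "(\<lambda>z. z powi n) \<in> L2" and Linf_powi [simp]: "(\<lambda>z. z powi n) \<in> Linf"
proof -
  show "(\<lambda>z. z powi n) \<in> Linf" by (rule Linf_continuous) (auto intro!: continuous_intros)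
  then show "(\<lambda>z. z powi n) \<in> L2" using Linf_subset_L2 by blast
qed

lemma L2_integrable_mult:
  assumes "f \<in> L2" "g \<in> L2"
  shows "integrable \<mu> (\<lambda>z. f z * g z)" "integrable \<mu> (\<lambda>z. norm (f z) * norm (g z))"
proof -
  show *: "integrable \<mu> (\<lambda>z. f z * g z)"
  proof (rule Bochner_Integration.integrable_bound)
    show "integrable \<mu> (\<lambda>z. (norm (f z))\<^sup>2 + (norm (g z))\<^sup>2)" using assms by (simp add: L2_integrable_square)
    have "norm (f z * g z) \<le> (norm (f z))\<^sup>2 + (norm (g z))\<^sup>2" for z
      using sum_squares_bound[of "norm (f z)" "norm (g z)"] mult_nonneg_nonneg[of "norm (f z)" "norm (g z)"]
      by (simp add: norm_mult del: mult_nonneg_nonneg)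
    then show "AE z in \<mu>. norm (f z * g z) \<le> norm ((norm (f z))\<^sup>2 + (norm (g z))\<^sup>2)"
      by (simp add: order_trans[OF _ abs_ge_self])
  qed (use assms in \<open>auto simp: L2_def\<close>)
  show "integrable \<mu> (\<lambda>z. norm (f z) * norm (g z))"
    using integrable_norm[OF *] by (simp add: norm_mult)
qed

lemma L2_integrable: "f \<in> L2 \<Longrightarrow> integrable \<mu> f"
  using L2_integrable_mult(1)[of f "\<lambda>_. 1"] by simp

lemma L2_integrable_inner: "f \<in> L2 \<Longrightarrow> g \<in> L2 \<Longrightarrow> integrable \<mu> (\<lambda>z. f z * cnj (g z))"
  by (rule L2_integrable_mult(1)[OF _ L2_cnj])

lemma L2_inner_add_left: "f \<in> L2 \<Longrightarrow> g \<in> L2 \<Longrightarrow> h \<in> L2 \<Longrightarrow> L2_inner (\<lambda>z. f z + g z) h = L2_inner f h + L2_inner g h"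
  unfolding L2_inner_def distrib_right
  by (rule Bochner_Integration.integral_add) (auto intro: L2_integrable_inner)

lemma L2_inner_diff_left: "f \<in> L2 \<Longrightarrow> g \<in> L2 \<Longrightarrow> h \<in> L2 \<Longrightarrow> L2_inner (\<lambda>z. f z - g z) h = L2_inner f h - L2_inner g h"
  unfolding L2_inner_def left_diff_distrib
  by (rule Bochner_Integration.integral_diff) (auto intro: L2_integrable_inner)

lemma L2_inner_cmult_left: "L2_inner (\<lambda>z. c * f z) h = c * L2_inner f h"
  by (simp add: L2_inner_def mult.assoc)

lemma L2_inner_commute: "L2_inner g f = cnj (L2_inner f g)"
  using Bochner_Integration.integral_cnj[of \<mu> "\<lambda>z. f z * cnj (g z)"] by (simp add: L2_inner_def mult.commute)

lemma L2_inner_cmult_right: "L2_inner f (\<lambda>z. c * h z) = cnj c * L2_inner f h"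
  by (simp add: L2_inner_def mult_ac)

lemma L2_inner_add_right: "f \<in> L2 \<Longrightarrow> g \<in> L2 \<Longrightarrow> h \<in> L2 \<Longrightarrow> L2_inner h (\<lambda>z. f z + g z) = L2_inner h f + L2_inner h g"
  using L2_inner_add_left[of f g h] by (simp add: L2_inner_commute[of h])

lemma L2_inner_self: "L2_inner f f = of_real ((L2_norm f)\<^sup>2)"
  by (simp add: L2_inner_def L2_norm_square complex_norm_square[symmetric] del: of_real_power)

text \<open>
The Cauchy-Schwarz inequality, from the quadratic polynomial \<open>t \<mapsto> \<integral> (t \<bar>f\<bar> + \<bar>g\<bar>)\<^sup>2\<close> being nonnegative.
\<close>

lemma integral_norm_mult_le:
  assumes f: "f \<in> L2" and g: "g \<in> L2"
  shows "(LINT z|\<mu>. norm (f z) * norm (g z)) \<le> L2_norm f * L2_norm g"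
proof -
  define I where "I = (LINT z|\<mu>. norm (f z) * norm (g z))"
  define a where "a = (L2_norm f)\<^sup>2"
  define b where "b = (L2_norm g)\<^sup>2"
  have q: "0 \<le> t\<^sup>2 * a + 2 * t * I + b" for t
  proof -
    have "0 \<le> (LINT z|\<mu>. (t * norm (f z) + norm (g z))\<^sup>2)" by simp
    also have "\<dots> = (LINT z|\<mu>. t\<^sup>2 * (norm (f z))\<^sup>2 + 2 * t * (norm (f z) * norm (g z)) + (norm (g z))\<^sup>2)"
      by (rule Bochner_Integration.integral_cong) (auto simp: power2_sum power_mult_distrib)
    also have "\<dots> = t\<^sup>2 * a + 2 * t * I + b"
      unfolding a_def b_def I_def L2_norm_square
      using L2_integrable_square[OF f] L2_integrable_square[OF g] L2_integrable_mult(2)[OF f g]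
      by (subst Bochner_Integration.integral_add Bochner_Integration.integral_add | simp)+
    finally show ?thesis .
  qed
  have I: "0 \<le> I" by (simp add: I_def)
  have "I\<^sup>2 \<le> a * b"
  proof (cases "a = 0")
    case True
    have "I = 0"
    proof (rule ccontr)
      assume "I \<noteq> 0"
      then show False using q[of "- (b + 1) / (2 * I)"] True by (simp add: field_simps)
    qed
    then show ?thesis using True by simp
  next
    case False
    then have "a > 0" by (auto simp: a_def)
    have "0 \<le> (- I / a)\<^sup>2 * a + 2 * (- I / a) * I + b" by (rule q)
    then show ?thesis using \<open>a > 0\<close> by (simp add: field_simps power2_eq_square)
  qed
  then have "I\<^sup>2 \<le> (L2_norm f * L2_norm g)\<^sup>2" by (simp add: a_def b_def power_mult_distrib)
  then show ?thesis unfolding I_def[symmetric] by (rule power2_le_imp_le) simp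
qed

lemma L2_Cauchy_Schwarz:
  assumes "f \<in> L2" "g \<in> L2"
  shows "norm (L2_inner f g) \<le> L2_norm f * L2_norm g"
proof -
  have "norm (L2_inner f g) \<le> (LINT z|\<mu>. norm (f z) * norm (g z))"
    using integral_norm_bound[of \<mu> "\<lambda>z. f z * cnj (g z)"] by (simp add: L2_inner_def norm_mult)
  also have "\<dots> \<le> L2_norm f * L2_norm g" by (rule integral_norm_mult_le[OF assms])
  finally show ?thesis .
qed

lemma L2_norm_const [simp]: "L2_norm (\<lambda>z. c) = norm c"
  by (simp add: L2_norm_def)

lemma integral_norm_le_L2_norm: "f \<in> L2 \<Longrightarrow> (LINT z|\<mu>. norm (f z)) \<le> L2_norm f"
  using integral_norm_mult_le[of f "\<lambda>_. 1"] by simp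

lemma L2_norm_cong_AE:
  assumes "AE z in \<mu>. f z = g z" "f \<in> borel_measurable \<mu>" "g \<in> borel_measurable \<mu>"
  shows "L2_norm f = L2_norm g"
  unfolding L2_norm_def using assms by (intro arg_cong[where f=sqrt] integral_cong_AE) (auto elim: eventually_mono)

lemma L2_norm_cmult: "L2_norm (\<lambda>z. c * f z) = norm c * L2_norm f"
  by (simp add: L2_norm_def norm_mult power_mult_distrib real_sqrt_mult)

lemma L2_norm_minus: "L2_norm (\<lambda>z. - f z) = L2_norm f"
  by (simp add: L2_norm_def)

lemma L2_norm_minus_commute: "L2_norm (\<lambda>z. f z - g z) = L2_norm (\<lambda>z. g z - f z)"
  by (simp add: L2_norm_def norm_minus_commute)

lemma L2_norm_add_square:
  assumes "f \<in> L2" "g \<in> L2"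
  shows "(L2_norm (\<lambda>z. f z + g z))\<^sup>2 = (L2_norm f)\<^sup>2 + 2 * Re (L2_inner f g) + (L2_norm g)\<^sup>2"
proof -
  have "of_real ((L2_norm (\<lambda>z. f z + g z))\<^sup>2) = L2_inner f f + L2_inner g f + (L2_inner f g + L2_inner g g)"
    using assms unfolding L2_inner_self[symmetric]
    by (simp add: L2_inner_add_left L2_inner_add_right L2_add)
  then have "complex_of_real ((L2_norm (\<lambda>z. f z + g z))\<^sup>2) =
     of_real ((L2_norm f)\<^sup>2) + (cnj (L2_inner f g) + L2_inner f g) + of_real ((L2_norm g)\<^sup>2)"
    by (simp add: L2_inner_self L2_inner_commute[of g f] del: of_real_power)
  then have "Re (complex_of_real ((L2_norm (\<lambda>z. f z + g z))\<^sup>2)) =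
     Re (of_real ((L2_norm f)\<^sup>2) + (cnj (L2_inner f g) + L2_inner f g) + of_real ((L2_norm g)\<^sup>2))" by simp
  then show ?thesis by (simp del: of_real_power)
qed

lemma L2_norm_diff_square:
  assumes "f \<in> L2" "g \<in> L2"
  shows "(L2_norm (\<lambda>z. f z - g z))\<^sup>2 = (L2_norm f)\<^sup>2 - 2 * Re (L2_inner f g) + (L2_norm g)\<^sup>2"
  using L2_norm_add_square[OF assms(1) L2_uminus[OF assms(2)]] L2_inner_cmult_right[of f "-1" g]
  by (simp add: L2_norm_minus)

lemma L2_norm_triangle:
  assumes "f \<in> L2" "g \<in> L2"
  shows "L2_norm (\<lambda>z. f z + g z) \<le> L2_norm f + L2_norm g"
proof (rule power2_le_imp_le)
  have "Re (L2_inner f g) \<le> L2_norm f * L2_norm g"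
    using complex_Re_le_cmod L2_Cauchy_Schwarz[OF assms] order_trans by blast
  then show "(L2_norm (\<lambda>z. f z + g z))\<^sup>2 \<le> (L2_norm f + L2_norm g)\<^sup>2"
    by (simp add: L2_norm_add_square[OF assms] power2_sum)
qed simp

lemma L2_norm_triangle_diff:
  assumes "f \<in> L2" "g \<in> L2" "h \<in> L2"
  shows "L2_norm (\<lambda>z. f z - h z) \<le> L2_norm (\<lambda>z. f z - g z) + L2_norm (\<lambda>z. g z - h z)"
  using L2_norm_triangle[OF L2_diff[OF assms(1,2)] L2_diff[OF assms(2,3)]] by simp

lemma L2_norm_mult_le:
  assumes f: "f \<in> L2" and \<phi>: "\<phi> \<in> borel_measurable \<mu>" "AE z in \<mu>. norm (\<phi> z) \<le> C"
  shows "L2_norm (\<lambda>z. \<phi> z * f z) \<le> C * L2_norm f"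
proof -
  have C: "0 \<le> C"
  proof (rule ccontr)
    assume "\<not> 0 \<le> C"
    then have "AE z in \<mu>. False" using \<phi>(2) by (auto elim!: eventually_mono dest: order_trans[OF norm_ge_zero])
    from AE_E[OF this] obtain N where "{x \<in> space \<mu>. \<not> False} \<subseteq> N" "emeasure \<mu> N = 0" "N \<in> sets \<mu>" .
    then show False using emeasure_mono[of "sphere 0 1" N \<mu>] by (auto simp: subset_eq)
  qed
  have L: "(\<lambda>z. \<phi> z * f z) \<in> L2" using assms by (intro L2_mult) (auto simp: Linf_def)
  have "(L2_norm (\<lambda>z. \<phi> z * f z))\<^sup>2 \<le> (LINT z|\<mu>. C\<^sup>2 * (norm (f z))\<^sup>2)"
    unfolding L2_norm_square
  proof (rule integral_mono_AE)
    show "AE z in \<mu>. (norm (\<phi> z * f z))\<^sup>2 \<le> C\<^sup>2 * (norm (f z))\<^sup>2"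
      using \<phi>(2) by eventually_elim (auto simp: norm_mult power_mult_distrib intro!: mult_right_mono power_mono)
  qed (use L f L2_integrable_square in auto)
  also have "\<dots> = (C * L2_norm f)\<^sup>2" by (simp add: power_mult_distrib L2_norm_square)
  finally show ?thesis using C by (rule power2_le_imp_le[OF _ mult_nonneg_nonneg]) simp
qed

lemma L2_norm_eq_0_iff: "f \<in> L2 \<Longrightarrow> L2_norm f = 0 \<longleftrightarrow> (AE z in \<mu>. f z = 0)"
  unfolding L2_norm_def real_sqrt_eq_0_iff
  by (subst integral_nonneg_eq_0_iff_AE) (auto simp: L2_integrable_square)

text \<open>
Riesz-Fischer in its first form. A subsequence whose successive distances are at most \<open>2\<^sup>-\<^sup>k\<close> has
increments with summable integrals, so it converges almost everywhere; Fatou's lemma bounds the distance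
of every late member of the sequence to the limit.
\<close>

theorem L2_complete:
  assumes f: "\<And>n. f n \<in> L2"
    and cauchy: "\<And>e. e > 0 \<Longrightarrow> \<exists>N. \<forall>m\<ge>N. \<forall>n\<ge>N. L2_norm (\<lambda>z. f m z - f n z) < e"
  shows "\<exists>F\<in>L2. (\<lambda>n. L2_norm (\<lambda>z. f n z - F z)) \<longlonglongrightarrow> 0"
proof -
  have fm [measurable]: "f n \<in> borel_measurable \<mu>" for n by (rule L2_measurable[OF f])
  have "\<exists>s. \<forall>k. (\<forall>m\<ge>s k. \<forall>n\<ge>s k. L2_norm (\<lambda>z. f m z - f n z) < (1/2) ^ k) \<and> s k < s (Suc k)"
  proof (rule dependent_nat_choice)
    show "\<exists>N. \<forall>m\<ge>N. \<forall>n\<ge>N. L2_norm (\<lambda>z. f m z - f n z) < (1/2) ^ 0" by (rule cauchy) simp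
  next
    fix N k
    obtain M where M: "\<forall>m\<ge>M. \<forall>n\<ge>M. L2_norm (\<lambda>z. f m z - f n z) < (1/2) ^ Suc k"
      using cauchy[of "(1/2) ^ Suc k"] by auto
    then show "\<exists>y. (\<forall>m\<ge>y. \<forall>n\<ge>y. L2_norm (\<lambda>z. f m z - f n z) < (1/2) ^ Suc k) \<and> N < y"
      by (intro exI[of _ "max M (Suc N)"]) auto
  qed
  then obtain s where s: "\<And>k m n. m \<ge> s k \<Longrightarrow> n \<ge> s k \<Longrightarrow> L2_norm (\<lambda>z. f m z - f n z) < (1/2) ^ k"
    and s_mono: "\<And>k. s k < s (Suc k)" by blast
  have smono: "strict_mono s" using s_mono by (simp add: strict_mono_Suc_iff)
  define g where "g k z = f (s (Suc k)) z - f (s k) z" for k z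
  have gL: "g k \<in> L2" for k unfolding g_def by (intro L2_diff f)
  have gn: "(LINT z|\<mu>. norm (g k z)) \<le> (1/2) ^ k" for k
    using integral_norm_le_L2_norm[OF gL, of k] s[of k "s (Suc k)" "s k"] s_mono[of k] by (simp add: g_def[abs_def])
  have "AE z in \<mu>. summable (\<lambda>k. norm (g k z))"
  proof -
    have "(\<integral>\<^sup>+z. (\<Sum>k. ennreal (norm (g k z))) \<partial>\<mu>) = (\<Sum>k. \<integral>\<^sup>+z. ennreal (norm (g k z)) \<partial>\<mu>)"
      by (rule nn_integral_suminf) (use L2_measurable[OF gL] in simp)
    also have "\<dots> = (\<Sum>k. ennreal (LINT z|\<mu>. norm (g k z)))"
      by (intro suminf_cong nn_integral_eq_integral) (use L2_integrable[OF gL] in auto)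
    also have "\<dots> \<le> (\<Sum>k. ennreal ((1/2) ^ k))"
      by (intro suminf_le ennreal_leI gn) auto
    also have "\<dots> = ennreal (\<Sum>k. (1/2) ^ k)"
      by (intro suminf_ennreal2) (auto intro!: summable_geometric)
    also have "\<dots> < \<infinity>" by simp
    finally have "AE z in \<mu>. (\<Sum>k. ennreal (norm (g k z))) \<noteq> \<infinity>"
      by (intro nn_integral_PInf_AE) (use L2_measurable[OF gL] in auto)
    then show ?thesis
      by eventually_elim (auto intro!: summable_suminf_not_top)
  qed
  then have conv: "AE z in \<mu>. convergent (\<lambda>k. f (s k) z)"
  proof eventually_elim
    case (elim z)
    then have "summable (\<lambda>k. g k z)" by (rule summable_norm_cancel)
    then have "convergent (\<lambda>n. (\<Sum>k<n. g k z))" by (simp add: summable_iff_convergent)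
    then have "convergent (\<lambda>n. f (s 0) z + (\<Sum>k<n. g k z))"
      by (intro convergent_add convergent_const)
    moreover have "f (s 0) z + (\<Sum>k<n. g k z) = f (s n) z" for n
      using sum_lessThan_telescope[of "\<lambda>k. f (s k) z" n] by (simp add: g_def)
    ultimately show ?case by simp
  qed
  define F where "F z = lim (\<lambda>k. f (s k) z)" for z
  have Fm [measurable]: "F \<in> borel_measurable \<mu>" unfolding F_def by measurable
  have lim: "AE z in \<mu>. (\<lambda>k. f (s k) z) \<longlonglongrightarrow> F z"
    using conv by eventually_elim (simp add: F_def convergent_LIMSEQ_iff)
  have bound: "(\<integral>\<^sup>+z. ennreal ((norm (f n z - F z))\<^sup>2) \<partial>\<mu>) \<le> ennreal (e\<^sup>2)"
    if n: "\<And>m. m \<ge> N \<Longrightarrow> L2_norm (\<lambda>z. f n z - f m z) \<le> e" and e: "0 \<le> e" for n N e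
  proof -
    have "(\<integral>\<^sup>+z. ennreal ((norm (f n z - F z))\<^sup>2) \<partial>\<mu>) = (\<integral>\<^sup>+z. liminf (\<lambda>k. ennreal ((norm (f n z - f (s k) z))\<^sup>2)) \<partial>\<mu>)"
    proof (rule nn_integral_cong_AE, use lim in eventually_elim)
      case (elim z)
      have "(\<lambda>k. ennreal ((norm (f n z - f (s k) z))\<^sup>2)) \<longlonglongrightarrow> ennreal ((norm (f n z - F z))\<^sup>2)"
        by (intro tendsto_ennrealI tendsto_intros elim)
      then show ?case by (intro lim_imp_Liminf[symmetric]) auto
    qed
    also have "\<dots> \<le> liminf (\<lambda>k. \<integral>\<^sup>+z. ennreal ((norm (f n z - f (s k) z))\<^sup>2) \<partial>\<mu>)"
      by (rule nn_integral_liminf) measurable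
    also have "\<dots> \<le> ennreal (e\<^sup>2)"
    proof -
      have "(\<integral>\<^sup>+z. ennreal ((norm (f n z - f (s k) z))\<^sup>2) \<partial>\<mu>) \<le> ennreal (e\<^sup>2)" if "k \<ge> N" for k
      proof -
        have "(\<integral>\<^sup>+z. ennreal ((norm (f n z - f (s k) z))\<^sup>2) \<partial>\<mu>) = ennreal ((L2_norm (\<lambda>z. f n z - f (s k) z))\<^sup>2)"
          unfolding L2_norm_square using L2_integrable_square[OF L2_diff[OF f f]] by (intro nn_integral_eq_integral) auto
        also have "\<dots> \<le> ennreal (e\<^sup>2)"
          using n[of "s k"] that seq_suble[OF smono, of k] by (intro ennreal_leI power_mono) auto
        finally show ?thesis .
      qed
      then have "eventually (\<lambda>k. (\<integral>\<^sup>+z. ennreal ((norm (f n z - f (s k) z))\<^sup>2) \<partial>\<mu>) \<le> ennreal (e\<^sup>2)) sequentially"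
        using eventually_sequentially by blast
      then have "liminf (\<lambda>k. \<integral>\<^sup>+z. ennreal ((norm (f n z - f (s k) z))\<^sup>2) \<partial>\<mu>) \<le> liminf (\<lambda>k::nat. ennreal (e\<^sup>2))"
        by (rule Liminf_mono)
      then show ?thesis by (simp add: Liminf_const)
    qed
    finally show ?thesis .
  qed
  have dL: "(\<lambda>z. f n z - F z) \<in> L2" and dn: "L2_norm (\<lambda>z. f n z - F z) \<le> e"
    if n: "\<And>m. m \<ge> N \<Longrightarrow> L2_norm (\<lambda>z. f n z - f m z) \<le> e" and e: "0 \<le> e" for n N e
  proof -
    have "integrable \<mu> (\<lambda>z. (norm (f n z - F z))\<^sup>2)"
      using bound[OF n e] by (intro integrableI_bounded) (auto simp: less_top[symmetric] top_unique)
    then show L: "(\<lambda>z. f n z - F z) \<in> L2" by (simp add: L2_def)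
    have "ennreal ((L2_norm (\<lambda>z. f n z - F z))\<^sup>2) \<le> ennreal (e\<^sup>2)"
      using bound[OF n e] unfolding L2_norm_square by (subst nn_integral_eq_integral[symmetric]) (use L2_integrable_square[OF L] in auto)
    then have "(L2_norm (\<lambda>z. f n z - F z))\<^sup>2 \<le> e\<^sup>2" by simp
    then show "L2_norm (\<lambda>z. f n z - F z) \<le> e" using e by (rule power2_le_imp_le)
  qed
  show ?thesis
  proof (intro bexI[of _ F])
    show "(\<lambda>n. L2_norm (\<lambda>z. f n z - F z)) \<longlonglongrightarrow> 0"
    proof (rule LIMSEQ_I)
      fix e :: real assume "e > 0"
      then obtain N where N: "\<forall>m\<ge>N. \<forall>n\<ge>N. L2_norm (\<lambda>z. f m z - f n z) < e / 2" using cauchy[of "e / 2"] by auto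
      have "norm (L2_norm (\<lambda>z. f n z - F z) - 0) < e" if "n \<ge> N" for n
      proof -
        have "L2_norm (\<lambda>z. f n z - F z) \<le> e / 2"
          by (rule dn[of N]) (use N that \<open>e > 0\<close> in \<open>auto intro: less_imp_le\<close>)
        then show ?thesis using \<open>e > 0\<close> by simp
      qed
      then show "\<exists>no. \<forall>n\<ge>no. norm (L2_norm (\<lambda>z. f n z - F z) - 0) < e" by blast
    qed
    obtain N where N: "\<forall>m\<ge>N. \<forall>n\<ge>N. L2_norm (\<lambda>z. f m z - f n z) < 1" using cauchy[of 1] by auto
    then have "(\<lambda>z. f N z - F z) \<in> L2" by (intro dL[of N N 1]) (auto intro: less_imp_le)
    from L2_diff[OF f[of N] this] show "F \<in> L2" by simp
  qed
qed


text \<open>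
Elements of the space are functions, and a set of functions represents a closed subspace if it is
closed under limits in the seminorm \<^const>\<open>L2_norm\<close>. Closedness under equality almost everywhere is
then automatic, because a constant sequence converges to every function equal to it almost everywhere.
\<close>

definition closed_subspace :: "(complex \<Rightarrow> complex) set \<Rightarrow> bool" where
  "closed_subspace M \<longleftrightarrow> M \<subseteq> L2 \<and> (\<lambda>z. 0) \<in> M \<and> (\<forall>f\<in>M. \<forall>g\<in>M. (\<lambda>z. f z + g z) \<in> M) \<and>
     (\<forall>c. \<forall>f\<in>M. (\<lambda>z. c * f z) \<in> M) \<and>
     (\<forall>s. \<forall>F\<in>L2. (\<forall>n::nat. s n \<in> M) \<longrightarrow> (\<lambda>n. L2_norm (\<lambda>z. s n z - F z)) \<longlonglongrightarrow> 0 \<longrightarrow> F \<in> M)"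

lemma closed_subspaceD:
  assumes "closed_subspace M"
  shows "f \<in> M \<Longrightarrow> f \<in> L2" "(\<lambda>z. 0) \<in> M" "f \<in> M \<Longrightarrow> g \<in> M \<Longrightarrow> (\<lambda>z. f z + g z) \<in> M"
    "f \<in> M \<Longrightarrow> (\<lambda>z. c * f z) \<in> M"
    "F \<in> L2 \<Longrightarrow> (\<And>n::nat. s n \<in> M) \<Longrightarrow> (\<lambda>n. L2_norm (\<lambda>z. s n z - F z)) \<longlonglongrightarrow> 0 \<Longrightarrow> F \<in> M"
  using assms unfolding closed_subspace_def by blast+

lemma closed_subspace_cong_AE:
  assumes M: "closed_subspace M" and f: "f \<in> M" and g: "g \<in> L2" and ae: "AE z in \<mu>. f z = g z"
  shows "g \<in> M"
proof -
  have "L2_norm (\<lambda>z. f z - g z) = 0"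
    using ae closed_subspaceD(1)[OF M f] g by (subst L2_norm_eq_0_iff) (auto intro: L2_diff elim: eventually_mono)
  then show ?thesis using closed_subspaceD(5)[OF M g, of "\<lambda>_. f"] f by simp
qed

text \<open>
The nearest point of the subspace: a minimizing sequence is Cauchy by the parallelogram identity, and
the error of a nearest point is orthogonal to the subspace.
\<close>

theorem orthogonal_projection:
  assumes M: "closed_subspace M" and x: "x \<in> L2"
  shows "\<exists>p\<in>M. \<forall>m\<in>M. L2_inner (\<lambda>z. x z - p z) m = 0"
proof -
  note MsubL2 = closed_subspaceD(1)[OF M]
  define D where "D = (\<lambda>m. (L2_norm (\<lambda>z. x z - m z))\<^sup>2) ` M"
  define d where "d = Inf D"
  have Dne: "D \<noteq> {}" using closed_subspaceD(2)[OF M] by (auto simp: D_def)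
  have Dbdd: "bdd_below D" unfolding D_def by (rule bdd_belowI2[of _ 0]) simp
  have d_le: "d \<le> (L2_norm (\<lambda>z. x z - m z))\<^sup>2" if "m \<in> M" for m
    unfolding d_def using that Dbdd by (intro cInf_lower) (auto simp: D_def)
  have "\<exists>m\<in>M. (L2_norm (\<lambda>z. x z - m z))\<^sup>2 < d + 1 / Suc n" for n
  proof -
    have "\<exists>y\<in>D. y < d + 1 / Suc n" using cInf_lessD[OF Dne, of "d + 1 / Suc n"] by (simp add: d_def)
    then show ?thesis by (auto simp: D_def)
  qed
  then obtain m where m: "\<And>n. m n \<in> M" "\<And>n::nat. (L2_norm (\<lambda>z. x z - m n z))\<^sup>2 < d + 1 / Suc n" by metis
  have mL: "m n \<in> L2" for n by (rule MsubL2[OF m(1)])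
  have par: "(L2_norm (\<lambda>z. m j z - m k z))\<^sup>2 \<le> 2 / Suc j + 2 / Suc k" for j k
  proof -
    let ?u = "\<lambda>z. x z - m k z" and ?v = "\<lambda>z. x z - m j z"
    let ?h = "\<lambda>z. (1/2) * m j z + (1/2) * m k z"
    have h: "?h \<in> M" by (intro closed_subspaceD(3,4)[OF M] m)
    have L: "?u \<in> L2" "?v \<in> L2" by (intro L2_diff x mL)+
    have eq: "(\<lambda>z. ?u z + ?v z) = (\<lambda>z. 2 * (x z - ?h z))" by (auto simp: fun_eq_iff algebra_simps)
    have "(\<lambda>z. ?u z - ?v z) = (\<lambda>z. m j z - m k z)" by (auto simp: fun_eq_iff)
    then have "(L2_norm (\<lambda>z. m j z - m k z))\<^sup>2 = 2 * (L2_norm ?u)\<^sup>2 + 2 * (L2_norm ?v)\<^sup>2 - (L2_norm (\<lambda>z. ?u z + ?v z))\<^sup>2"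
      using L2_norm_diff_square[OF L] L2_norm_add_square[OF L] by simp
    also have "(L2_norm (\<lambda>z. ?u z + ?v z))\<^sup>2 = 4 * (L2_norm (\<lambda>z. x z - ?h z))\<^sup>2"
      unfolding eq L2_norm_cmult by (simp add: power_mult_distrib)
    finally show ?thesis using d_le[OF h] m(2)[of j] m(2)[of k] by simp
  qed
  have "\<exists>N. \<forall>j\<ge>N. \<forall>k\<ge>N. L2_norm (\<lambda>z. m j z - m k z) < e" if "e > 0" for e
  proof -
    obtain N where N: "4 / e\<^sup>2 < real N" using reals_Archimedean2 by blast
    have "L2_norm (\<lambda>z. m j z - m k z) < e" if "j \<ge> N" "k \<ge> N" for j k
    proof (rule power2_less_imp_less)
      have "0 < real N" using N \<open>e > 0\<close> by (meson divide_nonneg_nonneg less_le_trans le_less_trans zero_le_numeral zero_le_power2)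
      have "2 / real (Suc j) + 2 / real (Suc k) \<le> 2 / real N + 2 / real N"
        using that \<open>0 < real N\<close> by (intro add_mono divide_left_mono) auto
      also have "\<dots> = 4 / real N" by simp
      also have "\<dots> < e\<^sup>2" using N \<open>e > 0\<close> \<open>0 < real N\<close> by (simp add: field_simps)
      finally show "(L2_norm (\<lambda>z. m j z - m k z))\<^sup>2 < e\<^sup>2" using par[of j k] by linarith
    qed (use \<open>e > 0\<close> in simp)
    then show ?thesis by blast
  qed
  then obtain p where p: "p \<in> L2" "(\<lambda>n. L2_norm (\<lambda>z. m n z - p z)) \<longlonglongrightarrow> 0"
    using L2_complete[of m, OF mL] by blast
  have pM: "p \<in> M" by (rule closed_subspaceD(5)[OF M p(1) m(1) p(2)])
  have dp: "(L2_norm (\<lambda>z. x z - p z))\<^sup>2 \<le> d"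
  proof -
    have "L2_norm (\<lambda>z. x z - p z) \<le> sqrt (d + 1 / Suc n) + L2_norm (\<lambda>z. m n z - p z)" for n
      using L2_norm_triangle_diff[OF x mL[of n] p(1)] real_le_rsqrt[OF less_imp_le[OF m(2)[of n]]] by linarith
    moreover have "(\<lambda>n. sqrt (d + 1 / Suc n) + L2_norm (\<lambda>z. m n z - p z)) \<longlonglongrightarrow> sqrt (d + 0) + 0"
      by (intro tendsto_add tendsto_real_sqrt tendsto_const p(2) LIMSEQ_inverse_real_of_nat[unfolded inverse_eq_divide])
    ultimately have "L2_norm (\<lambda>z. x z - p z) \<le> sqrt d" by (intro LIMSEQ_le_const) auto
    moreover have "0 \<le> d" unfolding d_def by (rule cInf_greatest[OF Dne]) (auto simp: D_def)
    ultimately show ?thesis by (metis L2_norm_nonneg power_mono real_sqrt_pow2)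
  qed
  have "L2_inner (\<lambda>z. x z - p z) h = 0" if h: "h \<in> M" for h
  proof -
    define w where "w = L2_inner (\<lambda>z. x z - p z) h"
    have L: "(\<lambda>z. x z - p z) \<in> L2" "h \<in> L2" using x p(1) MsubL2[OF h] by (auto intro: L2_diff)
    \<comment> \<open>Moving the nearest point by \<open>t w h\<close> cannot decrease the distance; the linear term in \<open>t\<close> then forces \<open>w = 0\<close>.\<close>
    have le: "2 * t * (norm w)\<^sup>2 \<le> t\<^sup>2 * ((norm w)\<^sup>2 * (L2_norm h)\<^sup>2)" for t :: real
    proof -
      let ?c = "of_real t * w"
      have "(\<lambda>z. p z + ?c * h z) \<in> M" by (intro closed_subspaceD(3,4)[OF M] pM h)
      then have "d \<le> (L2_norm (\<lambda>z. x z - (p z + ?c * h z)))\<^sup>2" by (rule d_le)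
      also have "(\<lambda>z. x z - (p z + ?c * h z)) = (\<lambda>z. (x z - p z) - ?c * h z)" by auto
      also have "(L2_norm \<dots>)\<^sup>2 = (L2_norm (\<lambda>z. x z - p z))\<^sup>2 - 2 * Re (cnj ?c * w) + (norm ?c * L2_norm h)\<^sup>2"
        by (simp only: L2_norm_diff_square[OF L(1) L2_cmult[OF L(2)]] L2_inner_cmult_right L2_norm_cmult w_def)
      also have "Re (cnj ?c * w) = t * (norm w)\<^sup>2"
        by (simp add: cmod_power2) (simp add: power2_eq_square algebra_simps)
      finally show ?thesis using dp by (simp add: power_mult_distrib norm_mult)
    qed
    have "w = 0"
    proof (rule ccontr)
      assume "w \<noteq> 0"
      define t where "t = 1 / ((L2_norm h)\<^sup>2 + 1)"
      have "(L2_norm h)\<^sup>2 + 1 > 0" by (simp add: add_nonneg_pos)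
      then have t: "t > 0" "t * (L2_norm h)\<^sup>2 < 2" by (auto simp: t_def field_simps intro: add_nonneg_pos)
      have "t * (norm w)\<^sup>2 * 2 \<le> t * (norm w)\<^sup>2 * (t * (L2_norm h)\<^sup>2)"
        using le[of t] by (simp add: power2_eq_square mult_ac)
      then show False using t \<open>w \<noteq> 0\<close> by (simp add: mult_le_cancel_left)
    qed
    then show ?thesis by (simp add: w_def)
  qed
  then show ?thesis using pM by blast
qed

section \<open>Fourier series\<close>

lemma fourier_coeff_inner: "fourier_coeff f n = L2_inner f (\<lambda>z. z powi n)"
  unfolding fourier_coeff_def L2_inner_def
  by (rule integral_circle_cong) (simp add: powi_uminus_circle)

lemma L2_norm_powi [simp]: "L2_norm (\<lambda>z. z powi n) = 1"
proof -
  have "(LINT z|\<mu>. (norm (z powi n))\<^sup>2) = (LINT z|\<mu>. 1)"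
    by (rule integral_circle_cong) (simp add: norm_power_int)
  then show ?thesis by (simp add: L2_norm_def)
qed

lemma fourier_coeff_le: "f \<in> L2 \<Longrightarrow> norm (fourier_coeff f n) \<le> L2_norm f"
  using L2_Cauchy_Schwarz[OF _ L2_powi] by (simp add: fourier_coeff_inner)

lemma fourier_coeff_add: "f \<in> L2 \<Longrightarrow> g \<in> L2 \<Longrightarrow> fourier_coeff (\<lambda>z. f z + g z) n = fourier_coeff f n + fourier_coeff g n"
  by (simp add: fourier_coeff_inner L2_inner_add_left)

lemma fourier_coeff_diff: "f \<in> L2 \<Longrightarrow> g \<in> L2 \<Longrightarrow> fourier_coeff (\<lambda>z. f z - g z) n = fourier_coeff f n - fourier_coeff g n"
  by (simp add: fourier_coeff_inner L2_inner_diff_left)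

lemma fourier_coeff_cmult: "fourier_coeff (\<lambda>z. c * f z) n = c * fourier_coeff f n"
  by (simp add: fourier_coeff_inner L2_inner_cmult_left)

lemma fourier_coeff_cong_AE:
  assumes "AE z in \<mu>. f z = g z" "f \<in> borel_measurable \<mu>" "g \<in> borel_measurable \<mu>"
  shows "fourier_coeff f n = fourier_coeff g n"
  unfolding fourier_coeff_def
proof (rule integral_cong_AE)
  have m: "(\<lambda>z. z powi (- n)) \<in> borel_measurable \<mu>" using L2_measurable[OF L2_powi] by blast
  show "(\<lambda>z. f z * z powi (- n)) \<in> borel_measurable \<mu>" "(\<lambda>z. g z * z powi (- n)) \<in> borel_measurable \<mu>"
    using m assms by (auto intro: borel_measurable_times)
qed (use assms in \<open>auto elim: eventually_mono\<close>)

lemma fourier_coeff_zero [simp]: "fourier_coeff (\<lambda>z. 0) n = 0"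
  by (simp add: fourier_coeff_def)

lemma fourier_coeff_sum:
  "finite I \<Longrightarrow> (\<And>i. i \<in> I \<Longrightarrow> f i \<in> L2) \<Longrightarrow> fourier_coeff (\<lambda>z. \<Sum>i\<in>I. f i z) n = (\<Sum>i\<in>I. fourier_coeff (f i) n)"
  by (induction I rule: finite_induct) (auto simp: fourier_coeff_add L2_sum)

lemma fourier_coeff_mult_powi: "fourier_coeff (\<lambda>z. z powi m * f z) n = fourier_coeff f (n - m)"
  unfolding fourier_coeff_def
proof (rule integral_circle_cong)
  fix z :: complex assume "norm z = 1"
  then have "z \<noteq> 0" by auto
  have "z powi (- (n - m)) = z powi m * z powi (- n)"
    using power_int_add[of z m "- n"] \<open>z \<noteq> 0\<close> by simp
  then show "z powi m * f z * z powi (- n) = f z * z powi (- (n - m))" by (simp add: mult_ac)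
qed

lemma fourier_coeff_powi: "fourier_coeff (\<lambda>z. z powi m) n = (if n = m then 1 else 0)"
  using fourier_coeff_mult_powi[of m "\<lambda>_. 1" n] integral_circle_powi[of "m - n"]
  by (simp add: fourier_coeff_def)

lemma fourier_coeff_tendsto:
  assumes "\<And>n. s n \<in> L2" "F \<in> L2" "(\<lambda>n. L2_norm (\<lambda>z. s n z - F z)) \<longlonglongrightarrow> 0"
  shows "(\<lambda>n. fourier_coeff (s n) k) \<longlonglongrightarrow> fourier_coeff F k"
proof -
  have "(\<lambda>n. fourier_coeff (s n) k - fourier_coeff F k) \<longlonglongrightarrow> 0"
  proof (rule Lim_null_comparison[OF _ assms(3)])
    show "\<forall>\<^sub>F n in sequentially. norm (fourier_coeff (s n) k - fourier_coeff F k) \<le> L2_norm (\<lambda>z. s n z - F z)"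
      using fourier_coeff_le[OF L2_diff[OF assms(1,2)]] by (simp add: fourier_coeff_diff assms)
  qed
  then show ?thesis by (simp add: LIM_zero_iff)
qed

definition trig_poly :: "int set \<Rightarrow> (int \<Rightarrow> complex) \<Rightarrow> complex \<Rightarrow> complex" where
  "trig_poly I c z = (\<Sum>n\<in>I. c n * z powi n)"

lemma trig_Linf [simp]: "trig_poly I c \<in> Linf" and trig_L2 [simp]: "trig_poly I c \<in> L2"
proof -
  show "trig_poly I c \<in> Linf" unfolding trig_poly_def by (rule Linf_continuous) (auto intro!: continuous_intros)
  then show "trig_poly I c \<in> L2" using Linf_subset_L2 by blast
qed

lemma fourier_coeff_trig:
  assumes "finite I"
  shows "fourier_coeff (trig_poly I c) n = (if n \<in> I then c n else 0)"
proof -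
  have "fourier_coeff (trig_poly I c) n = (\<Sum>i\<in>I. c i * (if n = i then 1 else 0))"
    unfolding trig_poly_def[abs_def] by (subst fourier_coeff_sum[OF assms]) (auto simp: fourier_coeff_cmult fourier_coeff_powi L2_cmult)
  also have "\<dots> = (if n \<in> I then c n else 0)" using assms by (simp add: if_distrib sum.delta cong: if_cong)
  finally show ?thesis .
qed

lemma L2_inner_trig_right:
  assumes "finite I" "f \<in> L2"
  shows "L2_inner f (trig_poly I c) = (\<Sum>n\<in>I. cnj (c n) * fourier_coeff f n)"
  using assms(1)
proof (induction I rule: finite_induct)
  case empty
  then show ?case by (simp add: trig_poly_def[abs_def] L2_inner_def)
next
  case (insert x I)
  have "trig_poly (insert x I) c = (\<lambda>z. c x * z powi x + trig_poly I c z)" using insert by (simp add: trig_poly_def[abs_def])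
  then show ?case using insert assms(2)
    by (simp add: L2_inner_add_right L2_cmult L2_inner_cmult_right fourier_coeff_inner)
qed

lemma L2_norm_trig_square:
  assumes "finite I"
  shows "(L2_norm (trig_poly I c))\<^sup>2 = (\<Sum>n\<in>I. (norm (c n))\<^sup>2)"
proof -
  have "complex_of_real ((L2_norm (trig_poly I c))\<^sup>2) = of_real (\<Sum>n\<in>I. (norm (c n))\<^sup>2)"
    unfolding L2_inner_self[symmetric] L2_inner_trig_right[OF assms trig_L2] of_real_sum
    by (intro sum.cong refl) (simp add: fourier_coeff_trig[OF assms] complex_norm_square[symmetric] mult.commute[of "cnj _"] del: of_real_power)
  then show ?thesis by (simp only: of_real_eq_iff)
qed

lemma bessel:
  assumes "finite I" "f \<in> L2"
  shows "(\<Sum>n\<in>I. (norm (fourier_coeff f n))\<^sup>2) \<le> (L2_norm f)\<^sup>2"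
proof -
  let ?t = "trig_poly I (fourier_coeff f)"
  have "L2_inner f ?t = of_real (\<Sum>n\<in>I. (norm (fourier_coeff f n))\<^sup>2)"
    unfolding L2_inner_trig_right[OF assms] of_real_sum
    by (intro sum.cong refl) (simp add: complex_norm_square[symmetric] mult.commute[of "cnj _"] del: of_real_power)
  then have "Re (L2_inner f ?t) = (\<Sum>n\<in>I. (norm (fourier_coeff f n))\<^sup>2)" by (simp del: of_real_sum)
  then have "(L2_norm (\<lambda>z. f z - ?t z))\<^sup>2 = (L2_norm f)\<^sup>2 - (\<Sum>n\<in>I. (norm (fourier_coeff f n))\<^sup>2)"
    by (simp add: L2_norm_diff_square[OF assms(2) trig_L2] L2_norm_trig_square[OF assms(1)])
  then show ?thesis by (metis diff_ge_0_iff_ge zero_le_power2)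
qed

text \<open>
The symmetric partial sums are Cauchy, since their distances are differences of the convergent
sequence of the sums \<open>\<Sum>\<bar>c n\<bar>\<^sup>2\<close>.
\<close>

theorem riesz_fischer:
  assumes B: "\<And>I. finite I \<Longrightarrow> (\<Sum>n\<in>I. (norm (c n))\<^sup>2) \<le> B"
  shows "\<exists>F\<in>L2. (\<forall>n. fourier_coeff F n = c n) \<and> (\<lambda>N. L2_norm (\<lambda>z. trig_poly {- int N..int N} c z - F z)) \<longlonglongrightarrow> 0"
proof -
  define a where "a N = (\<Sum>n\<in>{- int N..int N}. (norm (c n))\<^sup>2)" for N
  have amono: "incseq a" unfolding a_def by (intro incseq_SucI sum_mono2) auto
  have "convergent a" using amono B by (intro Bseq_mono_convergent BseqI'[of _ B]) (auto simp: a_def incseq_def sum_nonneg)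
  then have Ca: "Cauchy a" by (rule convergent_Cauchy)
  have diff: "(L2_norm (\<lambda>z. trig_poly {- int m..int m} c z - trig_poly {- int n..int n} c z))\<^sup>2 = a m - a n" if "n \<le> m" for m n
  proof -
    have sub: "{- int n..int n} \<subseteq> {- int m..int m}" using that by auto
    have "(\<lambda>z. trig_poly {- int m..int m} c z - trig_poly {- int n..int n} c z) = trig_poly ({- int m..int m} - {- int n..int n}) c"
      by (simp add: trig_poly_def fun_eq_iff sum_diff[OF _ sub])
    then show ?thesis by (simp add: L2_norm_trig_square a_def sum_diff[OF _ sub])
  qed
  have "\<exists>N. \<forall>m\<ge>N. \<forall>n\<ge>N. L2_norm (\<lambda>z. trig_poly {- int m..int m} c z - trig_poly {- int n..int n} c z) < e" if "e > 0" for e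
  proof -
    obtain N where N: "\<And>m n. m \<ge> N \<Longrightarrow> n \<ge> N \<Longrightarrow> dist (a m) (a n) < e\<^sup>2"
      using Ca \<open>e > 0\<close> unfolding Cauchy_def by (meson zero_less_power)
    have 1: "L2_norm (\<lambda>z. trig_poly {- int m..int m} c z - trig_poly {- int n..int n} c z) < e" if "n \<le> m" "N \<le> n" for m n
    proof (rule power2_less_imp_less)
      show "(L2_norm (\<lambda>z. trig_poly {- int m..int m} c z - trig_poly {- int n..int n} c z))\<^sup>2 < e\<^sup>2"
        using N[of m n] that incseqD[OF amono that(1)] by (simp add: diff dist_real_def)
    qed (use \<open>e > 0\<close> in simp)
    have "L2_norm (\<lambda>z. trig_poly {- int m..int m} c z - trig_poly {- int n..int n} c z) < e" if "N \<le> m" "N \<le> n" for m n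
      using 1[of n m] 1[of m n] that by (cases "n \<le> m") (auto simp: L2_norm_minus_commute[of "trig_poly {- int m..int m} c"])
    then show ?thesis by blast
  qed
  then obtain F where F: "F \<in> L2" "(\<lambda>N. L2_norm (\<lambda>z. trig_poly {- int N..int N} c z - F z)) \<longlonglongrightarrow> 0"
    using L2_complete[of "\<lambda>N. trig_poly {- int N..int N} c"] by auto
  have "fourier_coeff F n = c n" for n
  proof -
    have "(\<lambda>N. fourier_coeff (trig_poly {- int N..int N} c) n) \<longlonglongrightarrow> fourier_coeff F n"
      by (rule fourier_coeff_tendsto[OF _ F]) simp
    moreover have "(\<lambda>N. fourier_coeff (trig_poly {- int N..int N} c) n) \<longlonglongrightarrow> c n"
      by (rule tendsto_eventually) (auto simp: fourier_coeff_trig eventually_sequentially intro!: exI[of _ "nat \<bar>n\<bar>"])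
    ultimately show ?thesis by (rule LIMSEQ_unique)
  qed
  then show ?thesis using F by blast
qed

lemma L2_unique: "f \<in> L2 \<Longrightarrow> g \<in> L2 \<Longrightarrow> (\<And>n. fourier_coeff f n = fourier_coeff g n) \<Longrightarrow> AE z in \<mu>. f z = g z"
  by (intro fourier_coeff_unique L2_integrable)

text \<open>
The limit of the partial sums has the coefficients of \<open>f\<close>, hence is \<open>f\<close>.
\<close>

lemma fourier_series_tendsto:
  assumes f: "f \<in> L2"
  shows "(\<lambda>N. L2_norm (\<lambda>z. trig_poly {- int N..int N} (fourier_coeff f) z - f z)) \<longlonglongrightarrow> 0"
proof -
  obtain F where F: "F \<in> L2" "\<And>n. fourier_coeff F n = fourier_coeff f n"
    "(\<lambda>N. L2_norm (\<lambda>z. trig_poly {- int N..int N} (fourier_coeff f) z - F z)) \<longlonglongrightarrow> 0"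
    using riesz_fischer[of "fourier_coeff f" "(L2_norm f)\<^sup>2"] bessel[OF _ f] by blast
  have ae: "AE z in \<mu>. F z = f z" by (rule L2_unique[OF F(1) f F(2)])
  have "L2_norm (\<lambda>z. trig_poly {- int N..int N} (fourier_coeff f) z - F z) = L2_norm (\<lambda>z. trig_poly {- int N..int N} (fourier_coeff f) z - f z)" for N
    using ae F(1) f by (intro L2_norm_cong_AE L2_measurable L2_diff trig_L2) (auto elim: eventually_mono)
  then show ?thesis using F(3) by simp
qed

section \<open>The Hardy space and its projection\<close>

lemma H2_subset_L2: "f \<in> H2 \<Longrightarrow> f \<in> L2"
  by (simp add: H2_def)

lemma H2_fourier_neg: "f \<in> H2 \<Longrightarrow> n < 0 \<Longrightarrow> fourier_coeff f n = 0"
  by (simp add: H2_def)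

lemma closed_subspace_H2: "closed_subspace H2"
  unfolding closed_subspace_def
proof (intro conjI allI ballI impI)
  fix s and F :: "complex \<Rightarrow> complex" assume F: "F \<in> L2" and s: "\<forall>n::nat. s n \<in> H2"
    and lim: "(\<lambda>n. L2_norm (\<lambda>z. s n z - F z)) \<longlonglongrightarrow> 0"
  have "fourier_coeff F k = 0" if "k < 0" for k
  proof -
    have "(\<lambda>n. fourier_coeff (s n) k) \<longlonglongrightarrow> fourier_coeff F k"
      by (rule fourier_coeff_tendsto[OF _ F lim]) (use s in \<open>simp add: H2_def\<close>)
    then show ?thesis using s that by (simp add: H2_def LIMSEQ_const_iff)
  qed
  then show "F \<in> H2" using F by (simp add: H2_def)
qed (auto simp: H2_def L2_add L2_cmult fourier_coeff_add fourier_coeff_cmult)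

lemma H2_add: "f \<in> H2 \<Longrightarrow> g \<in> H2 \<Longrightarrow> (\<lambda>z. f z + g z) \<in> H2"
  by (rule closed_subspaceD(3)[OF closed_subspace_H2])

lemma H2_cmult: "f \<in> H2 \<Longrightarrow> (\<lambda>z. c * f z) \<in> H2"
  by (rule closed_subspaceD(4)[OF closed_subspace_H2])

lemma H2_zero [simp]: "(\<lambda>z. 0) \<in> H2"
  by (rule closed_subspaceD(2)[OF closed_subspace_H2])

lemma H2_diff: "f \<in> H2 \<Longrightarrow> g \<in> H2 \<Longrightarrow> (\<lambda>z. f z - g z) \<in> H2"
  using H2_add[of f "\<lambda>z. (-1) * g z"] H2_cmult[of g "-1"] by simp

lemma H2_sum: "(\<And>i. i \<in> I \<Longrightarrow> f i \<in> H2) \<Longrightarrow> (\<lambda>z. \<Sum>i\<in>I. f i z) \<in> H2"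
  by (induction I rule: infinite_finite_induct) (auto intro: H2_add)

lemma Linf_power [simp]: "(\<lambda>z. z ^ n) \<in> Linf"
  using Linf_powi[of "int n"] by simp

lemma H2_mult_power: "f \<in> H2 \<Longrightarrow> (\<lambda>z. z ^ n * f z) \<in> H2"
  using fourier_coeff_mult_powi[of "int n" f] L2_mult[of f "\<lambda>z. z ^ n"]
  by (auto simp: H2_def)

lemma fourier_coeff_mult_power: "fourier_coeff (\<lambda>z. z ^ m * f z) n = fourier_coeff f (n - int m)"
  using fourier_coeff_mult_powi[of "int m" f n] by simp

lemma fourier_coeff_mult_id: "fourier_coeff (\<lambda>z. z * f z) n = fourier_coeff f (n - 1)"
  using fourier_coeff_mult_power[of 1 f n] by simp

lemma H2_mult_id: "f \<in> H2 \<Longrightarrow> (\<lambda>z. z * f z) \<in> H2"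
  using H2_mult_power[of f 1] by simp

lemma fourier_coeff_power: "fourier_coeff (\<lambda>z. z ^ m) n = (if n = int m then 1 else 0)"
  using fourier_coeff_powi[of "int m" n] by simp

lemma H2_power [simp]: "(\<lambda>z. z ^ n) \<in> H2"
  using L2_powi[of "int n"] by (simp add: H2_def fourier_coeff_power)

lemma Linf_id [simp]: "(\<lambda>z. z) \<in> Linf"
  using Linf_power[of 1] by simp

lemma L2_norm_power [simp]: "L2_norm (\<lambda>z. z ^ n) = 1"
  using L2_norm_powi[of "int n"] by simp

lemma H2_const [simp]: "(\<lambda>z. c) \<in> H2"
  using H2_cmult[OF H2_power[of 0], of c] by simp

text \<open>
The form in which identities between operators are checked below: both sides lie in \<^const>\<open>H2\<close>, and
only the coefficients with nonnegative index are compared.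
\<close>

lemma H2_eqI:
  assumes f: "f \<in> H2" and g: "g \<in> H2" and eq: "\<And>n. fourier_coeff f (int n) = fourier_coeff g (int n)"
  shows "AE z in \<mu>. f z = g z"
proof (rule L2_unique)
  show "fourier_coeff f n = fourier_coeff g n" for n
    using eq[of "nat n"] H2_fourier_neg[OF f, of n] H2_fourier_neg[OF g, of n] by (cases "n < 0") auto
qed (use f g H2_subset_L2 in auto)

text \<open>
The choice in \<^const>\<open>proj_H2\<close> is among the solutions of the projection problem, and such solutions
exist.
\<close>

lemma proj_H2_spec:
  assumes "f \<in> L2"
  shows "proj_H2 f \<in> H2 \<and> (\<forall>h\<in>H2. L2_inner (\<lambda>z. f z - proj_H2 f z) h = 0)"
proof -
  have "\<exists>g. g \<in> H2 \<and> (\<forall>h\<in>H2. L2_inner (\<lambda>z. f z - g z) h = 0)"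
    using orthogonal_projection[OF closed_subspace_H2 assms] by blast
  from someI_ex[OF this] show ?thesis unfolding proj_H2_def .
qed

lemma proj_H2_in [simp]: "f \<in> L2 \<Longrightarrow> proj_H2 f \<in> H2"
  using proj_H2_spec by blast

lemma L2_inner_proj_H2:
  assumes "f \<in> L2" "h \<in> H2"
  shows "L2_inner (proj_H2 f) h = L2_inner f h"
  using proj_H2_spec[OF assms(1)] assms L2_inner_diff_left[of f "proj_H2 f" h]
  by (simp add: H2_subset_L2)

lemma fourier_coeff_proj_H2: "f \<in> L2 \<Longrightarrow> fourier_coeff (proj_H2 f) (int n) = fourier_coeff f (int n)"
  using L2_inner_proj_H2[of f "\<lambda>z. z ^ n"] by (simp add: fourier_coeff_inner)

lemma L2_norm_proj_H2:
  assumes f: "f \<in> L2"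
  shows "L2_norm (proj_H2 f) \<le> L2_norm f"
proof -
  have p: "proj_H2 f \<in> H2" by (rule proj_H2_in[OF f])
  have "complex_of_real ((L2_norm (proj_H2 f))\<^sup>2) = L2_inner f (proj_H2 f)"
    using L2_inner_proj_H2[OF f p] by (simp add: L2_inner_self)
  then have "(L2_norm (proj_H2 f))\<^sup>2 = norm (L2_inner f (proj_H2 f))"
    by (metis abs_of_nonneg norm_of_real zero_le_power2)
  also have "\<dots> \<le> L2_norm f * L2_norm (proj_H2 f)"
    by (rule L2_Cauchy_Schwarz[OF f H2_subset_L2[OF p]])
  finally have "L2_norm (proj_H2 f) * L2_norm (proj_H2 f) \<le> L2_norm f * L2_norm (proj_H2 f)" by (simp add: power2_eq_square)
  then show ?thesis by (metis L2_norm_nonneg mult_right_le_imp_le order_le_less)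
qed

lemma flip_L2: "f \<in> L2 \<Longrightarrow> flip f \<in> L2"
proof -
  assume f: "f \<in> L2"
  have m: "(\<lambda>z. f (cnj z)) \<in> borel_measurable \<mu>"
    using measurable_compose[OF measurable_circle_cnj L2_measurable[OF f]] by simp
  have "(\<lambda>z. (norm (f z))\<^sup>2) \<in> borel_measurable \<mu>" using L2_measurable[OF f] by simp
  from integral_circle_cnj(2)[OF this] show ?thesis using m L2_integrable_square[OF f] by (simp add: L2_def flip_def[abs_def])
qed

lemma L2_norm_flip: "f \<in> L2 \<Longrightarrow> L2_norm (flip f) = L2_norm f"
proof -
  assume f: "f \<in> L2"
  have "(\<lambda>z. (norm (f z))\<^sup>2) \<in> borel_measurable \<mu>" using L2_measurable[OF f] by simp
  from integral_circle_cnj(1)[OF this] show ?thesis by (simp add: L2_norm_def flip_def)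
qed

lemma toeplitz_H2: "\<phi> \<in> Linf \<Longrightarrow> f \<in> H2 \<Longrightarrow> toeplitz \<phi> f \<in> H2"
  unfolding toeplitz_def by (intro proj_H2_in L2_mult H2_subset_L2)

lemma hankel_H2: "\<phi> \<in> Linf \<Longrightarrow> f \<in> H2 \<Longrightarrow> hankel \<phi> f \<in> H2"
  unfolding hankel_def by (intro proj_H2_in L2_mult flip_L2 H2_subset_L2)

lemma fourier_coeff_toeplitz:
  "\<phi> \<in> Linf \<Longrightarrow> f \<in> H2 \<Longrightarrow> fourier_coeff (toeplitz \<phi> f) (int n) = fourier_coeff (\<lambda>z. \<phi> z * f z) (int n)"
  unfolding toeplitz_def by (intro fourier_coeff_proj_H2 L2_mult H2_subset_L2)

lemma fourier_coeff_hankel: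
  "\<phi> \<in> Linf \<Longrightarrow> f \<in> H2 \<Longrightarrow> fourier_coeff (hankel \<phi> f) (int n) = fourier_coeff (\<lambda>z. \<phi> z * flip f z) (int n)"
  unfolding hankel_def by (intro fourier_coeff_proj_H2 L2_mult flip_L2 H2_subset_L2)

lemma toeplitz_analytic:
  assumes "u \<in> Linf" "f \<in> H2" "(\<lambda>z. u z * f z) \<in> H2"
  shows "AE z in \<mu>. toeplitz u f z = u z * f z"
  using assms by (intro H2_eqI toeplitz_H2) (auto simp: fourier_coeff_toeplitz)

lemma shift_H2: "f \<in> H2 \<Longrightarrow> shift f \<in> H2"
  by (rule toeplitz_H2) simp_all

lemma shift_AE: "f \<in> H2 \<Longrightarrow> AE z in \<mu>. shift f z = z * f z"
  by (rule toeplitz_analytic) (auto intro: H2_mult_id)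

lemma L2_inner_cong_AE:
  assumes "AE z in \<mu>. f z = f' z" "f \<in> L2" "f' \<in> L2" "g \<in> L2"
  shows "L2_inner f g = L2_inner f' g"
  unfolding L2_inner_def
  using assms L2_integrable_inner[OF assms(2,4)] L2_integrable_inner[OF assms(3,4)]
  by (intro integral_cong_AE) (auto elim: eventually_mono)

text \<open>
The adjoint of the shift is the projection of the multiplication by \<open>cnj z\<close>; this provides the element
among which \<^const>\<open>adjoint_H2\<close> chooses.
\<close>

lemma adjoint_shift_spec:
  assumes f: "f \<in> H2"
  shows "adjoint_H2 shift f \<in> H2 \<and> (\<forall>h\<in>H2. L2_inner (shift h) f = L2_inner h (adjoint_H2 shift f))"
proof -
  have cL: "(\<lambda>z. cnj z * f z) \<in> L2"
    by (intro L2_mult H2_subset_L2[OF f] Linf_continuous continuous_intros)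
  have "L2_inner (shift h) f = L2_inner h (proj_H2 (\<lambda>z. cnj z * f z))" if h: "h \<in> H2" for h
  proof -
    have "L2_inner (shift h) f = L2_inner (\<lambda>z. z * h z) f"
      by (rule L2_inner_cong_AE[OF shift_AE[OF h]]) (auto intro: H2_subset_L2 shift_H2 H2_mult_id f h)
    also have "\<dots> = L2_inner h (\<lambda>z. cnj z * f z)" by (simp add: L2_inner_def mult_ac)
    also have "\<dots> = L2_inner h (proj_H2 (\<lambda>z. cnj z * f z))"
      using L2_inner_proj_H2[OF cL h] by (simp add: L2_inner_commute[of h])
    finally show ?thesis .
  qed
  then have "\<exists>g. g \<in> H2 \<and> (\<forall>h\<in>H2. L2_inner (shift h) f = L2_inner h g)"
    using proj_H2_in[OF cL] by blast
  from someI_ex[OF this] show ?thesis unfolding adjoint_H2_def .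
qed

lemma adjoint_shift_H2: "f \<in> H2 \<Longrightarrow> adjoint_H2 shift f \<in> H2"
  using adjoint_shift_spec by blast

lemma fourier_coeff_adjoint_shift:
  assumes f: "f \<in> H2"
  shows "fourier_coeff (adjoint_H2 shift f) (int n) = fourier_coeff f (int n + 1)"
proof -
  let ?p = "\<lambda>z::complex. z ^ n"
  have "L2_inner ?p (adjoint_H2 shift f) = L2_inner (shift ?p) f"
    using adjoint_shift_spec[OF f] by simp
  also have "\<dots> = L2_inner (\<lambda>z. z * z ^ n) f"
    by (rule L2_inner_cong_AE[OF shift_AE]) (intro H2_subset_L2 shift_H2 H2_mult_id f H2_power)+
  finally have "L2_inner (adjoint_H2 shift f) (\<lambda>z. z ^ n) = L2_inner f (\<lambda>z. z ^ Suc n)"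
    by (simp add: L2_inner_commute[of f] L2_inner_commute[of "adjoint_H2 shift f"])
  then show ?thesis
    using fourier_coeff_inner[of f "int (Suc n)"] fourier_coeff_inner[of _ "int n"]
    by (simp add: power_int_add_1 flip: power_int_of_nat del: power_Suc of_nat_Suc) (simp add: add.commute)
qed

section \<open>Bounded operators and their matrices\<close>

lemma bounded_operatorD:
  assumes "bounded_operator_H2 A"
  shows bounded_operator_H2_in: "f \<in> H2 \<Longrightarrow> A f \<in> H2"
    and bounded_operator_cong: "f \<in> H2 \<Longrightarrow> g \<in> H2 \<Longrightarrow> AE z in \<mu>. f z = g z \<Longrightarrow> AE z in \<mu>. A f z = A g z"
    and bounded_operator_add: "f \<in> H2 \<Longrightarrow> g \<in> H2 \<Longrightarrow> AE z in \<mu>. A (\<lambda>w. f w + g w) z = A f z + A g z"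
    and bounded_operator_cmult: "f \<in> H2 \<Longrightarrow> AE z in \<mu>. A (\<lambda>w. c * f w) z = c * A f z"
  using assms unfolding bounded_operator_H2_def by blast+

lemma bounded_operator_bound:
  assumes "bounded_operator_H2 A"
  shows "\<exists>C\<ge>0. \<forall>f\<in>H2. L2_norm (A f) \<le> C * L2_norm f"
proof -
  obtain C where C: "\<And>f. f \<in> H2 \<Longrightarrow> L2_norm (A f) \<le> C * L2_norm f"
    using assms unfolding bounded_operator_H2_def by blast
  have "L2_norm (A f) \<le> max C 0 * L2_norm f" if "f \<in> H2" for f
    using C[OF that] mult_right_mono[of C "max C 0" "L2_norm f"] by simp
  then show ?thesis by (intro exI[of _ "max C 0"]) auto
qed

text \<open>
A bounded operator respects sums and multiples only up to null sets. Passing to Fourier coefficients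
turns these relations into equations of complex numbers.
\<close>

lemma bounded_operator_fourier:
  assumes A: "bounded_operator_H2 A"
  shows fourier_op_cong: "f \<in> H2 \<Longrightarrow> g \<in> H2 \<Longrightarrow> AE z in \<mu>. f z = g z \<Longrightarrow> fourier_coeff (A f) n = fourier_coeff (A g) n"
    and fourier_op_add: "f \<in> H2 \<Longrightarrow> g \<in> H2 \<Longrightarrow> fourier_coeff (A (\<lambda>w. f w + g w)) n = fourier_coeff (A f) n + fourier_coeff (A g) n"
    and fourier_op_cmult: "f \<in> H2 \<Longrightarrow> fourier_coeff (A (\<lambda>w. c * f w)) n = c * fourier_coeff (A f) n"
proof -
  note meas = L2_measurable[OF H2_subset_L2]
  note inH = bounded_operator_H2_in[OF A]
  show "fourier_coeff (A f) n = fourier_coeff (A g) n" if "f \<in> H2" "g \<in> H2" "AE z in \<mu>. f z = g z"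
    by (rule fourier_coeff_cong_AE[OF bounded_operator_cong[OF A that]]) (intro meas inH that)+
  show "fourier_coeff (A (\<lambda>w. f w + g w)) n = fourier_coeff (A f) n + fourier_coeff (A g) n" if fg: "f \<in> H2" "g \<in> H2"
    unfolding fourier_coeff_add[OF H2_subset_L2[OF inH[OF fg(1)]] H2_subset_L2[OF inH[OF fg(2)]], symmetric]
    by (rule fourier_coeff_cong_AE[OF bounded_operator_add[OF A fg]]) (intro meas inH H2_add fg)+
  show "fourier_coeff (A (\<lambda>w. c * f w)) n = c * fourier_coeff (A f) n" if f: "f \<in> H2"
    unfolding fourier_coeff_cmult[symmetric]
    by (rule fourier_coeff_cong_AE[OF bounded_operator_cmult[OF A f]]) (intro meas inH H2_cmult f)+
qed

lemma fourier_op_diff: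
  assumes A: "bounded_operator_H2 A" and "f \<in> H2" "g \<in> H2"
  shows "fourier_coeff (A (\<lambda>w. f w - g w)) n = fourier_coeff (A f) n - fourier_coeff (A g) n"
  using fourier_op_add[OF A assms(2) H2_cmult[OF assms(3), of "-1"], of n] fourier_op_cmult[OF A assms(3), of "-1" n]
  by simp

lemma fourier_op_zero:
  assumes A: "bounded_operator_H2 A"
  shows "fourier_coeff (A (\<lambda>w. 0)) n = 0"
  using fourier_op_cmult[OF A H2_zero, of 0 n] by simp

lemma fourier_op_sum:
  assumes A: "bounded_operator_H2 A" and "\<And>i. i \<in> I \<Longrightarrow> f i \<in> H2" "finite I"
  shows "fourier_coeff (A (\<lambda>w. \<Sum>i\<in>I. c i * f i w)) n = (\<Sum>i\<in>I. c i * fourier_coeff (A (f i)) n)"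
  using assms(3,2)
proof (induction I rule: finite_induct)
  case (insert x I)
  have "(\<lambda>w. \<Sum>i\<in>insert x I. c i * f i w) = (\<lambda>w. c x * f x w + (\<Sum>i\<in>I. c i * f i w))"
    using insert by auto
  then show ?case using insert
    by (simp add: fourier_op_add[OF A] H2_cmult H2_sum fourier_op_cmult[OF A])
qed (simp add: fourier_op_zero[OF A])

text \<open>
With this continuity, matrix identities on the monomials extend to all of \<^const>\<open>H2\<close>.
\<close>

lemma fourier_op_tendsto:
  assumes A: "bounded_operator_H2 A" and s: "\<And>n. s n \<in> H2" and F: "F \<in> H2"
    and lim: "(\<lambda>n. L2_norm (\<lambda>z. s n z - F z)) \<longlonglongrightarrow> 0"
  shows "(\<lambda>n. fourier_coeff (A (s n)) k) \<longlonglongrightarrow> fourier_coeff (A F) k"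
proof -
  obtain C where C: "0 \<le> C" "\<And>f. f \<in> H2 \<Longrightarrow> L2_norm (A f) \<le> C * L2_norm f"
    using bounded_operator_bound[OF A] by blast
  have "(\<lambda>n. fourier_coeff (A (s n)) k - fourier_coeff (A F) k) \<longlonglongrightarrow> 0"
  proof (rule Lim_null_comparison)
    have "norm (fourier_coeff (A (s n)) k - fourier_coeff (A F) k) \<le> C * L2_norm (\<lambda>z. s n z - F z)" for n
    proof -
      have "fourier_coeff (A (s n)) k - fourier_coeff (A F) k = fourier_coeff (A (\<lambda>z. s n z - F z)) k"
        by (simp add: fourier_op_diff[OF A s F])
      also have "norm \<dots> \<le> L2_norm (A (\<lambda>z. s n z - F z))"
        by (intro fourier_coeff_le H2_subset_L2 bounded_operator_H2_in[OF A] H2_diff s F)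
      also have "\<dots> \<le> C * L2_norm (\<lambda>z. s n z - F z)" by (intro C H2_diff s F)
      finally show ?thesis .
    qed
    then show "\<forall>\<^sub>F n in sequentially. norm (fourier_coeff (A (s n)) k - fourier_coeff (A F) k) \<le> C * L2_norm (\<lambda>z. s n z - F z)"
      by simp
    show "(\<lambda>n. C * L2_norm (\<lambda>z. s n z - F z)) \<longlonglongrightarrow> 0"
      using tendsto_mult_right_zero[OF lim] by simp
  qed
  then show ?thesis by (simp add: LIM_zero_iff)
qed

text \<open>
For a member of \<^const>\<open>H2\<close> this is the whole symmetric partial sum of its Fourier series.
\<close>

definition taylor :: "(complex \<Rightarrow> complex) \<Rightarrow> nat \<Rightarrow> complex \<Rightarrow> complex" where
  "taylor f N z = (\<Sum>k\<le>N. fourier_coeff f (int k) * z ^ k)"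

lemma taylor_H2 [simp]: "taylor f N \<in> H2"
  unfolding taylor_def by (intro H2_sum H2_cmult H2_power)

lemma trig_eq_taylor:
  assumes "f \<in> H2"
  shows "trig_poly {- int N..int N} (fourier_coeff f) = taylor f N"
proof
  fix z
  have "trig_poly {- int N..int N} (fourier_coeff f) z = (\<Sum>n\<in>int ` {..N}. fourier_coeff f n * z powi n)"
    unfolding trig_poly_def
  proof (rule sum.mono_neutral_right)
    show "\<forall>i\<in>{- int N..int N} - int ` {..N}. fourier_coeff f i * z powi i = 0"
    proof
      fix i assume i: "i \<in> {- int N..int N} - int ` {..N}"
      have "i < 0"
      proof (rule ccontr)
        assume "\<not> i < 0"
        then have "i = int (nat i)" "nat i \<le> N" using i by auto
        then show False using i by blast
      qed
      then show "fourier_coeff f i * z powi i = 0" using H2_fourier_neg[OF assms] by simp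
    qed
  qed auto
  also have "\<dots> = taylor f N z" unfolding taylor_def by (subst sum.reindex) auto
  finally show "trig_poly {- int N..int N} (fourier_coeff f) z = taylor f N z" .
qed

lemma taylor_tendsto: "f \<in> H2 \<Longrightarrow> (\<lambda>N. L2_norm (\<lambda>z. taylor f N z - f z)) \<longlonglongrightarrow> 0"
  using fourier_series_tendsto[of f] by (simp add: trig_eq_taylor H2_subset_L2)

text \<open>
Members of \<^const>\<open>H2\<close> are determined by their coefficients, so linearity and compatibility with equality almost
everywhere need to be checked for the coefficient functionals \<open>l n\<close> only.
\<close>

lemma bounded_operatorI:
  assumes inH: "\<And>f. f \<in> H2 \<Longrightarrow> B f \<in> H2"
    and coef: "\<And>f n. f \<in> H2 \<Longrightarrow> fourier_coeff (B f) (int n) = l n f"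
    and cong: "\<And>f g n. f \<in> H2 \<Longrightarrow> g \<in> H2 \<Longrightarrow> AE z in \<mu>. f z = g z \<Longrightarrow> l n f = l n g"
    and add: "\<And>f g n. f \<in> H2 \<Longrightarrow> g \<in> H2 \<Longrightarrow> l n (\<lambda>w. f w + g w) = l n f + l n g"
    and cmult: "\<And>c f n. f \<in> H2 \<Longrightarrow> l n (\<lambda>w. c * f w) = c * l n f"
    and bound: "\<And>f. f \<in> H2 \<Longrightarrow> L2_norm (B f) \<le> C * L2_norm f"
  shows "bounded_operator_H2 B"
  unfolding bounded_operator_H2_def
proof (intro conjI ballI allI impI)
  fix f g assume fg: "f \<in> H2" "g \<in> H2" "AE z in \<mu>. f z = g z"
  have "fourier_coeff (B f) (int n) = fourier_coeff (B g) (int n)" for n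
    unfolding coef[OF fg(1)] coef[OF fg(2)] by (rule cong[OF fg])
  then show "AE z in \<mu>. B f z = B g z" by (intro H2_eqI inH fg(1,2))
next
  fix f g assume fg: "f \<in> H2" "g \<in> H2"
  then show "AE z in \<mu>. B (\<lambda>w. f w + g w) z = B f z + B g z"
    by (intro H2_eqI inH H2_add)
       (simp_all only: coef add H2_add fourier_coeff_add[OF H2_subset_L2[OF inH] H2_subset_L2[OF inH]])
next
  fix c f assume f: "f \<in> H2"
  then show "AE z in \<mu>. B (\<lambda>w. c * f w) z = c * B f z"
    by (intro H2_eqI inH H2_cmult) (simp_all only: coef cmult H2_cmult fourier_coeff_cmult)
next
  show "\<exists>C. \<forall>f\<in>H2. L2_norm (B f) \<le> C * L2_norm f" using bound by (intro exI[of _ C] ballI)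
qed (rule inH)

lemma fourier_coeff_mult_cong_AE:
  assumes "\<phi> \<in> Linf" "f \<in> L2" "g \<in> L2" "AE z in \<mu>. f z = g z"
  shows "fourier_coeff (\<lambda>z. \<phi> z * f z) n = fourier_coeff (\<lambda>z. \<phi> z * g z) n"
  using assms by (intro fourier_coeff_cong_AE L2_measurable L2_mult) (auto elim: eventually_mono)

text \<open>
Toeplitz and Hankel operators together: \<open>W\<close> is the identity or the flip.
\<close>

lemma bounded_proj_mult:
  assumes \<phi>: "\<phi> \<in> Linf" and WL: "\<And>f. f \<in> L2 \<Longrightarrow> W f \<in> L2" and Wn: "\<And>f. f \<in> L2 \<Longrightarrow> L2_norm (W f) = L2_norm f"
    and add: "\<And>f g. W (\<lambda>z. f z + g z) = (\<lambda>z. W f z + W g z)" and cmult: "\<And>c f. W (\<lambda>z. c * f z) = (\<lambda>z. c * W f z)"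
    and cong: "\<And>f g. AE z in \<mu>. f z = g z \<Longrightarrow> AE z in \<mu>. W f z = W g z"
  shows "bounded_operator_H2 (\<lambda>f. proj_H2 (\<lambda>z. \<phi> z * W f z))"
proof -
  obtain C where C: "\<phi> \<in> borel_measurable \<mu>" "AE z in \<mu>. norm (\<phi> z) \<le> C" using \<phi> by (auto simp: Linf_def)
  note WH = WL[OF H2_subset_L2]
  have L: "(\<lambda>z. \<phi> z * W f z) \<in> L2" if "f \<in> H2" for f by (rule L2_mult[OF WH[OF that] \<phi>])
  show ?thesis
  proof (rule bounded_operatorI[where l="\<lambda>n f. fourier_coeff (\<lambda>z. \<phi> z * W f z) (int n)" and C=C])
    fix f assume f: "f \<in> H2"
    have "L2_norm (proj_H2 (\<lambda>z. \<phi> z * W f z)) \<le> L2_norm (\<lambda>z. \<phi> z * W f z)" by (rule L2_norm_proj_H2[OF L[OF f]])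
    also have "\<dots> \<le> C * L2_norm (W f)" by (rule L2_norm_mult_le[OF WH[OF f] C])
    finally show "L2_norm (proj_H2 (\<lambda>z. \<phi> z * W f z)) \<le> C * L2_norm f" by (simp only: Wn[OF H2_subset_L2[OF f]])
  next
    fix f g n assume fg: "f \<in> H2" "g \<in> H2"
    show "fourier_coeff (\<lambda>z. \<phi> z * W (\<lambda>w. f w + g w) z) (int n) =
      fourier_coeff (\<lambda>z. \<phi> z * W f z) (int n) + fourier_coeff (\<lambda>z. \<phi> z * W g z) (int n)"
      by (simp only: add distrib_left fourier_coeff_add[OF L[OF fg(1)] L[OF fg(2)]])
  next
    fix c f n
    show "fourier_coeff (\<lambda>z. \<phi> z * W (\<lambda>w. c * f w) z) (int n) = c * fourier_coeff (\<lambda>z. \<phi> z * W f z) (int n)"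
      by (simp only: cmult mult.left_commute[of _ c] fourier_coeff_cmult)
  next
    fix f g n assume fg: "f \<in> H2" "g \<in> H2" "AE z in \<mu>. f z = g z"
    show "fourier_coeff (\<lambda>z. \<phi> z * W f z) (int n) = fourier_coeff (\<lambda>z. \<phi> z * W g z) (int n)"
      by (rule fourier_coeff_mult_cong_AE[OF \<phi> WH[OF fg(1)] WH[OF fg(2)] cong[OF fg(3)]])
  qed (use L in \<open>simp_all add: fourier_coeff_proj_H2\<close>)
qed

lemma bounded_toeplitz: "\<phi> \<in> Linf \<Longrightarrow> bounded_operator_H2 (toeplitz \<phi>)"
  unfolding toeplitz_def[abs_def] by (rule bounded_proj_mult[where W="\<lambda>f. f"]) auto

lemma L2_norm_shift_le: "f \<in> H2 \<Longrightarrow> L2_norm (\<lambda>z. z * f z) \<le> L2_norm f"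
  using L2_norm_mult_le[of f "\<lambda>z. z" 1] eventually_mono[OF AE_circle_norm, of "\<lambda>z. norm z \<le> 1"]
  by (simp add: H2_subset_L2)

lemma bounded_adjoint_shift: "bounded_operator_H2 (adjoint_H2 shift)"
proof (rule bounded_operatorI[where l="\<lambda>n f. fourier_coeff f (int n + 1)" and C=1])
  fix f assume f: "f \<in> H2"
  let ?g = "adjoint_H2 shift f"
  have g: "?g \<in> H2" by (rule adjoint_shift_H2[OF f])
  have "complex_of_real ((L2_norm ?g)\<^sup>2) = L2_inner (shift ?g) f"
    using adjoint_shift_spec[OF f] g by (simp add: L2_inner_self)
  then have "(L2_norm ?g)\<^sup>2 = norm (L2_inner (shift ?g) f)"
    by (metis abs_of_nonneg norm_of_real zero_le_power2)
  also have "\<dots> = norm (L2_inner (\<lambda>z. z * ?g z) f)"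
    using L2_inner_cong_AE[OF shift_AE[OF g]] by (simp add: H2_subset_L2 shift_H2 H2_mult_id f g)
  also have "\<dots> \<le> L2_norm (\<lambda>z. z * ?g z) * L2_norm f"
    by (intro L2_Cauchy_Schwarz H2_subset_L2 H2_mult_id f g)
  also have "\<dots> \<le> L2_norm ?g * L2_norm f" by (intro mult_right_mono L2_norm_shift_le g) simp
  finally have "L2_norm ?g * L2_norm ?g \<le> L2_norm f * L2_norm ?g" by (simp add: power2_eq_square mult.commute)
  then show "L2_norm ?g \<le> 1 * L2_norm f" by (metis L2_norm_nonneg mult_1 mult_right_le_imp_le order_le_less)
qed (auto intro: adjoint_shift_H2 fourier_coeff_adjoint_shift fourier_coeff_cong_AE L2_measurable H2_subset_L2
      simp: fourier_coeff_add fourier_coeff_cmult H2_subset_L2)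

lemma bounded_operator_diff:
  assumes A: "bounded_operator_H2 A" and B: "bounded_operator_H2 B"
  shows "bounded_operator_H2 (\<lambda>f z. A f z - B f z)"
proof -
  obtain C where C: "0 \<le> C" "\<And>f. f \<in> H2 \<Longrightarrow> L2_norm (A f) \<le> C * L2_norm f" using bounded_operator_bound[OF A] by blast
  obtain D where D: "0 \<le> D" "\<And>f. f \<in> H2 \<Longrightarrow> L2_norm (B f) \<le> D * L2_norm f" using bounded_operator_bound[OF B] by blast
  note inA = bounded_operator_H2_in[OF A] and inB = bounded_operator_H2_in[OF B]
  show ?thesis
  proof (rule bounded_operatorI[where l="\<lambda>n f. fourier_coeff (A f) (int n) - fourier_coeff (B f) (int n)" and C="C + D"])
    fix f assume f: "f \<in> H2"
    have "L2_norm (\<lambda>z. A f z - B f z) \<le> L2_norm (A f) + L2_norm (B f)"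
      using L2_norm_triangle[OF H2_subset_L2[OF inA[OF f]] L2_uminus[OF H2_subset_L2[OF inB[OF f]]]] by (simp add: L2_norm_minus)
    then show "L2_norm (\<lambda>z. A f z - B f z) \<le> (C + D) * L2_norm f"
      using C(2)[OF f] D(2)[OF f] by (simp add: distrib_right)
  next
    fix f g n assume fg: "f \<in> H2" "g \<in> H2" "AE z in \<mu>. f z = g z"
    show "fourier_coeff (A f) (int n) - fourier_coeff (B f) (int n) = fourier_coeff (A g) (int n) - fourier_coeff (B g) (int n)"
      by (simp add: fourier_op_cong[OF A fg] fourier_op_cong[OF B fg])
  qed (auto intro: H2_diff inA inB
      simp: fourier_coeff_diff H2_subset_L2 inA inB fourier_op_add[OF A] fourier_op_add[OF B] fourier_op_cmult[OF A] fourier_op_cmult[OF B] algebra_simps)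
qed

lemma bounded_operator_comp:
  assumes A: "bounded_operator_H2 A" and B: "bounded_operator_H2 B"
  shows "bounded_operator_H2 (\<lambda>f. A (B f))"
proof -
  obtain C where C: "0 \<le> C" "\<And>f. f \<in> H2 \<Longrightarrow> L2_norm (A f) \<le> C * L2_norm f" using bounded_operator_bound[OF A] by blast
  obtain D where D: "0 \<le> D" "\<And>f. f \<in> H2 \<Longrightarrow> L2_norm (B f) \<le> D * L2_norm f" using bounded_operator_bound[OF B] by blast
  note inA = bounded_operator_H2_in[OF A] and inB = bounded_operator_H2_in[OF B]
  show ?thesis
  proof (rule bounded_operatorI[where l="\<lambda>n f. fourier_coeff (A (B f)) (int n)" and C="C * D"])
    fix f assume f: "f \<in> H2"
    show "L2_norm (A (B f)) \<le> (C * D) * L2_norm f"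
      using C(2)[OF inB[OF f]] mult_left_mono[OF D(2)[OF f] C(1)] by (simp add: mult.assoc)
  next
    fix f g n assume fg: "f \<in> H2" "g \<in> H2" "AE z in \<mu>. f z = g z"
    show "fourier_coeff (A (B f)) (int n) = fourier_coeff (A (B g)) (int n)"
      by (intro fourier_op_cong[OF A] inB fg bounded_operator_cong[OF B])
  next
    fix f g n assume fg: "f \<in> H2" "g \<in> H2"
    have "fourier_coeff (A (B (\<lambda>w. f w + g w))) (int n) = fourier_coeff (A (\<lambda>w. B f w + B g w)) (int n)"
      by (intro fourier_op_cong[OF A] inB fg H2_add bounded_operator_add[OF B])
    then show "fourier_coeff (A (B (\<lambda>w. f w + g w))) (int n) = fourier_coeff (A (B f)) (int n) + fourier_coeff (A (B g)) (int n)"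
      by (simp add: fourier_op_add[OF A] inB fg)
  next
    fix c f n assume f: "f \<in> H2"
    have "fourier_coeff (A (B (\<lambda>w. c * f w))) (int n) = fourier_coeff (A (\<lambda>w. c * B f w)) (int n)"
      by (intro fourier_op_cong[OF A] inB f H2_cmult bounded_operator_cmult[OF B])
    then show "fourier_coeff (A (B (\<lambda>w. c * f w))) (int n) = c * fourier_coeff (A (B f)) (int n)"
      by (simp add: fourier_op_cmult[OF A] inB f)
  qed (simp_all add: inA inB)
qed

section \<open>The disc algebra and the theorem of Brown and Halmos\<close>

lemma L2_norm_le_uniform:
  assumes "f \<in> L2" "\<And>z. norm z = 1 \<Longrightarrow> norm (f z) \<le> e"
  shows "L2_norm f \<le> e"
  using L2_norm_mult_le[OF L2_const[of 1] L2_measurable[OF assms(1)] eventually_mono[OF AE_circle_norm, of "\<lambda>z. norm (f z) \<le> e"]] assms(2)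
  by simp

lemma L2_tendsto_uniform:
  assumes "\<And>n. s n \<in> L2" "F \<in> L2" "\<And>n z. norm z = 1 \<Longrightarrow> norm (s n z - F z) \<le> e n" "e \<longlonglongrightarrow> 0"
  shows "(\<lambda>n. L2_norm (\<lambda>z. s n z - F z)) \<longlonglongrightarrow> 0"
proof (rule Lim_null_comparison[OF _ assms(4)])
  have "L2_norm (\<lambda>z. s n z - F z) \<le> e n" for n
    by (intro L2_norm_le_uniform L2_diff assms)
  then show "\<forall>\<^sub>F n in sequentially. norm (L2_norm (\<lambda>z. s n z - F z)) \<le> e n" by simp
qed

lemma H2_closed:
  "F \<in> L2 \<Longrightarrow> (\<And>n::nat. s n \<in> H2) \<Longrightarrow> (\<lambda>n. L2_norm (\<lambda>z. s n z - F z)) \<longlonglongrightarrow> 0 \<Longrightarrow> F \<in> H2"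
  by (rule closed_subspaceD(5)[OF closed_subspace_H2])

text \<open>
The disc algebra is closed under multiplication, which \<^const>\<open>H2\<close> is not, and it contains the reproducing kernels
and the factors of polynomials that are needed below.
\<close>

definition disc_algebra :: "(complex \<Rightarrow> complex) set" where
  "disc_algebra = {g. continuous_on (cball 0 1) g \<and> g holomorphic_on ball 0 1}"

lemma disc_algebra_mult: "g \<in> disc_algebra \<Longrightarrow> h \<in> disc_algebra \<Longrightarrow> (\<lambda>z. g z * h z) \<in> disc_algebra"
  by (auto simp: disc_algebra_def intro: continuous_intros holomorphic_intros)

lemma disc_algebra_Linf: "g \<in> disc_algebra \<Longrightarrow> g \<in> Linf"
  by (rule Linf_continuous) (auto simp: disc_algebra_def intro: continuous_on_subset)

text \<open>
The partial sums are polynomials and converge uniformly on the circle.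
\<close>

lemma power_series_H2:
  assumes g: "g \<in> L2" and sm: "summable (\<lambda>n. norm (a n))"
    and sums: "\<And>z. norm z = 1 \<Longrightarrow> (\<lambda>n. a n * z ^ n) sums g z"
  shows "g \<in> H2"
proof (rule H2_closed[OF g])
  show "(\<lambda>z. \<Sum>k<n. a k * z ^ k) \<in> H2" for n by (intro H2_sum H2_cmult H2_power)
  define e where "e n = (\<Sum>k. norm (a (k + n)))" for n
  have e0: "e \<longlonglongrightarrow> 0" unfolding e_def using suminf_exist_split2[OF sm] .
  show "(\<lambda>n. L2_norm (\<lambda>z. (\<Sum>k<n. a k * z ^ k) - g z)) \<longlonglongrightarrow> 0"
  proof (rule L2_tendsto_uniform[OF _ g _ e0])
    show "(\<lambda>z. \<Sum>k<n. a k * z ^ k) \<in> L2" for n by (intro H2_subset_L2 H2_sum H2_cmult H2_power)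
    fix n and z :: complex assume z: "norm z = 1"
    have s1: "summable (\<lambda>k. norm (a (k + n) * z ^ (k + n)))"
      using summable_ignore_initial_segment[OF sm, of n] z by (simp add: norm_mult norm_power)
    have "g z = (\<Sum>k. a (k + n) * z ^ (k + n)) + (\<Sum>k<n. a k * z ^ k)"
      using suminf_split_initial_segment[OF sums_summable[OF sums[OF z]], of n] sums_unique[OF sums[OF z]] by simp
    then have "norm ((\<Sum>k<n. a k * z ^ k) - g z) = norm (\<Sum>k. a (k + n) * z ^ (k + n))" by simp
    also have "\<dots> \<le> (\<Sum>k. norm (a (k + n) * z ^ (k + n)))" by (rule summable_norm[OF s1])
    also have "\<dots> = e n" using z by (simp add: e_def norm_mult norm_power)
    finally show "norm ((\<Sum>k<n. a k * z ^ k) - g z) \<le> e n" .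
  qed
qed

text \<open>
The dilates \<open>g(r z)\<close> with \<open>r < 1\<close> are absolutely convergent power series on the circle, and they tend to
\<open>g\<close> uniformly.
\<close>

lemma disc_algebra_H2:
  assumes g: "g \<in> disc_algebra"
  shows "g \<in> H2"
proof -
  have cont: "continuous_on (cball 0 1) g" and hol: "g holomorphic_on ball 0 1" using g by (auto simp: disc_algebra_def)
  define r where "r n = 1 - 1 / real (n + 2)" for n
  have r: "0 \<le> r n" "r n < 1" for n by (auto simp: r_def field_simps)
  define s where "s n z = g (of_real (r n) * z)" for n z
  have sLinf: "s n \<in> Linf" for n
    unfolding s_def
  proof (intro Linf_continuous continuous_on_compose2[OF cont])
    show "(\<lambda>z. complex_of_real (r n) * z) ` sphere 0 1 \<subseteq> cball 0 1" using r[of n] by (auto simp: norm_mult)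
  qed (intro continuous_intros)
  have gL2: "g \<in> L2" using disc_algebra_Linf[OF g] Linf_subset_L2 by blast
  have sH2: "s n \<in> H2" for n
  proof (rule power_series_H2)
    show "s n \<in> L2" using sLinf Linf_subset_L2 by blast
    define b where "b k = (deriv ^^ k) g 0 / fact k" for k
    have b: "(\<lambda>k. b k * w ^ k) sums g w" if "norm w < 1" for w
      using holomorphic_power_series[OF hol, of w] that by (simp add: b_def)
    obtain \<rho> where \<rho>: "r n < \<rho>" "\<rho> < 1" using dense r by blast
    have "summable (\<lambda>k. norm (b k * of_real (r n) ^ k))"
      by (rule powser_insidea[OF sums_summable[OF b[of "of_real \<rho>"]]]) (use \<rho> r[of n] in auto)
    then show "summable (\<lambda>k. norm (b k * of_real (r n) ^ k))" .
    show "(\<lambda>k. b k * of_real (r n) ^ k * z ^ k) sums s n z" if "norm z = 1" for z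
      using b[of "of_real (r n) * z"] that r[of n] by (simp add: s_def norm_mult power_mult_distrib mult.assoc)
  qed
  have uc: "uniformly_continuous_on (cball 0 1) g"
    using cont by (intro compact_uniformly_continuous) auto
  have "(\<lambda>n. L2_norm (\<lambda>z. s n z - g z)) \<longlonglongrightarrow> 0"
  proof (rule LIMSEQ_I)
    fix e :: real assume "e > 0"
    then obtain d where d: "d > 0" "\<And>x x'. x \<in> cball 0 1 \<Longrightarrow> x' \<in> cball 0 1 \<Longrightarrow> dist x' x < d \<Longrightarrow> dist (g x') (g x) < e / 2"
      using uniformly_continuous_onE[OF uc, of "e / 2"] by (metis half_gt_zero)
    obtain N where N: "1 / real (Suc N) < d" using nat_approx_posE[OF d(1)] by blast
    have "norm (L2_norm (\<lambda>z. s n z - g z) - 0) < e" if "n \<ge> N" for n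
    proof -
      have "L2_norm (\<lambda>z. s n z - g z) \<le> e / 2"
      proof (rule L2_norm_le_uniform)
        show "(\<lambda>z. s n z - g z) \<in> L2" by (rule L2_diff[OF H2_subset_L2[OF sH2] gL2])
        fix z :: complex assume z: "norm z = 1"
        have "dist (of_real (r n) * z) z = norm ((of_real (r n) - 1) * z)" by (simp add: dist_norm algebra_simps)
        also have "\<dots> = norm (of_real (r n - 1) :: complex)" using z by (simp add: norm_mult)
        also have "\<dots> = 1 / real (n + 2)" by (simp only: norm_of_real r_def) simp
        also have "\<dots> \<le> 1 / real (Suc N)" using that by (intro divide_left_mono) auto
        also note N
        finally have "dist (g (of_real (r n) * z)) (g z) < e / 2"
          using z r[of n] by (intro d(2)) (auto simp: norm_mult)
        then show "norm (s n z - g z) \<le> e / 2" by (simp add: s_def dist_norm)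
      qed
      then show ?thesis using \<open>e > 0\<close> by simp
    qed
    then show "\<exists>no. \<forall>n\<ge>no. norm (L2_norm (\<lambda>z. s n z - g z) - 0) < e" by blast
  qed
  then show ?thesis using H2_closed[of g s] gL2 sH2 by blast
qed

text \<open>
The bound passes to the radial limits. The symbols of Toeplitz and of Hankel operators are found to be bounded in
this way.
\<close>

lemma poisson_bounded_imp_bounded:
  assumes f: "integrable \<mu> f" and b: "\<And>w. norm w < 1 \<Longrightarrow> norm (poisson f w) \<le> C"
  shows "AE z in \<mu>. norm (f z) \<le> C"
  using fatou_radial_limit[OF f] AE_circle_norm
proof eventually_elim
  case (elim z)
  have "\<forall>\<^sub>F r in at_left (1::real). norm (poisson f (of_real r * z)) \<le> C"
    using eventually_at_left_real[of 0 "1::real"] by (auto elim!: eventually_mono intro!: b simp: norm_mult elim(2))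
  then show ?case by (rule tendsto_upperbound[OF tendsto_norm[OF elim(1)]]) simp
qed

lemma kernel_disc_algebra:
  assumes w: "norm w < 1"
  shows "(\<lambda>z. 1 / (1 - cnj w * z)) \<in> disc_algebra"
proof -
  have "1 - cnj w * z \<noteq> 0" if "norm z \<le> 1" for z
  proof
    assume "1 - cnj w * z = 0"
    then have "norm (cnj w * z) = 1" by simp
    moreover have "norm (cnj w * z) \<le> norm w * 1" using that by (simp add: norm_mult mult_left_le)
    ultimately show False using w by simp
  qed
  then show ?thesis unfolding disc_algebra_def by (auto intro!: continuous_intros holomorphic_intros)
qed

text \<open>
The Poisson kernel is the normalized squared modulus of the reproducing kernel \<open>1/(1 - cnj w z)\<close> of
\<^const>\<open>H2\<close>.
\<close>

lemma poisson_kernel_eq_square: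
  assumes z: "norm z = 1"
  shows "complex_of_real (poisson_kernel w z) = (1 - (norm w)\<^sup>2) * ((1 / (1 - cnj w * z)) * cnj (1 / (1 - cnj w * z)))"
proof -
  have "z - w = z * cnj (1 - cnj w * z)" using circle_mult_cnj(1)[OF z] by (simp add: algebra_simps)
  then have "norm (z - w) = norm (1 - cnj w * z)" using z by (metis complex_mod_cnj mult_1 norm_mult)
  moreover have "(1 / (1 - cnj w * z)) * cnj (1 / (1 - cnj w * z)) = of_real ((norm (1 / (1 - cnj w * z)))\<^sup>2)"
    by (simp add: complex_norm_square del: of_real_power)
  ultimately show ?thesis by (simp add: poisson_kernel_def norm_divide power_divide)
qed

text \<open>
For a square integrable symbol \<open>\<phi>\<close> the product \<open>\<phi> f\<close> is merely integrable, but its coefficients still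
depend continuously on \<open>f\<close>.
\<close>

lemma fourier_coeff_mult_tendsto:
  assumes \<phi>: "\<phi> \<in> L2" and s: "\<And>n. s n \<in> L2" and F: "F \<in> L2" and lim: "(\<lambda>n. L2_norm (\<lambda>z. s n z - F z)) \<longlonglongrightarrow> 0"
  shows "(\<lambda>n. fourier_coeff (\<lambda>z. \<phi> z * s n z) k) \<longlonglongrightarrow> fourier_coeff (\<lambda>z. \<phi> z * F z) k"
proof -
  have eq: "fourier_coeff (\<lambda>z. \<phi> z * f z) k = L2_inner f (\<lambda>z. cnj (\<phi> z) * z powi k)" if "f \<in> L2" for f
    unfolding fourier_coeff_def L2_inner_def
    by (rule integral_circle_cong) (simp add: powi_uminus_circle mult_ac)
  have h: "(\<lambda>z. cnj (\<phi> z) * z powi k) \<in> L2"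
    using L2_mult[OF L2_cnj[OF \<phi>] Linf_powi[of k]] by (simp add: mult.commute)
  have "(\<lambda>n. fourier_coeff (\<lambda>z. \<phi> z * s n z) k - fourier_coeff (\<lambda>z. \<phi> z * F z) k) \<longlonglongrightarrow> 0"
  proof (rule Lim_null_comparison)
    have "norm (fourier_coeff (\<lambda>z. \<phi> z * s n z) k - fourier_coeff (\<lambda>z. \<phi> z * F z) k) \<le>
        L2_norm (\<lambda>z. s n z - F z) * L2_norm (\<lambda>z. cnj (\<phi> z) * z powi k)" for n
      using L2_Cauchy_Schwarz[OF L2_diff[OF s F] h, of n] by (simp add: eq s F L2_inner_diff_left h)
    then show "\<forall>\<^sub>F n in sequentially. norm (fourier_coeff (\<lambda>z. \<phi> z * s n z) k - fourier_coeff (\<lambda>z. \<phi> z * F z) k) \<le>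
        L2_norm (\<lambda>z. s n z - F z) * L2_norm (\<lambda>z. cnj (\<phi> z) * z powi k)" by simp
    show "(\<lambda>n. L2_norm (\<lambda>z. s n z - F z) * L2_norm (\<lambda>z. cnj (\<phi> z) * z powi k)) \<longlonglongrightarrow> 0"
      using tendsto_mult_left_zero[OF lim] by simp
  qed
  then show ?thesis by (simp add: LIM_zero_iff)
qed

lemma fourier_coeff_mult_taylor:
  assumes "\<phi> \<in> L2"
  shows "fourier_coeff (\<lambda>z. \<phi> z * taylor f N z) n = (\<Sum>k\<le>N. fourier_coeff f (int k) * fourier_coeff \<phi> (n - int k))"
proof -
  have "(\<lambda>z. \<phi> z * taylor f N z) = (\<lambda>z. \<Sum>k\<le>N. fourier_coeff f (int k) * (z ^ k * \<phi> z))"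
    by (simp add: taylor_def fun_eq_iff sum_distrib_left mult_ac)
  then show ?thesis
    by (simp add: fourier_coeff_sum L2_cmult L2_mult assms fourier_coeff_cmult fourier_coeff_mult_power)
qed

text \<open>
The Brown-Halmos theorem. The hypothesis says that the matrix entries depend on the difference of
the indices only. Every finite set of these entries occurs in the column of a high power \<open>z\<^sup>k\<close>, so they
are square summable and belong to a symbol \<open>\<phi>\<close> in \<^const>\<open>L2\<close>. The Poisson integral of \<open>\<phi>\<close> at \<open>w\<close> is
\<open>\<langle>T k, k\<rangle> / \<parallel>k\<parallel>\<^sup>2\<close> for the reproducing kernel \<open>k\<close> at \<open>w\<close>, hence bounded by the norm of \<open>T\<close>.
\<close>

theorem brown_halmos:
  assumes T: "bounded_operator_H2 T"
    and toep: "\<And>f n. f \<in> H2 \<Longrightarrow> fourier_coeff (T (\<lambda>z. z * f z)) (int n + 1) = fourier_coeff (T f) (int n)"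
  shows "\<exists>\<phi>\<in>Linf. op_eq T (toeplitz \<phi>)"
proof -
  obtain C where C: "0 \<le> C" "\<And>f. f \<in> H2 \<Longrightarrow> L2_norm (T f) \<le> C * L2_norm f" using bounded_operator_bound[OF T] by blast
  note TH2 = bounded_operator_H2_in[OF T]
  \<comment> \<open>The matrix entry in column \<open>k\<close> and row \<open>i\<close>.\<close>
  define t where "t k i = fourier_coeff (T (\<lambda>z. z ^ k)) (int i)" for k i
  have tS: "t (Suc k) (Suc i) = t k i" for k i
    using toep[OF H2_power, of k i] by (simp add: t_def add.commute)
  have tp: "t (k + m) (i + m) = t k i" for k i m by (induction m) (simp_all add: tS)
  define a where "a n = t (nat (- n)) (nat n)" for n
  have ta: "t k i = a (int i - int k)" for k i
  proof (cases "k \<le> i")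
    case True
    then show ?thesis using tp[of 0 k "i - k"] by (simp add: a_def nat_diff_distrib')
  next
    case False
    then show ?thesis using tp[of "k - i" i 0] by (simp add: a_def nat_diff_distrib')
  qed
  have "(\<Sum>n\<in>I. (norm (a n))\<^sup>2) \<le> C\<^sup>2" if I: "finite I" for I
  proof -
    obtain k :: nat where k: "\<And>n. n \<in> I \<Longrightarrow> - int k \<le> n"
    proof -
      have "\<bar>n\<bar> \<le> (\<Sum>n\<in>I. \<bar>n\<bar>)" if "n \<in> I" for n using that I by (intro member_le_sum) auto
      then show ?thesis by (intro that[of "nat (\<Sum>n\<in>I. \<bar>n\<bar>)"]) (smt (verit) nat_0_le sum_nonneg)
    qed
    have "(\<Sum>n\<in>I. (norm (a n))\<^sup>2) = (\<Sum>n\<in>I. (norm (fourier_coeff (T (\<lambda>z. z ^ k)) (n + int k)))\<^sup>2)"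
    proof (intro sum.cong refl arg_cong[where f="\<lambda>x. (norm x)\<^sup>2"])
      fix n assume "n \<in> I"
      then have "0 \<le> n + int k" using k[of n] by simp
      then show "a n = fourier_coeff (T (\<lambda>z. z ^ k)) (n + int k)"
        using ta[of k "nat (n + int k)"] by (simp add: t_def)
    qed
    also have "\<dots> = (\<Sum>n\<in>(\<lambda>n. n + int k) ` I. (norm (fourier_coeff (T (\<lambda>z. z ^ k)) n))\<^sup>2)"
      by (subst sum.reindex) (auto intro: inj_onI)
    also have "\<dots> \<le> (L2_norm (T (\<lambda>z. z ^ k)))\<^sup>2"
      by (rule bessel) (use I H2_subset_L2 TH2 in auto)
    also have "\<dots> \<le> C\<^sup>2" using C(2)[OF H2_power[of k]] by (intro power_mono) auto
    finally show ?thesis .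
  qed
  then obtain \<phi> where \<phi>: "\<phi> \<in> L2" "\<And>n. fourier_coeff \<phi> n = a n"
    using riesz_fischer[of a "C\<^sup>2"] by blast
  have coef: "fourier_coeff (T f) (int i) = fourier_coeff (\<lambda>z. \<phi> z * f z) (int i)" if f: "f \<in> H2" for f i
  proof -
    have "fourier_coeff (T (taylor f N)) (int i) = fourier_coeff (\<lambda>z. \<phi> z * taylor f N z) (int i)" for N
      unfolding fourier_coeff_mult_taylor[OF \<phi>(1)]
      using fourier_op_sum[OF T, of "{..N}" "\<lambda>k z. z ^ k" "\<lambda>k. fourier_coeff f (int k)" "int i"]
      by (simp add: taylor_def[abs_def] \<phi>(2) ta[symmetric] t_def)
    moreover have "(\<lambda>N. fourier_coeff (T (taylor f N)) (int i)) \<longlonglongrightarrow> fourier_coeff (T f) (int i)"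
      by (rule fourier_op_tendsto[OF T taylor_H2 f taylor_tendsto[OF f]])
    moreover have "(\<lambda>N. fourier_coeff (\<lambda>z. \<phi> z * taylor f N z) (int i)) \<longlonglongrightarrow> fourier_coeff (\<lambda>z. \<phi> z * f z) (int i)"
      by (rule fourier_coeff_mult_tendsto[OF \<phi>(1) H2_subset_L2[OF taylor_H2] H2_subset_L2[OF f] taylor_tendsto[OF f]])
    ultimately show ?thesis using LIMSEQ_unique by simp
  qed
  have "norm (poisson \<phi> w) \<le> C" if w: "norm w < 1" for w
  proof -
    define k where "k z = 1 / (1 - cnj w * z)" for z
    have kd: "k \<in> disc_algebra" unfolding k_def using kernel_disc_algebra[OF w] .
    have kH2: "k \<in> H2" by (rule disc_algebra_H2[OF kd])
    have kL2: "k \<in> L2" by (rule H2_subset_L2[OF kH2])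
    have \<phi>k: "(\<lambda>z. \<phi> z * k z) \<in> L2"
      using L2_mult[OF \<phi>(1) disc_algebra_Linf[OF kd]] by (simp add: mult.commute)
    have ae: "AE z in \<mu>. T k z = proj_H2 (\<lambda>z. \<phi> z * k z) z"
      by (rule H2_eqI[OF TH2[OF kH2] proj_H2_in[OF \<phi>k]]) (simp add: coef[OF kH2] fourier_coeff_proj_H2[OF \<phi>k])
    have "L2_inner (T k) k = L2_inner (\<lambda>z. \<phi> z * k z) k"
      unfolding L2_inner_proj_H2[OF \<phi>k kH2, symmetric]
      by (rule L2_inner_cong_AE[OF ae]) (intro H2_subset_L2 TH2 kH2 proj_H2_in \<phi>k)+
    moreover have "poisson \<phi> w = of_real (1 - (norm w)\<^sup>2) * L2_inner (\<lambda>z. \<phi> z * k z) k"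
      unfolding poisson_def L2_inner_def integral_mult_right_zero[symmetric]
      by (intro integral_circle_cong) (simp add: poisson_kernel_eq_square k_def mult_ac)
    \<comment> \<open>The norm of the reproducing kernel, from the Poisson kernel having integral one.\<close>
    moreover have "1 = (1 - (norm w)\<^sup>2) * (L2_norm k)\<^sup>2"
    proof -
      have "complex_of_real 1 = (LINT z|\<mu>. complex_of_real (poisson_kernel w z))" using poisson_one[OF w] by simp
      also have "\<dots> = of_real (1 - (norm w)\<^sup>2) * L2_inner k k"
        unfolding L2_inner_def integral_mult_right_zero[symmetric]
        by (intro integral_circle_cong) (simp add: poisson_kernel_eq_square k_def)
      also have "\<dots> = of_real ((1 - (norm w)\<^sup>2) * (L2_norm k)\<^sup>2)" by (simp add: L2_inner_self)
      finally show ?thesis by (simp only: of_real_eq_iff)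
    qed
    moreover have "norm (L2_inner (T k) k) \<le> C * (L2_norm k)\<^sup>2"
      using L2_Cauchy_Schwarz[OF H2_subset_L2[OF TH2[OF kH2]] kL2] mult_right_mono[OF C(2)[OF kH2], of "L2_norm k"]
      by (simp add: power2_eq_square mult.assoc)
    moreover have "0 \<le> 1 - (norm w)\<^sup>2" using w by (simp add: abs_square_le_1)
    ultimately show ?thesis
      using mult_left_mono[of "norm (L2_inner (T k) k)" "C * (L2_norm k)\<^sup>2" "1 - (norm w)\<^sup>2"]
      by (simp add: norm_mult mult.left_commute[of _ C] del: of_real_diff)
  qed
  then have "AE z in \<mu>. norm (\<phi> z) \<le> C" by (rule poisson_bounded_imp_bounded[OF L2_integrable[OF \<phi>(1)]])
  then have \<phi>inf: "\<phi> \<in> Linf" using L2_measurable[OF \<phi>(1)] by (auto simp: Linf_def)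
  have "op_eq T (toeplitz \<phi>)"
    unfolding op_eq_def by (intro ballI H2_eqI TH2 toeplitz_H2 \<phi>inf) (simp_all add: coef fourier_coeff_toeplitz \<phi>inf)
  then show ?thesis using \<phi>inf by blast
qed

section \<open>Inner functions and shift-invariant subspaces\<close>

text \<open>
Cauchy's criterion with countably many conditions, as needed to show that the set of convergence is
measurable.
\<close>

lemma at_left_1_convergent_iff:
  fixes g :: "real \<Rightarrow> complex"
  shows "(\<exists>l. (g \<longlongrightarrow> l) (at_left 1)) \<longleftrightarrow>
    (\<forall>k. \<exists>m. \<forall>r\<in>{1 - 1 / real (m + 2)<..<1}. \<forall>s\<in>{1 - 1 / real (m + 2)<..<1}. dist (g r) (g s) \<le> 1 / real (Suc k))"
    (is "?L \<longleftrightarrow> (\<forall>k. \<exists>m. ?near k m)")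
proof -
  have "?L \<longleftrightarrow> (\<forall>e>0. \<exists>P. eventually P (at_left 1) \<and> (\<forall>r s. P r \<and> P s \<longrightarrow> dist (g r) (g s) < e))"
    unfolding cauchy_filter_metric_filtermap[symmetric] convergent_filter_iff_cauchy[symmetric] convergent_filter_iff filterlim_def ..
  also have "\<dots> \<longleftrightarrow> (\<forall>k. \<exists>m. ?near k m)"
  proof (intro iffI allI impI)
    fix k assume "\<forall>e>0. \<exists>P. eventually P (at_left 1) \<and> (\<forall>r s. P r \<and> P s \<longrightarrow> dist (g r) (g s) < e)"
    then obtain P where P: "eventually P (at_left (1::real))" "\<And>r s. P r \<Longrightarrow> P s \<Longrightarrow> dist (g r) (g s) < 1 / real (Suc k)"
      by (metis of_nat_0_less_iff zero_less_Suc zero_less_divide_1_iff)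
    then obtain b where b: "b < 1" "\<And>r. b < r \<Longrightarrow> r < 1 \<Longrightarrow> P r" unfolding eventually_at_left_field by blast
    obtain m where "1 / real (Suc m) < 1 - b" using nat_approx_posE[of "1 - b"] b by auto
    moreover have "1 / real (m + 2) \<le> 1 / real (Suc m)" by (intro divide_left_mono) auto
    ultimately have "b < 1 - 1 / real (m + 2)" by linarith
    then show "\<exists>m. ?near k m" using b(2) P(2) by (intro exI[of _ m]) (auto intro!: less_imp_le)
  next
    fix e :: real assume near: "\<forall>k. \<exists>m. ?near k m" and "e > 0"
    then obtain k where k: "1 / real (Suc k) < e" using nat_approx_posE by blast
    obtain m where m: "?near k m" using near by blast
    have "eventually (\<lambda>r. r \<in> {1 - 1 / real (m + 2)<..<1}) (at_left 1)"
      by (rule eventually_at_left_real) simp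
    then show "\<exists>P. eventually P (at_left 1) \<and> (\<forall>r s. P r \<and> P s \<longrightarrow> dist (g r) (g s) < e)"
      using m k by (meson le_less_trans)
  qed
  finally show ?thesis .
qed

text \<open>
By Cauchy's criterion, the set \<open>E\<close> where the radial limit exists is a countable intersection of countable
unions of closed sets. On \<open>E\<close> the limit can be taken along a sequence; off \<open>E\<close> the function
\<^const>\<open>radial_limit\<close> is constant, because the definite description \<open>THE l. False\<close> does not depend on the
point. The measurability matters because the integral of a function that is not measurable is \<open>0\<close>, even
if the function equals a measurable one almost everywhere.
\<close>

lemma radial_limit_measurable:
  assumes \<theta>: "continuous_on (ball 0 1) \<theta>"
  shows "radial_limit \<theta> \<in> borel_measurable \<mu>"
proof -
  define E where "E = {z \<in> sphere 0 1. \<exists>l. ((\<lambda>r::real. \<theta> (of_real r * z)) \<longlongrightarrow> l) (at_left 1)}"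
  define R where "R m = {1 - 1 / real (m + 2)<..<1}" for m
  define B where "B k r s = sphere 0 1 \<inter> (\<lambda>z. dist (\<theta> (of_real r * z)) (\<theta> (of_real s * z))) -` {..1 / real (Suc k)}" for k and r s :: real
  have cont: "continuous_on (sphere 0 1) (\<lambda>z. \<theta> (of_real r * z))" if "0 \<le> r" "r < 1" for r
    by (rule continuous_on_compose2[OF \<theta>]) (use that in \<open>auto intro!: continuous_intros simp: norm_mult\<close>)
  have R: "0 \<le> r" "r < 1" if "r \<in> R m" for r m
  proof -
    have "1 / real (m + 2) \<le> 1" by simp
    then show "0 \<le> r" "r < 1" using that unfolding R_def greaterThanLessThan_iff by linarith+
  qed
  have clB: "closed (B k r s)" if "r \<in> R m" "s \<in> R m" for k m r s
    unfolding B_def by (rule continuous_closed_preimage) (use R[OF that(1)] R[OF that(2)] cont in \<open>auto intro!: continuous_intros\<close>)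
  define A where "A k m = sphere 0 1 \<inter> (\<Inter>r\<in>R m. \<Inter>s\<in>R m. B k r s)" for k m
  have "closed (A k m)" for k m
    unfolding A_def by (rule closed_Int[OF closed_sphere], rule closed_INT, rule ballI, rule closed_INT, rule ballI, rule clB)
  moreover have "E = (\<Inter>k. \<Union>m. A k m)"
    unfolding E_def at_left_1_convergent_iff by (auto simp: A_def B_def R_def)
  ultimately have "E \<in> sets borel"
    by (simp only:) (intro sets.countable_INT sets.countable_UN, auto)
  moreover have Es: "E \<subseteq> sphere 0 1" by (auto simp: E_def)
  ultimately have E: "E \<in> sets \<mu>" by (simp add: sets_circle sets_restrict_space_iff)
  define \<rho> where "\<rho> n = 1 - 1 / real (n + 3)" for n
  have \<rho>: "0 < \<rho> n" "\<rho> n < 1" for n by (auto simp: \<rho>_def field_simps)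
  have "(\<lambda>n. 1 - 1 / real (n + 3)) \<longlonglongrightarrow> 1 - 0"
    by (intro tendsto_diff tendsto_const LIMSEQ_ignore_initial_segment[OF lim_1_over_n])
  then have "\<rho> \<longlonglongrightarrow> 1" by (simp add: \<rho>_def[abs_def])
  then have \<rho>lim: "filterlim \<rho> (at_left 1) sequentially"
    unfolding filterlim_at by (intro conjI always_eventually) (use \<rho>(2) in \<open>auto simp: less_imp_neq\<close>)
  have "radial_limit \<theta> z = (if z \<in> E then lim (\<lambda>n. \<theta> (of_real (\<rho> n) * z)) else (THE l::complex. False))" if z: "z \<in> space \<mu>" for z
  proof (cases "z \<in> E")
    case True
    then obtain l where l: "((\<lambda>r::real. \<theta> (of_real r * z)) \<longlongrightarrow> l) (at_left 1)" by (auto simp: E_def)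
    have "radial_limit \<theta> z = l" unfolding radial_limit_def by (rule tendsto_Lim[OF _ l]) simp
    moreover have "lim (\<lambda>n. \<theta> (of_real (\<rho> n) * z)) = l"
      by (rule limI[OF filterlim_compose[OF l \<rho>lim]])
    ultimately show ?thesis using True by simp
  next
    case False
    then have "\<not> ((\<lambda>r::real. \<theta> (of_real r * z)) \<longlongrightarrow> l) (at_left 1)" for l using z by (auto simp: E_def)
    then show ?thesis using False by (simp add: radial_limit_def Topological_Spaces.Lim_def)
  qed
  moreover have "(\<lambda>z. if z \<in> E then lim (\<lambda>n. \<theta> (of_real (\<rho> n) * z)) else (THE l::complex. False)) \<in> borel_measurable \<mu>"
  proof (rule measurable_If)
    show "(\<lambda>z. lim (\<lambda>n. \<theta> (of_real (\<rho> n) * z))) \<in> borel_measurable \<mu>"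
      by (rule borel_measurable_lim_metric, rule borel_measurable_circle_continuous, rule cont) (use \<rho> in \<open>auto intro: less_imp_le\<close>)
    have "{x \<in> space \<mu>. x \<in> E} = E" using Es by auto
    then show "{x \<in> space \<mu>. x \<in> E} \<in> sets \<mu>" using E by simp
  qed simp
  ultimately show ?thesis by (subst measurable_cong) auto
qed

text \<open>
The Poisson integral is an average.
\<close>

lemma poisson_norm_le:
  assumes u: "u \<in> borel_measurable \<mu>" "AE z in \<mu>. norm (u z) \<le> C" and w: "norm w < 1"
  shows "norm (poisson u w) \<le> C"
proof -
  have iu: "integrable \<mu> u" using L2_integrable[OF L2_bounded[OF u]] .
  have ik: "integrable \<mu> (\<lambda>z. poisson_kernel w z)"
  proof -
    have "integrable \<mu> (\<lambda>z. Re (complex_of_real (poisson_kernel w z) * 1))"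
      by (intro integrable_Re integrable_poisson w) simp
    then show ?thesis by simp
  qed
  have "norm (poisson u w) \<le> (LINT z|\<mu>. norm (of_real (poisson_kernel w z) * u z))"
    unfolding poisson_def by (rule integral_norm_bound)
  also have "\<dots> \<le> (LINT z|\<mu>. poisson_kernel w z * C)"
  proof (rule integral_mono_AE)
    show "AE z in \<mu>. norm (of_real (poisson_kernel w z) * u z) \<le> poisson_kernel w z * C"
      using u(2) by eventually_elim (simp add: norm_mult poisson_kernel_nonneg[OF w] mult_left_mono)
  qed (use ik integrable_poisson[OF iu w] in auto)
  also have "\<dots> = C" by (simp add: poisson_one[OF w])
  finally show ?thesis .
qed

text \<open>
Without negative frequencies the Poisson integral is a power series, and Fatou's theorem identifies its
radial limits.
\<close>

lemma inner_function_poisson: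
  assumes u: "u \<in> H2" "AE z in \<mu>. norm (u z) = 1"
  shows "inner_function (poisson u)" "AE z in \<mu>. radial_limit (poisson u) z = u z"
    "radial_limit (poisson u) \<in> borel_measurable \<mu>"
proof -
  have iu: "integrable \<mu> u" by (intro L2_integrable H2_subset_L2 u)
  have hol: "poisson u holomorphic_on ball 0 1"
  proof (rule power_series_holomorphic)
    fix w :: complex assume "w \<in> ball 0 1"
    then have "norm w < 1" by simp
    from poisson_sums[OF iu this]
    show "(\<lambda>n. fourier_coeff u (int n) * (w - 0) ^ n) sums poisson u w"
      by (simp add: H2_fourier_neg[OF u(1)] mult.commute)
  qed
  show rl: "AE z in \<mu>. radial_limit (poisson u) z = u z"
    using fatou_radial_limit[OF iu] by eventually_elim (simp add: radial_limit_def tendsto_Lim)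
  show "radial_limit (poisson u) \<in> borel_measurable \<mu>"
    by (intro radial_limit_measurable holomorphic_on_imp_continuous_on hol)
  have "norm (poisson u w) \<le> 1" if "norm w < 1" for w
    by (rule poisson_norm_le[OF L2_measurable[OF H2_subset_L2[OF u(1)]] _ that]) (use u(2) in \<open>auto elim: eventually_mono\<close>)
  then have "bounded (poisson u ` ball 0 1)" unfolding bounded_iff by (intro exI[of _ 1]) auto
  moreover have "AE z in \<mu>. norm (radial_limit (poisson u) z) = 1" using rl u(2) by eventually_elim simp
  ultimately show "inner_function (poisson u)" using hol by (simp add: inner_function_def Hinf_def)
qed

text \<open>
Beurling's theorem. Let \<open>k\<close> be the least index of a coefficient that does not vanish on all of \<open>M\<close>, and let
\<open>p\<close> be the projection of \<open>z\<^sup>k\<close> to \<open>M\<close>, so that \<open>\<langle>m, p\<rangle>\<close> is the \<open>k\<close>-th coefficient of \<open>m\<close> for \<open>m\<close> in \<open>M\<close>. By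
minimality, \<open>p\<close> is orthogonal to \<open>z\<^sup>n M\<close> for all \<open>n \<ge> 1\<close>. For \<open>z\<^sup>n p\<close> this says that \<open>\<bar>p\<bar>\<^sup>2\<close> has no
coefficients besides the mean, so \<open>\<bar>p\<bar>\<close> is constant and \<open>p\<close> can be scaled to be unimodular. For general members
\<open>h\<close> of \<open>M\<close> it says that \<open>cnj p h\<close> has no negative frequencies, so \<open>h\<close> is \<open>p\<close> times a member of \<^const>\<open>H2\<close>.
\<close>

theorem beurling:
  assumes M: "closed_subspace M" "M \<subseteq> H2" and shift: "\<And>f. f \<in> M \<Longrightarrow> (\<lambda>z. z * f z) \<in> M"
    and nz: "f0 \<in> M" "\<not> (AE z in \<mu>. f0 z = 0)"
  shows "\<exists>\<theta>. inner_function \<theta> \<and> radial_limit \<theta> \<in> Linf \<and> radial_limit \<theta> \<in> M \<and> M = mult_H2 (radial_limit \<theta>)"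
proof -
  have MH2: "f \<in> H2" "f \<in> L2" if "f \<in> M" for f using that M(2) H2_subset_L2 by auto
  have shiftn: "(\<lambda>z. z ^ n * f z) \<in> M" if "f \<in> M" for f n
  proof (induction n)
    case (Suc n)
    from shift[OF Suc] show ?case by (simp add: mult.assoc)
  qed (use that in simp)
  have ex: "\<exists>k. \<exists>f\<in>M. fourier_coeff f (int k) \<noteq> 0"
    using H2_eqI[of f0 "\<lambda>z. 0"] nz MH2 by fastforce
  define k where "k = (LEAST k. \<exists>f\<in>M. fourier_coeff f (int k) \<noteq> 0)"
  obtain f where f: "f \<in> M" "fourier_coeff f (int k) \<noteq> 0" using LeastI_ex[OF ex] unfolding k_def by blast
  have kmin: "fourier_coeff g j = 0" if "g \<in> M" "j < int k" for g j
  proof (cases "j < 0")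
    case False
    then have "nat j < k" using that by simp
    from not_less_Least[OF this[unfolded k_def]] that False show ?thesis by auto
  qed (use H2_fourier_neg MH2 that in auto)
  obtain p where p: "p \<in> M" "\<And>m. m \<in> M \<Longrightarrow> L2_inner (\<lambda>z. z ^ k - p z) m = 0"
    using orthogonal_projection[OF M(1) H2_subset_L2[OF H2_power]] by blast
  have pin: "L2_inner m p = fourier_coeff m (int k)" if "m \<in> M" for m
  proof -
    have "L2_inner (\<lambda>z. z ^ k) m - L2_inner p m = 0"
      using p(2)[OF that] MH2 p(1) that by (simp add: L2_inner_diff_left H2_subset_L2)
    then have "L2_inner p m = L2_inner (\<lambda>z. z ^ k) m" by simp
    then show ?thesis
      by (simp add: fourier_coeff_inner L2_inner_commute[of m])
  qed
  have orth: "L2_inner (\<lambda>z. z ^ n * g z) p = 0" if "g \<in> M" "n \<ge> 1" for g n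
    using that by (simp add: pin shiftn fourier_coeff_mult_power kmin)
  define c where "c = L2_norm p"
  have c: "c > 0"
  proof -
    have "c \<noteq> 0"
    proof
      assume "c = 0"
      then have "norm (L2_inner f p) \<le> 0" using L2_Cauchy_Schwarz[of f p] MH2 f(1) p(1) by (simp add: c_def)
      then show False using pin[OF f(1)] f(2) by simp
    qed
    then show ?thesis using L2_norm_nonneg[of p] unfolding c_def by linarith
  qed
  have pabs: "AE z in \<mu>. p z * cnj (p z) = of_real (c\<^sup>2)"
  proof (rule fourier_coeff_unique)
    show "integrable \<mu> (\<lambda>z. p z * cnj (p z))" by (intro L2_integrable_inner MH2 p)
    have neg: "fourier_coeff (\<lambda>z. p z * cnj (p z)) (- int n) = (if n = 0 then of_real (c\<^sup>2) else 0)" for n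
    proof -
      have "fourier_coeff (\<lambda>z. p z * cnj (p z)) (- int n) = L2_inner (\<lambda>z. z ^ n * p z) p"
        by (simp add: fourier_coeff_neg L2_inner_def mult_ac)
      then show ?thesis using orth[OF p(1), of n] L2_inner_self[of p] by (simp add: c_def)
    qed
    have pos: "fourier_coeff (\<lambda>z. p z * cnj (p z)) (int n) = cnj (fourier_coeff (\<lambda>z. p z * cnj (p z)) (- int n))" for n
      using Bochner_Integration.integral_cnj[of \<mu> "\<lambda>z. p z * cnj (p z) * z ^ n"] by (simp add: fourier_coeff_neg fourier_coeff_nat mult_ac)
    show "fourier_coeff (\<lambda>z. p z * cnj (p z)) n = fourier_coeff (\<lambda>z. of_real (c\<^sup>2)) n" for n
    proof -
      have "fourier_coeff (\<lambda>z. of_real (c\<^sup>2)) n = (if n = 0 then of_real (c\<^sup>2) else 0)"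
        using fourier_coeff_cmult[of "of_real (c\<^sup>2)" "\<lambda>z. 1" n] fourier_coeff_power[of 0 n] by simp
      moreover have "fourier_coeff (\<lambda>z. p z * cnj (p z)) n = (if n = 0 then of_real (c\<^sup>2) else 0)"
        using neg[of "nat (- n)"] pos[of "nat n"] neg[of "nat n"] by (cases "n \<le> 0") auto
      ultimately show ?thesis by simp
    qed
  qed simp
  define u where "u z = of_real (1 / c) * p z" for z
  have uM: "u \<in> M" unfolding u_def by (rule closed_subspaceD(4)[OF M(1) p(1)])
  have unorm: "AE z in \<mu>. norm (u z) = 1"
    using pabs
  proof eventually_elim
    case (elim z)
    then have "complex_of_real ((norm (p z))\<^sup>2) = of_real (c\<^sup>2)" by (simp add: complex_norm_square del: of_real_power)
    then have "(norm (p z))\<^sup>2 = c\<^sup>2" by (simp only: of_real_eq_iff)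
    then have "norm (p z) = c" using c by (simp add: power2_eq_iff_nonneg)
    then show ?case using c by (simp add: u_def norm_mult norm_divide)
  qed
  \<comment> \<open>From here on \<open>v\<close>, which is measurable and equal to \<open>u\<close> almost everywhere, replaces \<open>u\<close>.\<close>
  define \<theta> where "\<theta> = poisson u"
  define v where "v = radial_limit \<theta>"
  have inner: "inner_function \<theta>" and vu: "AE z in \<mu>. v z = u z" and vm: "v \<in> borel_measurable \<mu>"
    using inner_function_poisson[OF MH2(1)[OF uM] unorm] by (simp_all add: \<theta>_def v_def)
  have vnorm: "AE z in \<mu>. norm (v z) = 1" using vu unorm by eventually_elim simp
  then have vle: "AE z in \<mu>. norm (v z) \<le> 1" by (auto elim: eventually_mono)
  then have vinf: "v \<in> Linf" using vm by (auto simp: Linf_def)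
  have vL2: "v \<in> L2" using vinf Linf_subset_L2 by blast
  have vM: "v \<in> M"
    by (rule closed_subspace_cong_AE[OF M(1) uM vL2]) (use vu in \<open>auto elim: eventually_mono\<close>)
  have sub1: "mult_H2 v \<subseteq> M"
  proof
    fix h assume "h \<in> mult_H2 v"
    then obtain g where h: "h \<in> L2" and g: "g \<in> H2" and hg: "AE z in \<mu>. h z = v z * g z" by (auto simp: mult_H2_def)
    have vg: "(\<lambda>z. v z * g z) \<in> L2" by (intro L2_mult vinf H2_subset_L2 g)
    have tM: "(\<lambda>z. v z * taylor g N z) \<in> M" for N
    proof -
      have "(\<lambda>z. \<Sum>k\<in>K. fourier_coeff g (int k) * (z ^ k * v z)) \<in> M" if "finite K" for K
        using that by (induction K rule: finite_induct)
          (simp_all add: closed_subspaceD(2,3,4)[OF M(1)] shiftn vM)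
      from this[of "{..N}"] show ?thesis by (simp add: taylor_def sum_distrib_left mult_ac)
    qed
    have "(\<lambda>z. v z * g z) \<in> M"
    proof (rule closed_subspaceD(5)[OF M(1) vg tM])
      have "L2_norm (\<lambda>z. v z * taylor g N z - v z * g z) \<le> L2_norm (\<lambda>z. taylor g N z - g z)" for N
        using L2_norm_mult_le[OF L2_diff[OF H2_subset_L2[OF taylor_H2] H2_subset_L2[OF g]] vm vle, of g N]
        by (simp add: right_diff_distrib)
      then show "(\<lambda>N. L2_norm (\<lambda>z. v z * taylor g N z - v z * g z)) \<longlonglongrightarrow> 0"
        by (intro Lim_null_comparison[OF _ taylor_tendsto[OF g]]) simp
    qed
    then show "h \<in> M" by (rule closed_subspace_cong_AE[OF M(1) _ h]) (use hg in \<open>auto elim: eventually_mono\<close>)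
  qed
  have sub2: "M \<subseteq> mult_H2 v"
  proof
    fix h assume h: "h \<in> M"
    define g where "g z = cnj (v z) * h z" for z
    have gL2: "g \<in> L2" unfolding g_def by (intro L2_mult Linf_cnj vinf MH2 h)
    have "fourier_coeff g j = 0" if j: "j < 0" for j
    proof -
      define n where "n = nat (- j)"
      have n: "n \<ge> 1" "j = - int n" using j by (auto simp: n_def)
      have zh: "(\<lambda>z. z ^ n * h z) \<in> L2" by (intro MH2 shiftn h)
      have "fourier_coeff g j = L2_inner (\<lambda>z. z ^ n * h z) v"
        by (simp add: n fourier_coeff_neg L2_inner_def g_def mult_ac)
      also have "\<dots> = cnj (L2_inner v (\<lambda>z. z ^ n * h z))" by (rule L2_inner_commute)
      also have "L2_inner v (\<lambda>z. z ^ n * h z) = L2_inner u (\<lambda>z. z ^ n * h z)"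
        by (rule L2_inner_cong_AE[OF vu vL2 MH2(2)[OF uM] zh])
      also have "\<dots> = of_real (1 / c) * cnj (L2_inner (\<lambda>z. z ^ n * h z) p)"
        unfolding u_def[abs_def] L2_inner_cmult_left by (simp add: L2_inner_commute[of p])
      finally show ?thesis using orth[OF h n(1)] by simp
    qed
    then have gH2: "g \<in> H2" using gL2 by (simp add: H2_def)
    have "AE z in \<mu>. h z = v z * g z"
      using vnorm by eventually_elim (simp add: g_def mult.assoc[symmetric] circle_mult_cnj)
    then show "h \<in> mult_H2 v" using gH2 MH2(2)[OF h] by (auto simp: mult_H2_def)
  qed
  show ?thesis
    using inner vinf vM sub1 sub2 unfolding v_def by blast
qed

section \<open>Kernels of Hankel operators\<close>

lemma bounded_hankel: "\<psi> \<in> Linf \<Longrightarrow> bounded_operator_H2 (hankel \<psi>)"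
  unfolding hankel_def[abs_def]
  by (rule bounded_proj_mult[where W=flip, OF _ flip_L2 L2_norm_flip])
     (simp_all add: flip_def fun_eq_iff, drule AE_circle_cnj, assumption)

text \<open>
The flip turns the factor \<open>z\<close> into \<open>z\<^sup>-\<^sup>1\<close>, which lowers the indices of the coefficients.
\<close>

lemma fourier_coeff_hankel_shift:
  assumes \<psi>: "\<psi> \<in> Linf" and f: "f \<in> H2"
  shows "fourier_coeff (hankel \<psi> (\<lambda>z. z * f z)) (int n) = fourier_coeff (hankel \<psi> f) (int n + 1)"
proof -
  have "fourier_coeff (hankel \<psi> (\<lambda>z. z * f z)) (int n) = fourier_coeff (\<lambda>z. \<psi> z * flip (\<lambda>z. z * f z) z) (int n)"
    by (rule fourier_coeff_hankel[OF \<psi> H2_mult_id[OF f]])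
  also have "\<dots> = fourier_coeff (\<lambda>z. z powi (-1) * (\<psi> z * flip f z)) (int n)"
    unfolding fourier_coeff_def
    by (rule integral_circle_cong) (simp add: flip_def inverse_circle mult_ac)
  also have "\<dots> = fourier_coeff (\<lambda>z. \<psi> z * flip f z) (int (n + 1))"
    unfolding fourier_coeff_mult_powi by (simp add: add.commute)
  also have "\<dots> = fourier_coeff (hankel \<psi> f) (int (n + 1))" by (rule fourier_coeff_hankel[OF \<psi> f, symmetric])
  finally show ?thesis by (simp add: add.commute)
qed

lemma ker_H2_iff:
  assumes A: "bounded_operator_H2 A"
  shows "f \<in> ker_H2 A \<longleftrightarrow> f \<in> H2 \<and> (\<forall>n. fourier_coeff (A f) (int n) = 0)"
proof
  assume f: "f \<in> ker_H2 A"
  then have fH: "f \<in> H2" and ae: "AE z in \<mu>. A f z = 0" by (auto simp: ker_H2_def)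
  have "fourier_coeff (A f) n = fourier_coeff (\<lambda>z. 0) n" for n
    by (rule fourier_coeff_cong_AE[OF ae]) (use L2_measurable H2_subset_L2 bounded_operator_H2_in[OF A fH] in auto)
  then show "f \<in> H2 \<and> (\<forall>n. fourier_coeff (A f) (int n) = 0)" using fH by simp
next
  assume f: "f \<in> H2 \<and> (\<forall>n. fourier_coeff (A f) (int n) = 0)"
  then have "AE z in \<mu>. A f z = 0" by (intro H2_eqI bounded_operator_H2_in[OF A]) auto
  then show "f \<in> ker_H2 A" using f by (simp add: ker_H2_def)
qed

lemma closed_subspace_ker:
  assumes A: "bounded_operator_H2 A"
  shows "closed_subspace (ker_H2 A)"
  unfolding closed_subspace_def
proof (intro conjI allI ballI impI)
  fix s and F :: "complex \<Rightarrow> complex" assume F: "F \<in> L2" and s: "\<forall>n::nat. s n \<in> ker_H2 A"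
    and lim: "(\<lambda>n. L2_norm (\<lambda>z. s n z - F z)) \<longlonglongrightarrow> 0"
  have sH: "s n \<in> H2" and s0: "fourier_coeff (A (s n)) (int j) = 0" for n j using s ker_H2_iff[OF A] by auto
  have FH: "F \<in> H2" using H2_closed[OF F _ lim] sH by blast
  have "fourier_coeff (A F) (int j) = 0" for j
    using fourier_op_tendsto[OF A sH FH lim, of "int j"] by (simp add: s0 LIMSEQ_const_iff)
  then show "F \<in> ker_H2 A" using FH by (simp add: ker_H2_iff[OF A])
qed (auto simp: ker_H2_iff[OF A] H2_subset_L2 fourier_op_zero[OF A] H2_add fourier_op_add[OF A] H2_cmult fourier_op_cmult[OF A])

text \<open>
The zero subspace consists of all representatives of zero, and every bounded operator annihilates them.
\<close>

lemma ker_H2_nonzero: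
  assumes A: "bounded_operator_H2 A"
  shows "ker_H2 A \<noteq> zero_H2 \<longleftrightarrow> (\<exists>f\<in>ker_H2 A. \<not> (AE z in \<mu>. f z = 0))"
proof -
  have "zero_H2 \<subseteq> ker_H2 A"
  proof
    fix f assume "f \<in> zero_H2"
    then have f: "f \<in> H2" "AE z in \<mu>. f z = 0" by (auto simp: zero_H2_def)
    then have "fourier_coeff (A f) n = 0" for n
      using fourier_op_cong[OF A f(1) H2_zero f(2)] fourier_op_zero[OF A] by simp
    then show "f \<in> ker_H2 A" using f by (simp add: ker_H2_iff[OF A])
  qed
  moreover have "f \<in> zero_H2 \<longleftrightarrow> (AE z in \<mu>. f z = 0)" if "f \<in> ker_H2 A" for f
    using that by (auto simp: zero_H2_def ker_H2_def)
  ultimately show ?thesis by blast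
qed

section \<open>Factorization of polynomials\<close>

text \<open>
On the closed right half plane the principal branch is continuous even at its branch point \<open>0\<close>. This
allows zeros on the circle below.
\<close>

lemma continuous_csqrt_right: "continuous_on {z. 0 \<le> Re z} csqrt"
proof (rule continuous_at_imp_continuous_on, rule ballI)
  fix z assume z: "z \<in> {z. 0 \<le> Re z}"
  show "isCont csqrt z"
  proof (cases "z = 0")
    case True
    have "((\<lambda>w. norm (csqrt w)) \<longlongrightarrow> sqrt (norm (0::complex))) (at 0)"
      unfolding norm_csqrt by (intro tendsto_intros)
    then have "(csqrt \<longlongrightarrow> 0) (at 0)" by (intro tendsto_norm_zero_cancel[of csqrt]) simp
    then show ?thesis using True by (simp add: isCont_def)
  next
    case False
    have "z \<notin> \<real>\<^sub>\<le>\<^sub>0"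
    proof
      assume "z \<in> \<real>\<^sub>\<le>\<^sub>0"
      then have "Im z = 0" "Re z \<le> 0" by (auto simp: complex_nonpos_Reals_iff)
      then show False using z False by (auto simp: complex_eq_iff)
    qed
    then show ?thesis by (rule continuous_at_csqrt)
  qed
qed

lemma disc_algebra_csqrt:
  assumes c: "norm c \<le> 1"
  shows "(\<lambda>z. csqrt (1 - c * z)) \<in> disc_algebra"
proof -
  have re: "Re (c * z) \<le> norm z" for z
    using complex_Re_le_cmod[of "c * z"] mult_left_le_one_le[OF norm_ge_zero norm_ge_zero c, of z] by (simp add: norm_mult)
  have "continuous_on (cball 0 1) (\<lambda>z. csqrt (1 - c * z))"
  proof (rule continuous_on_compose2[OF continuous_csqrt_right])
    show "(\<lambda>z. 1 - c * z) ` cball 0 1 \<subseteq> {z. 0 \<le> Re z}"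
    proof (clarsimp simp del: times_complex.sel)
      fix z :: complex assume "norm z \<le> 1"
      then show "Re (c * z) \<le> 1" using re[of z] by linarith
    qed
  qed (intro continuous_intros)
  moreover have "(\<lambda>z. csqrt (1 - c * z)) holomorphic_on ball 0 1"
  proof (intro holomorphic_on_csqrt' holomorphic_intros)
    fix z :: complex assume "z \<in> ball 0 1"
    then have "Re (1 - c * z) > 0" using re[of z] by (simp del: times_complex.sel)
    then show "1 - c * z \<notin> \<real>\<^sub>\<le>\<^sub>0" by (auto simp: complex_nonpos_Reals_iff)
  qed
  ultimately show ?thesis by (simp add: disc_algebra_def)
qed

lemma disc_algebra_const [simp]: "(\<lambda>z. c) \<in> disc_algebra"
  by (simp add: disc_algebra_def)

lemma norm_csqrt_square: "(norm (csqrt z))\<^sup>2 = norm z"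
  by (simp flip: norm_power)

text \<open>
The factorization of F. Riesz, which converts an integral of \<open>\<bar>f\<bar>\<close> into a product of two norms in \<^const>\<open>L2\<close>.
\<close>

definition riesz_factorable :: "(complex \<Rightarrow> complex) \<Rightarrow> bool" where
  "riesz_factorable f \<longleftrightarrow> (\<exists>g\<in>disc_algebra. \<exists>h\<in>disc_algebra. \<forall>z. norm z = 1 \<longrightarrow>
     f z = g z * h z \<and> (norm (g z))\<^sup>2 = norm (f z) \<and> (norm (h z))\<^sup>2 = norm (f z))"

lemma riesz_factorableI:
  assumes "g \<in> disc_algebra" "h \<in> disc_algebra"
    and "\<And>z. norm z = 1 \<Longrightarrow> f z = g z * h z" "\<And>z. norm z = 1 \<Longrightarrow> (norm (g z))\<^sup>2 = norm (f z)"
      "\<And>z. norm z = 1 \<Longrightarrow> (norm (h z))\<^sup>2 = norm (f z)"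
  shows "riesz_factorable f"
  using assms unfolding riesz_factorable_def by blast

lemma riesz_factorable_mult:
  assumes "riesz_factorable f1" "riesz_factorable f2"
  shows "riesz_factorable (\<lambda>z. f1 z * f2 z)"
proof -
  obtain g1 h1 where 1: "g1 \<in> disc_algebra" "h1 \<in> disc_algebra" "\<And>z. norm z = 1 \<Longrightarrow>
     f1 z = g1 z * h1 z \<and> (norm (g1 z))\<^sup>2 = norm (f1 z) \<and> (norm (h1 z))\<^sup>2 = norm (f1 z)"
    using assms(1) unfolding riesz_factorable_def by blast
  obtain g2 h2 where 2: "g2 \<in> disc_algebra" "h2 \<in> disc_algebra" "\<And>z. norm z = 1 \<Longrightarrow>
     f2 z = g2 z * h2 z \<and> (norm (g2 z))\<^sup>2 = norm (f2 z) \<and> (norm (h2 z))\<^sup>2 = norm (f2 z)"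
    using assms(2) unfolding riesz_factorable_def by blast
  show ?thesis
  proof (rule riesz_factorableI)
    show "(\<lambda>z. g1 z * g2 z) \<in> disc_algebra" "(\<lambda>z. h1 z * h2 z) \<in> disc_algebra"
      by (intro disc_algebra_mult 1 2)+
    fix z :: complex assume z: "norm z = 1"
    show "f1 z * f2 z = g1 z * g2 z * (h1 z * h2 z)" using 1(3)[OF z] 2(3)[OF z] by (simp add: mult_ac)
    show "(norm (g1 z * g2 z))\<^sup>2 = norm (f1 z * f2 z)" "(norm (h1 z * h2 z))\<^sup>2 = norm (f1 z * f2 z)"
      using 1(3)[OF z] 2(3)[OF z] by (simp_all only: norm_mult power_mult_distrib)
  qed
qed

lemma riesz_factorable_const: "riesz_factorable (\<lambda>z. c)"
  by (rule riesz_factorableI[of "\<lambda>z. csqrt c" "\<lambda>z. csqrt c"])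
     (simp_all only: norm_csqrt_square disc_algebra_const, simp flip: power2_eq_square)

text \<open>
If \<open>\<bar>a\<bar> < 1\<close>, then \<open>z - a\<close> is a Blaschke factor, which is unimodular on the circle, times \<open>1 - cnj a z\<close>. If
\<open>\<bar>a\<bar> \<ge> 1\<close>, then it is a constant times \<open>1 - z/a\<close>. In both cases the last factor maps the closed disc into the closed
right half plane and so has a square root in the disc algebra.
\<close>

lemma riesz_factorable_linear: "riesz_factorable (\<lambda>z. z - a)"
proof (cases "norm a < 1")
  case True
  let ?s = "\<lambda>z. csqrt (1 - cnj a * z)" and ?b = "\<lambda>z. (z - a) * (1 / (1 - cnj a * z))"
  have id: "(\<lambda>z. z - a) \<in> disc_algebra" by (auto simp: disc_algebra_def intro!: continuous_intros holomorphic_intros)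
  have b: "?b \<in> disc_algebra" by (rule disc_algebra_mult[OF id kernel_disc_algebra[OF True]])
  have s: "?s \<in> disc_algebra" using True by (intro disc_algebra_csqrt) simp
  show ?thesis
  proof (rule riesz_factorableI[OF disc_algebra_mult[OF b s] s])
    fix z :: complex assume z: "norm z = 1"
    have "z - a = z * cnj (1 - cnj a * z)" using circle_mult_cnj(1)[OF z] by (simp add: algebra_simps)
    then have n: "norm (z - a) = norm (1 - cnj a * z)" using z by (metis complex_mod_cnj mult_1 norm_mult)
    have "z \<noteq> a" using z True by auto
    then have ne: "1 - cnj a * z \<noteq> 0" using n by auto
    have sq: "?s z * ?s z = 1 - cnj a * z" by (simp flip: power2_eq_square)
    have "?b z * ?s z * ?s z = ?b z * (1 - cnj a * z)" unfolding mult.assoc[of "?b z"] sq ..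
    then have 1: "z - a = ?b z * ?s z * ?s z" using ne by simp
    have bn: "norm (?b z) = 1" using ne n by (simp add: norm_mult norm_divide)
    have 2: "(norm (?s z))\<^sup>2 = norm (z - a)" by (simp only: norm_csqrt_square n)
    have 3: "(norm (?b z * ?s z))\<^sup>2 = norm (z - a)" by (simp only: norm_mult[of "?b z"] bn mult_1 2)
    show "z - a = ?b z * ?s z * ?s z" "(norm (?b z * ?s z))\<^sup>2 = norm (z - a)" "(norm (?s z))\<^sup>2 = norm (z - a)"
      by (fact 1 3 2)+
  qed
next
  case False
  then have a: "a \<noteq> 0" "norm (1 / a) \<le> 1" by (auto simp: norm_divide divide_le_eq_1 not_less)
  have s: "riesz_factorable (\<lambda>z. 1 - 1 / a * z)"
  proof (rule riesz_factorableI[OF disc_algebra_csqrt[OF a(2)] disc_algebra_csqrt[OF a(2)]])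
    fix z
    show "1 - 1 / a * z = csqrt (1 - 1 / a * z) * csqrt (1 - 1 / a * z)" by (simp flip: power2_eq_square)
  qed (simp_all only: norm_csqrt_square)
  from riesz_factorable_mult[OF riesz_factorable_const[of "- a"] s] show ?thesis using a by (simp add: algebra_simps)
qed

lemma riesz_factorable_poly: "riesz_factorable (poly p)"
proof (induction "degree p" arbitrary: p rule: less_induct)
  case less
  show ?case
  proof (cases "degree p = 0")
    case True
    then obtain c where "p = [:c:]" by (metis degree_0_id)
    moreover have "poly [:c:] = (\<lambda>z. c)" by auto
    ultimately show ?thesis using riesz_factorable_const[of c] by simp
  next
    case False
    then have "coeff p (degree p) \<noteq> 0" by auto
    then have "coeff p 0 = 0 \<or> (\<exists>i\<in>{1..degree p}. coeff p i \<noteq> 0)"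
      using False by (intro disjI2 bexI[of _ "degree p"]) auto
    then obtain a where "(\<Sum>i\<le>degree p. coeff p i * a ^ i) = 0"
      by (rule fundamental_theorem_of_algebra)
    then have a: "poly p a = 0" by (simp add: poly_altdef)
    then obtain q where q: "p = [:- a, 1:] * q" by (auto simp: poly_eq_0_iff_dvd dvd_def)
    have "q \<noteq> 0" using q False by auto
    then have "degree p = Suc (degree q)" unfolding q by (subst degree_mult_eq) auto
    then have "riesz_factorable (poly q)" using less by simp
    moreover have "poly p = (\<lambda>z. (z - a) * poly q z)" by (auto simp: q fun_eq_iff algebra_simps)
    ultimately show ?thesis using riesz_factorable_mult[OF riesz_factorable_linear[of a]] by simp
  qed
qed

section \<open>Extension of dominated functionals\<close>

definition sublinear :: "((complex \<Rightarrow> complex) \<Rightarrow> real) \<Rightarrow> bool" where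
  "sublinear p \<longleftrightarrow> (\<forall>f\<in>L2. \<forall>g\<in>L2. p (\<lambda>z. f z + g z) \<le> p f + p g) \<and>
     (\<forall>f\<in>L2. \<forall>t>0. p (\<lambda>z. of_real t * f z) = t * p f)"

lemma sublinearD:
  assumes "sublinear p"
  shows "f \<in> L2 \<Longrightarrow> g \<in> L2 \<Longrightarrow> p (\<lambda>z. f z + g z) \<le> p f + p g"
    and "f \<in> L2 \<Longrightarrow> t > 0 \<Longrightarrow> p (\<lambda>z. of_real t * f z) = t * p f"
  using assms unfolding sublinear_def by blast+

lemma sublinear_zero: "sublinear p \<Longrightarrow> p (\<lambda>z. 0) = 0"
  using sublinearD(2)[of p "\<lambda>z. 0" 2] by simp

lemma sublinear_neg: "sublinear p \<Longrightarrow> f \<in> L2 \<Longrightarrow> - p (\<lambda>z. - f z) \<le> p f"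
  using sublinearD(1)[of p f "\<lambda>z. - f z"] sublinear_zero[of p] by (simp add: L2_uminus)

text \<open>
One step towards a dominated linear functional: \<open>q\<close> is the largest sublinear functional below \<open>p\<close> with
\<open>q (- m) \<le> - l m\<close> on \<open>K\<close>. The infimum is finite because \<open>l m \<le> p m \<le> p (f + m) + p (- f)\<close>, and subadditive
because \<open>K\<close> is a convex cone on which \<open>l\<close> is additive.
\<close>

lemma sublinear_infimum:
  assumes p: "sublinear p"
    and K: "K \<subseteq> L2" "(\<lambda>z. 0) \<in> K" "\<And>m m'. m \<in> K \<Longrightarrow> m' \<in> K \<Longrightarrow> (\<lambda>z. m z + m' z) \<in> K"
      "\<And>m t. m \<in> K \<Longrightarrow> t > 0 \<Longrightarrow> (\<lambda>z. of_real t * m z) \<in> K"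
    and l: "\<And>m m'. m \<in> K \<Longrightarrow> m' \<in> K \<Longrightarrow> l (\<lambda>z. m z + m' z) = l m + l m'"
      "\<And>m t. m \<in> K \<Longrightarrow> t > 0 \<Longrightarrow> l (\<lambda>z. of_real t * m z) = t * l m"
      "\<And>m. m \<in> K \<Longrightarrow> l m \<le> p m"
  defines "q \<equiv> \<lambda>f. INF m\<in>K. p (\<lambda>z. f z + m z) - l m"
  shows "sublinear q" "\<And>f. f \<in> L2 \<Longrightarrow> q f \<le> p f" "\<And>m. m \<in> K \<Longrightarrow> q (\<lambda>z. - m z) \<le> - l m"
proof -
  have KL: "m \<in> L2" if "m \<in> K" for m using K(1) that by blast
  have l0: "l (\<lambda>z. 0) = 0" using l(2)[OF K(2), of 2] by simp
  have bound: "- p (\<lambda>z. - f z) \<le> p (\<lambda>z. f z + m z) - l m" if "f \<in> L2" "m \<in> K" for f m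
  proof -
    have "l m \<le> p m" by (rule l(3)[OF that(2)])
    also have "\<dots> = p (\<lambda>z. (f z + m z) + - f z)" by simp
    also have "\<dots> \<le> p (\<lambda>z. f z + m z) + p (\<lambda>z. - f z)"
      by (intro sublinearD(1)[OF p] L2_add L2_uminus that KL)
    finally show ?thesis by simp
  qed
  have bdd: "bdd_below ((\<lambda>m. p (\<lambda>z. f z + m z) - l m) ` K)" if "f \<in> L2" for f
    by (rule bdd_belowI2[of _ "- p (\<lambda>z. - f z)"]) (rule bound[OF that])
  have le: "q f \<le> p (\<lambda>z. f z + m z) - l m" if "f \<in> L2" "m \<in> K" for f m
    unfolding q_def by (rule cINF_lower[OF bdd[OF that(1)] that(2)])
  have ge: "x \<le> q f" if "\<And>m. m \<in> K \<Longrightarrow> x \<le> p (\<lambda>z. f z + m z) - l m" for x f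
    unfolding q_def by (rule cINF_greatest) (use K(2) that in auto)
  show "q f \<le> p f" if "f \<in> L2" for f using le[OF that K(2)] by (simp add: l0)
  show "q (\<lambda>z. - m z) \<le> - l m" if "m \<in> K" for m
    using le[OF L2_uminus[OF KL[OF that]] that] by (simp add: sublinear_zero[OF p])
  show "sublinear q" unfolding sublinear_def
  proof (intro conjI ballI allI impI)
    fix f g assume f: "f \<in> L2" and g: "g \<in> L2"
    have 1: "q (\<lambda>z. f z + g z) \<le> (p (\<lambda>z. f z + m z) - l m) + (p (\<lambda>z. g z + m' z) - l m')" if "m \<in> K" "m' \<in> K" for m m'
    proof -
      have "q (\<lambda>z. f z + g z) \<le> p (\<lambda>z. (f z + g z) + (m z + m' z)) - l (\<lambda>z. m z + m' z)"
        by (intro le L2_add f g K(3) that)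
      also have "p (\<lambda>z. (f z + g z) + (m z + m' z)) = p (\<lambda>z. (f z + m z) + (g z + m' z))" by (simp add: add_ac)
      also have "\<dots> \<le> p (\<lambda>z. f z + m z) + p (\<lambda>z. g z + m' z)"
        by (intro sublinearD(1)[OF p] L2_add f g KL that)
      finally show ?thesis by (simp add: l(1) that)
    qed
    have 2: "q (\<lambda>z. f z + g z) - (p (\<lambda>z. f z + m z) - l m) \<le> q g" if "m \<in> K" for m
      using 1[OF that] by (intro ge) (simp add: algebra_simps)
    have "q (\<lambda>z. f z + g z) - q g \<le> q f"
      using 2 by (intro ge) (simp add: algebra_simps)
    then show "q (\<lambda>z. f z + g z) \<le> q f + q g" by simp
  next
    fix f and t :: real assume f: "f \<in> L2" and t: "t > 0"
    have scale: "q (\<lambda>z. of_real s * h z) \<le> s * q h" if "h \<in> L2" "s > 0" for h and s :: real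
    proof -
      have "q (\<lambda>z. of_real s * h z) / s \<le> q h"
      proof (rule ge)
        fix m assume m: "m \<in> K"
        have "q (\<lambda>z. of_real s * h z) \<le> p (\<lambda>z. of_real s * h z + of_real s * m z) - l (\<lambda>z. of_real s * m z)"
          by (intro le L2_cmult that K(4) m)
        also have "(\<lambda>z. of_real s * h z + of_real s * m z) = (\<lambda>z. of_real s * (h z + m z))" by (simp add: distrib_left)
        also have "p \<dots> = s * p (\<lambda>z. h z + m z)" by (intro sublinearD(2)[OF p] L2_add KL m that)
        also have "l (\<lambda>z. of_real s * m z) = s * l m" by (rule l(2)[OF m that(2)])
        finally show "q (\<lambda>z. of_real s * h z) / s \<le> p (\<lambda>z. h z + m z) - l m"
          using that by (simp add: field_simps)
      qed
      then show ?thesis using that by (simp add: field_simps)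
    qed
    have "q (\<lambda>z. of_real (1 / t) * (of_real t * f z)) \<le> 1 / t * q (\<lambda>z. of_real t * f z)"
      using t by (intro scale L2_cmult f) simp
    then have "t * q f \<le> q (\<lambda>z. of_real t * f z)" using t by (simp add: field_simps)
    then show "q (\<lambda>z. of_real t * f z) = t * q f" using scale[OF f t] by simp
  qed
qed

text \<open>
The cone is the ray of \<open>v\<close>, on which \<open>p\<close> itself is additive. Every sublinear functional below \<open>q\<close>
is then linear in the direction \<open>v\<close>, because its values at \<open>v\<close> and \<open>- v\<close> add up to at least \<open>0\<close>.
\<close>

lemma sublinear_step:
  assumes p: "sublinear p" and v: "v \<in> L2"
  shows "\<exists>q. sublinear q \<and> (\<forall>f\<in>L2. q f \<le> p f) \<and> q (\<lambda>z. - v z) \<le> - p v"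
proof -
  define K where "K = {\<lambda>z. of_real t * v z | t::real. t \<ge> 0}"
  have pK: "p (\<lambda>z. of_real t * v z) = t * p v" if "t \<ge> 0" for t
    using that sublinearD(2)[OF p v, of t] sublinear_zero[OF p] by (cases "t = 0") auto
  have KI: "(\<lambda>z. of_real t * v z) \<in> K" if "t \<ge> 0" for t using that by (auto simp: K_def)
  have KE: "\<exists>t\<ge>0. m = (\<lambda>z. of_real t * v z)" if "m \<in> K" for m using that by (auto simp: K_def)
  have K: "K \<subseteq> L2" "(\<lambda>z. 0) \<in> K" "\<And>m m'. m \<in> K \<Longrightarrow> m' \<in> K \<Longrightarrow> (\<lambda>z. m z + m' z) \<in> K"
    "\<And>m t. m \<in> K \<Longrightarrow> t > 0 \<Longrightarrow> (\<lambda>z. of_real t * m z) \<in> K"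
  proof -
    show "K \<subseteq> L2" using v by (auto simp: K_def L2_cmult)
    show "(\<lambda>z. 0) \<in> K" using KI[of 0] by simp
    show "(\<lambda>z. m z + m' z) \<in> K" if mm: "m \<in> K" "m' \<in> K" for m m'
    proof -
      obtain s t where "s \<ge> 0" "t \<ge> 0" "m = (\<lambda>z. of_real s * v z)" "m' = (\<lambda>z. of_real t * v z)"
        using KE[OF mm(1)] KE[OF mm(2)] by blast
      then show ?thesis using KI[of "s + t"] by (simp add: distrib_right)
    qed
    show "(\<lambda>z. of_real t * m z) \<in> K" if m: "m \<in> K" "t > 0" for m and t :: real
    proof -
      obtain s where "s \<ge> 0" "m = (\<lambda>z. of_real s * v z)" using KE[OF m(1)] by blast
      then show ?thesis using KI[of "t * s"] m(2) by (simp add: mult.assoc)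
    qed
  qed
  have l: "\<And>m m'. m \<in> K \<Longrightarrow> m' \<in> K \<Longrightarrow> p (\<lambda>z. m z + m' z) = p m + p m'"
    "\<And>m t. m \<in> K \<Longrightarrow> t > 0 \<Longrightarrow> p (\<lambda>z. of_real t * m z) = t * p m"
  proof -
    show "p (\<lambda>z. m z + m' z) = p m + p m'" if mm: "m \<in> K" "m' \<in> K" for m m'
    proof -
      obtain s t where st: "s \<ge> 0" "t \<ge> 0" "m = (\<lambda>z. of_real s * v z)" "m' = (\<lambda>z. of_real t * v z)"
        using KE[OF mm(1)] KE[OF mm(2)] by blast
      then show ?thesis using pK[of "s + t"] pK[of s] pK[of t] by (simp add: distrib_right)
    qed
    show "p (\<lambda>z. of_real t * m z) = t * p m" if "m \<in> K" "t > 0" for m and t :: real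
      using sublinearD(2)[OF p _ that(2)] K(1) that(1) by blast
  qed
  have "v \<in> K" using KI[of 1] by simp
  then show ?thesis
    using sublinear_infimum[OF p K l order_refl] by blast
qed

text \<open>
The Hahn-Banach theorem for countably many directions: the step is repeated for each \<open>v n\<close>, and the
pointwise infimum of the decreasing sequence of sublinear functionals is taken.
\<close>

lemma hahn_banach_countable:
  fixes v :: "nat \<Rightarrow> complex \<Rightarrow> complex"
  assumes p: "sublinear p" and v: "\<And>n. v n \<in> L2"
  shows "\<exists>P. sublinear P \<and> (\<forall>f\<in>L2. P f \<le> p f) \<and> (\<forall>n. P (\<lambda>z. - v n z) = - P (v n))"
proof -
  have "\<exists>s. \<forall>n. (sublinear (s n) \<and> (\<forall>f\<in>L2. s n f \<le> p f)) \<and>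
     ((\<forall>f\<in>L2. s (Suc n) f \<le> s n f) \<and> s (Suc n) (\<lambda>z. - v n z) \<le> - s n (v n))"
  proof (rule dependent_nat_choice)
    show "\<exists>x. sublinear x \<and> (\<forall>f\<in>L2. x f \<le> p f)" using p by blast
    fix x and n :: nat assume x: "sublinear x \<and> (\<forall>f\<in>L2. x f \<le> p f)"
    obtain q where "sublinear q" "\<forall>f\<in>L2. q f \<le> x f" "q (\<lambda>z. - v n z) \<le> - x (v n)"
      using sublinear_step[of x "v n"] x v by blast
    then show "\<exists>y. (sublinear y \<and> (\<forall>f\<in>L2. y f \<le> p f)) \<and> (\<forall>f\<in>L2. y f \<le> x f) \<and> y (\<lambda>z. - v n z) \<le> - x (v n)"
      using x by (intro exI[of _ q]) (auto intro: order_trans)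
  qed
  then obtain s where s: "\<And>n. sublinear (s n)" "\<And>n f. f \<in> L2 \<Longrightarrow> s n f \<le> p f"
    and dec: "\<And>n f. f \<in> L2 \<Longrightarrow> s (Suc n) f \<le> s n f" and sv: "\<And>n. s (Suc n) (\<lambda>z. - v n z) \<le> - s n (v n)" by blast
  have mono: "s n f \<le> s m f" if "m \<le> n" "f \<in> L2" for m n f
    using that(1) by (induction rule: dec_induct) (auto intro: order_trans[OF dec[OF that(2)]])
  have bound: "- p (\<lambda>z. - f z) \<le> s n f" if "f \<in> L2" for n f
    using sublinear_neg[OF s(1)[of n] that] s(2)[OF L2_uminus[OF that], of n] by linarith
  define P where "P f = (INF n. s n f)" for f
  have le: "P f \<le> s n f" if "f \<in> L2" for n f
    unfolding P_def by (intro cINF_lower bdd_belowI2[of _ "- p (\<lambda>z. - f z)"] bound that) auto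
  have ge: "x \<le> P f" if "\<And>n. x \<le> s n f" for x f
    unfolding P_def by (rule cINF_greatest) (use that in auto)
  have sub: "sublinear P" unfolding sublinear_def
  proof (intro conjI ballI allI impI)
    fix f g assume fg: "f \<in> L2" "g \<in> L2"
    have 1: "P (\<lambda>z. f z + g z) \<le> s n f + s m g" for n m
    proof -
      have "P (\<lambda>z. f z + g z) \<le> s (max n m) (\<lambda>z. f z + g z)" by (intro le L2_add fg)
      also have "\<dots> \<le> s (max n m) f + s (max n m) g" by (intro sublinearD(1)[OF s(1)] fg)
      also have "\<dots> \<le> s n f + s m g" by (intro add_mono mono fg) auto
      finally show ?thesis .
    qed
    have "P (\<lambda>z. f z + g z) - s n f \<le> P g" for n using 1[of n] by (intro ge) (simp add: algebra_simps)
    then have "P (\<lambda>z. f z + g z) - P g \<le> P f" by (intro ge) (simp add: algebra_simps)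
    then show "P (\<lambda>z. f z + g z) \<le> P f + P g" by simp
  next
    fix f and t :: real assume f: "f \<in> L2" and t: "t > 0"
    have a: "P (\<lambda>z. of_real t * f z) \<le> t * P f"
    proof -
      have "P (\<lambda>z. of_real t * f z) \<le> t * s n f" for n
        using le[OF L2_cmult[OF f], of "of_real t" n] sublinearD(2)[OF s(1) f t, of n] by simp
      then have "P (\<lambda>z. of_real t * f z) / t \<le> P f" using t by (intro ge) (simp add: field_simps)
      then show ?thesis using t by (simp add: field_simps)
    qed
    have b: "t * P f \<le> P (\<lambda>z. of_real t * f z)"
      using le[OF f] t by (intro ge) (simp add: sublinearD(2)[OF s(1) f t])
    show "P (\<lambda>z. of_real t * f z) = t * P f" using a b by simp
  qed
  have "P (\<lambda>z. - v n z) = - P (v n)" for n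
    using sv[of n] le[OF L2_uminus[OF v], of n "Suc n"] le[OF v, of n n] sublinear_neg[OF sub v, of n] by linarith
  moreover have "\<forall>f\<in>L2. P f \<le> p f" using le s(2) order_trans by blast
  ultimately show ?thesis using sub by blast
qed

text \<open>
A sublinear functional is additive along the vectors with this property, and they form a real subspace.
\<close>

definition additive_at :: "((complex \<Rightarrow> complex) \<Rightarrow> real) \<Rightarrow> (complex \<Rightarrow> complex) \<Rightarrow> bool" where
  "additive_at P v \<longleftrightarrow> v \<in> L2 \<and> P (\<lambda>z. - v z) = - P v"

lemma additive_at_add:
  assumes P: "sublinear P" and v: "additive_at P v" and f: "f \<in> L2"
  shows "P (\<lambda>z. f z + v z) = P f + P v"
proof -
  have vL: "v \<in> L2" and vn: "P (\<lambda>z. - v z) = - P v" using v by (auto simp: additive_at_def)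
  have "P (\<lambda>z. (f z + v z) + - v z) \<le> P (\<lambda>z. f z + v z) + P (\<lambda>z. - v z)"
    by (intro sublinearD(1)[OF P] L2_add L2_uminus f vL)
  then show ?thesis using sublinearD(1)[OF P f vL] vn by simp
qed

lemma additive_at_sum:
  assumes P: "sublinear P" and u: "additive_at P u" and v: "additive_at P v"
  shows "additive_at P (\<lambda>z. u z + v z)"
proof -
  have uL: "u \<in> L2" and vL: "v \<in> L2" using u v by (auto simp: additive_at_def)
  have nv: "additive_at P (\<lambda>z. - v z)" using v by (simp add: additive_at_def L2_uminus)
  have "P (\<lambda>z. - u z + - v z) = P (\<lambda>z. - u z) + P (\<lambda>z. - v z)"
    by (rule additive_at_add[OF P nv L2_uminus[OF uL]])
  also have "\<dots> = - P (\<lambda>z. u z + v z)"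
    using u v additive_at_add[OF P v uL] by (simp add: additive_at_def)
  finally show ?thesis using uL vL by (simp add: additive_at_def L2_add)
qed

lemma additive_at_scale:
  assumes P: "sublinear P" and v: "additive_at P v"
  shows "P (\<lambda>z. of_real t * v z) = t * P v" "additive_at P (\<lambda>z. of_real t * v z)"
proof -
  have vL: "v \<in> L2" and vn: "P (\<lambda>z. - v z) = - P v" using v by (auto simp: additive_at_def)
  have *: "P (\<lambda>z. of_real t * v z) = t * P v" for t :: real
  proof (cases t "0::real" rule: linorder_cases)
    case less
    have "P (\<lambda>z. of_real (- t) * - v z) = - t * P (\<lambda>z. - v z)"
      using less by (intro sublinearD(2)[OF P] L2_uminus vL) simp
    then show ?thesis by (simp add: vn)
  qed (use sublinear_zero[OF P] sublinearD(2)[OF P vL] in auto)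
  show "P (\<lambda>z. of_real t * v z) = t * P v" by (rule *)
  show "additive_at P (\<lambda>z. of_real t * v z)"
    using *[of "- t"] *[of t] vL by (simp add: additive_at_def L2_cmult)
qed


section \<open>The theorem of Nehari\<close>

lemma op_eqI_power:
  assumes A: "bounded_operator_H2 A" and B: "bounded_operator_H2 B"
    and eq: "\<And>k n. fourier_coeff (A (\<lambda>z. z ^ k)) (int n) = fourier_coeff (B (\<lambda>z. z ^ k)) (int n)"
  shows "op_eq A B"
  unfolding op_eq_def
proof (intro ballI H2_eqI bounded_operator_H2_in[OF A] bounded_operator_H2_in[OF B])
  fix f n assume f: "f \<in> H2"
  have "fourier_coeff (A (taylor f N)) (int n) = fourier_coeff (B (taylor f N)) (int n)" for N
    unfolding taylor_def[abs_def] by (simp add: fourier_op_sum[OF A] fourier_op_sum[OF B] eq)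
  moreover have "(\<lambda>N. fourier_coeff (A (taylor f N)) (int n)) \<longlonglongrightarrow> fourier_coeff (A f) (int n)"
    by (rule fourier_op_tendsto[OF A taylor_H2 f taylor_tendsto[OF f]])
  moreover have "(\<lambda>N. fourier_coeff (B (taylor f N)) (int n)) \<longlonglongrightarrow> fourier_coeff (B f) (int n)"
    by (rule fourier_op_tendsto[OF B taylor_H2 f taylor_tendsto[OF f]])
  ultimately show "fourier_coeff (A f) (int n) = fourier_coeff (B f) (int n)" using LIMSEQ_unique by simp
qed

lemma poly_H2 [simp]: "poly p \<in> H2"
  by (rule disc_algebra_H2) (auto simp: disc_algebra_def intro!: continuous_intros holomorphic_intros)

text \<open>
For \<open>p = g h\<close> the Hankel property gives \<open>(D (g h))\<^sub>0 = \<Sum> g\<^sub>k (D h)\<^sub>k\<close>, which is at most \<open>\<parallel>g\<parallel> \<parallel>D h\<parallel>\<close> by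
Cauchy-Schwarz. The factorization with \<open>\<bar>g\<bar>\<^sup>2 = \<bar>h\<bar>\<^sup>2 = \<bar>p\<bar>\<close> makes \<open>\<parallel>g\<parallel> \<parallel>h\<parallel>\<close> the integral of \<open>\<bar>p\<bar>\<close>. The sum is
infinite in general, so \<open>g\<close> is approximated by its Taylor polynomials.
\<close>

lemma hankel_functional_bound:
  assumes D: "bounded_operator_H2 D" and C: "0 \<le> C" "\<And>f. f \<in> H2 \<Longrightarrow> L2_norm (D f) \<le> C * L2_norm f"
    and hank: "\<And>f i k. f \<in> H2 \<Longrightarrow> fourier_coeff (D (\<lambda>z. z ^ k * f z)) (int i) = fourier_coeff (D f) (int (i + k))"
  shows "norm (fourier_coeff (D (poly p)) 0) \<le> C * (LINT z|\<mu>. norm (poly p z))"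
proof -
  obtain g h where gh: "g \<in> disc_algebra" "h \<in> disc_algebra" "\<And>z. norm z = 1 \<Longrightarrow>
     poly p z = g z * h z \<and> (norm (g z))\<^sup>2 = norm (poly p z) \<and> (norm (h z))\<^sup>2 = norm (poly p z)"
    using riesz_factorable_poly[of p] unfolding riesz_factorable_def by blast
  note gH = disc_algebra_H2[OF gh(1)] and hH = disc_algebra_H2[OF gh(2)]
  note hinf = disc_algebra_Linf[OF gh(2)]
  have ghH: "(\<lambda>z. g z * h z) \<in> H2" by (intro disc_algebra_H2 disc_algebra_mult gh)
  have DhL: "D h \<in> L2" by (intro H2_subset_L2 bounded_operator_H2_in[OF D] hH)
  have gn: "(L2_norm g)\<^sup>2 = (LINT z|\<mu>. norm (poly p z))" and hn: "(L2_norm h)\<^sup>2 = (LINT z|\<mu>. norm (poly p z))"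
    unfolding L2_norm_square by (intro integral_circle_cong; use gh(3) in simp)+
  have th: "(\<lambda>z. taylor g N z * h z) \<in> H2" for N
  proof -
    have "(\<lambda>z. \<Sum>k\<le>N. fourier_coeff g (int k) * (z ^ k * h z)) \<in> H2"
      by (intro H2_sum H2_cmult H2_mult_power hH)
    then show ?thesis by (simp add: taylor_def sum_distrib_right mult.assoc)
  qed
  have bN: "norm (fourier_coeff (D (\<lambda>z. taylor g N z * h z)) 0) \<le> L2_norm g * L2_norm (D h)" for N
  proof -
    let ?I = "int ` {..N}"
    let ?c = "\<lambda>n. cnj (fourier_coeff g n)"
    have "(\<lambda>z. taylor g N z * h z) = (\<lambda>z. \<Sum>k\<le>N. fourier_coeff g (int k) * (z ^ k * h z))"
      by (simp add: taylor_def fun_eq_iff sum_distrib_right mult.assoc)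
    then have "fourier_coeff (D (\<lambda>z. taylor g N z * h z)) 0 = (\<Sum>k\<le>N. fourier_coeff g (int k) * fourier_coeff (D h) (int k))"
      using fourier_op_sum[OF D, of "{..N}" "\<lambda>k z. z ^ k * h z" "\<lambda>k. fourier_coeff g (int k)" "int 0"] hank[OF hH, of _ 0]
      by (simp add: H2_mult_power hH)
    also have "\<dots> = L2_inner (D h) (trig_poly ?I ?c)"
      by (simp add: L2_inner_trig_right DhL sum.reindex)
    finally have b1: "norm (fourier_coeff (D (\<lambda>z. taylor g N z * h z)) 0) \<le> L2_norm (D h) * L2_norm (trig_poly ?I ?c)"
      using L2_Cauchy_Schwarz[OF DhL trig_L2] by simp
    have b2: "L2_norm (trig_poly ?I ?c) \<le> L2_norm g"
    proof (rule power2_le_imp_le)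
      show "(L2_norm (trig_poly ?I ?c))\<^sup>2 \<le> (L2_norm g)\<^sup>2"
        using bessel[OF _ H2_subset_L2[OF gH], of ?I] by (simp add: L2_norm_trig_square)
    qed simp
    show ?thesis
      unfolding mult.commute[of "L2_norm g"] by (rule order_trans[OF b1 mult_left_mono[OF b2 L2_norm_nonneg]])
  qed
  have "(\<lambda>N. fourier_coeff (D (\<lambda>z. taylor g N z * h z)) 0) \<longlonglongrightarrow> fourier_coeff (D (\<lambda>z. g z * h z)) 0"
  proof (rule fourier_op_tendsto[OF D th ghH])
    obtain B where B: "h \<in> borel_measurable \<mu>" "AE z in \<mu>. norm (h z) \<le> B" using hinf by (auto simp: Linf_def)
    have "L2_norm (\<lambda>z. taylor g N z * h z - g z * h z) \<le> B * L2_norm (\<lambda>z. taylor g N z - g z)" for N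
      using L2_norm_mult_le[OF L2_diff[OF H2_subset_L2[OF taylor_H2[of g N]] H2_subset_L2[OF gH]] B]
      by (simp add: algebra_simps)
    then show "(\<lambda>N. L2_norm (\<lambda>z. taylor g N z * h z - g z * h z)) \<longlonglongrightarrow> 0"
      by (intro Lim_null_comparison[OF _ tendsto_mult_right_zero[OF taylor_tendsto[OF gH], of B]]) simp
  qed
  then have "norm (fourier_coeff (D (\<lambda>z. g z * h z)) 0) \<le> L2_norm g * L2_norm (D h)"
    by (intro tendsto_upperbound[OF tendsto_norm]) (use bN in auto)
  also have "\<dots> \<le> L2_norm g * (C * L2_norm h)" by (intro mult_left_mono C hH) simp
  also have "\<dots> = C * (L2_norm g * L2_norm h)" by simp
  also have "L2_norm g = L2_norm h" using gn hn by (metis L2_norm_nonneg power2_eq_imp_eq)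
  also have "L2_norm h * L2_norm h = (LINT z|\<mu>. norm (poly p z))" using hn by (simp add: power2_eq_square)
  also have "fourier_coeff (D (\<lambda>z. g z * h z)) 0 = fourier_coeff (D (poly p)) 0"
    by (rule fourier_op_cong[OF D ghH poly_H2]) (use AE_circle_norm gh(3) in \<open>auto elim!: eventually_mono\<close>)
  finally show ?thesis .
qed

lemma sublinear_L1: "0 \<le> C \<Longrightarrow> sublinear (\<lambda>f. C * (LINT z|\<mu>. norm (f z)))"
  unfolding sublinear_def
proof (intro conjI ballI allI impI)
  fix f g assume C: "0 \<le> C" and fg: "f \<in> L2" "g \<in> L2"
  have "(LINT z|\<mu>. norm (f z + g z)) \<le> (LINT z|\<mu>. norm (f z) + norm (g z))"
    using fg by (intro integral_mono integrable_norm L2_integrable L2_add Bochner_Integration.integrable_add norm_triangle_ineq)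
  also have "\<dots> = (LINT z|\<mu>. norm (f z)) + (LINT z|\<mu>. norm (g z))"
    using fg by (intro Bochner_Integration.integral_add integrable_norm L2_integrable)
  finally show "C * (LINT z|\<mu>. norm (f z + g z)) \<le> C * (LINT z|\<mu>. norm (f z)) + C * (LINT z|\<mu>. norm (g z))"
    using C by (simp add: mult_left_mono flip: distrib_left)
qed (simp add: norm_mult)

text \<open>
The Hahn-Banach step of Nehari's theorem. The real part of the functional \<open>p \<mapsto> \<Sum> p\<^sub>i d\<^sub>i\<close> is extended first: the
\<open>L\<^sup>1\<close> norm is lowered along the cone of all analytic polynomials and then made linear in the directions \<open>z\<^sup>n\<close> and
\<open>\<i> z\<^sup>n\<close> with \<open>n < 0\<close>. The complex functional is recovered from its real part, and its bound follows by rotating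
the value to the positive axis.
\<close>

lemma extend_to_trig_polynomials:
  assumes C: "0 \<le> C" and d: "\<And>p :: complex poly. norm (\<Sum>i\<le>degree p. coeff p i * d i) \<le> C * (LINT z|\<mu>. norm (poly p z))"
  shows "\<exists>c. (\<forall>n. c (int n) = d n) \<and>
     (\<forall>I a. finite I \<longrightarrow> norm (\<Sum>n\<in>I. a n * c n) \<le> C * (LINT z|\<mu>. norm (trig_poly I a z)))"
proof -
  define p0 where "p0 f = C * (LINT z|\<mu>. norm (f z))" for f :: "complex \<Rightarrow> complex"
  have p0: "sublinear p0" unfolding p0_def[abs_def] by (rule sublinear_L1[OF C])
  define L where "L p = (\<Sum>i\<le>degree p. coeff p i * d i)" for p :: "complex poly"
  have L_ext: "L p = (\<Sum>i\<le>n. coeff p i * d i)" if "degree p \<le> n" for p n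
    unfolding L_def using that by (intro sum.mono_neutral_left) (auto simp: coeff_eq_0)
  have L_add: "L (p + q) = L p + L q" for p q
  proof -
    let ?n = "max (degree p) (degree q)"
    show ?thesis using L_ext[of "p + q" ?n] L_ext[of p ?n] L_ext[of q ?n] degree_add_le_max[of p q]
      by (simp add: distrib_right sum.distrib)
  qed
  have L_smult: "L (smult a p) = a * L p" for a p
    using L_ext[of "smult a p" "degree p"] by (simp add: L_def sum_distrib_left mult.assoc degree_smult_le)
  have L_monom: "L (monom a n) = a * d n" for a n
  proof -
    have "L (monom a n) = (\<Sum>i\<le>n. coeff (monom a n) i * d i)" by (rule L_ext[OF degree_monom_le])
    also have "\<dots> = (\<Sum>i\<le>n. if i = n then a * d i else 0)" by (intro sum.cong) (auto simp: coeff_monom)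
    also have "\<dots> = a * d n" by (simp add: sum.delta)
    finally show ?thesis .
  qed
  define K where "K = range (poly :: complex poly \<Rightarrow> complex \<Rightarrow> complex)"
  define l where "l f = Re (L (inv poly f))" for f :: "complex \<Rightarrow> complex"
  have inj: "inj (poly :: complex poly \<Rightarrow> complex \<Rightarrow> complex)" by (simp add: inj_def poly_eq_poly_eq_iff)
  have lp: "l (poly p) = Re (L p)" for p by (simp add: l_def inv_f_f[OF inj])
  have padd: "(\<lambda>z. poly p z + poly q z) = poly (p + q)" for p q :: "complex poly" by auto
  have pscale: "(\<lambda>z. a * poly p z) = poly (smult a p)" for p :: "complex poly" and a by auto
  define p1 where "p1 f = (INF m\<in>K. p0 (\<lambda>z. f z + m z) - l m)" for f
  have K_L2: "K \<subseteq> L2" using H2_subset_L2 by (auto simp: K_def)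
  have "(\<lambda>z. 0) = poly (0::complex poly)" by auto
  then have K0: "(\<lambda>z. 0) \<in> K" by (simp add: K_def)
  have Kadd: "(\<lambda>z. m z + m' z) \<in> K" "l (\<lambda>z. m z + m' z) = l m + l m'" if "m \<in> K" "m' \<in> K" for m m'
    using that by (auto simp: K_def padd lp L_add)
  have Kscale: "(\<lambda>z. of_real t * m z) \<in> K" "l (\<lambda>z. of_real t * m z) = t * l m" if "m \<in> K" "t > 0" for m and t :: real
    using that by (auto simp: K_def pscale lp L_smult)
  have l_le: "l m \<le> p0 m" if mK: "m \<in> K" for m
  proof -
    obtain p where m: "m = poly p" using mK by (auto simp: K_def)
    show ?thesis using d[of p] complex_Re_le_cmod[of "L p"] by (simp add: m lp p0_def L_def)
  qed
  note inf = sublinear_infimum[OF p0 K_L2 K0 Kadd(1) Kscale(1) Kadd(2) Kscale(2) l_le]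
  have p1: "sublinear p1" "\<And>f. f \<in> L2 \<Longrightarrow> p1 f \<le> p0 f" "\<And>m. m \<in> K \<Longrightarrow> p1 (\<lambda>z. - m z) \<le> - l m"
    unfolding p1_def[abs_def] using inf by blast+
  define v where "v n z = (if even n then 1 else \<i>) * z powi (- int (Suc (n div 2)))" for n and z :: complex
  have vL: "v n \<in> L2" for n unfolding v_def by (intro L2_cmult L2_powi)
  obtain P where P: "sublinear P" "\<And>f. f \<in> L2 \<Longrightarrow> P f \<le> p1 f" "\<And>n. P (\<lambda>z. - v n z) = - P (v n)"
    using hahn_banach_countable[of p1 v, OF p1(1) vL] by blast
  have Pp: "P (poly p) = Re (L p)" and Ap: "additive_at P (poly p)" for p
  proof -
    have pL: "poly p \<in> L2" using H2_subset_L2 by simp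
    have n: "(\<lambda>z. - poly p z) = poly (- p)" by auto
    have Ln: "L (- p) = - L p" using L_smult[of "-1" p] by simp
    have "P (poly p) \<le> Re (L p)"
      using P(2)[OF pL] p1(3)[of "poly (- p)"] by (simp add: K_def lp Ln)
    moreover have "P (\<lambda>z. - poly p z) \<le> - Re (L p)"
      using P(2)[OF L2_uminus[OF pL]] p1(3)[of "poly p"] by (simp add: K_def lp)
    ultimately show "P (poly p) = Re (L p)" "additive_at P (poly p)"
      using sublinear_neg[OF P(1) pL] pL by (auto simp: additive_at_def)
  qed
  \<comment> \<open>A functional with real part \<open>P\<close> takes the value \<open>P f - \<i> P (\<i> f)\<close>.\<close>
  define c where "c n = (if n \<ge> 0 then d (nat n) else Complex (P (\<lambda>z. z powi n)) (- P (\<lambda>z. \<i> * z powi n)))" for n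
  have mono: "additive_at P (\<lambda>z. a * z powi n) \<and> P (\<lambda>z. a * z powi n) = Re (a * c n)" for a n
  proof (cases "n \<ge> 0")
    case True
    have "(\<lambda>z. a * z powi n) = poly (monom a (nat n))" using True by (auto simp: poly_monom power_int_def)
    then show ?thesis using True Ap[of "monom a (nat n)"] Pp[of "monom a (nat n)"] by (simp add: L_monom c_def)
  next
    case False
    define k where "k = nat (- n - 1)"
    have nk: "n = - int (Suc k)" using False by (simp add: k_def)
    have v1: "v (2 * k) = (\<lambda>z. z powi n)" and v2: "v (2 * k + 1) = (\<lambda>z. \<i> * z powi n)"
      by (auto simp: v_def nk simp del: of_nat_Suc)
    have a1: "additive_at P (\<lambda>z. z powi n)" using P(3)[of "2 * k"] by (simp add: v1 additive_at_def)
    have a2: "additive_at P (\<lambda>z. \<i> * z powi n)" using P(3)[of "2 * k + 1"] vL[of "2 * k + 1"] by (simp only: v2 additive_at_def) 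
    have eq: "(\<lambda>z. a * z powi n) = (\<lambda>z. of_real (Re a) * z powi n + of_real (Im a) * (\<i> * z powi n))"
      by (rule ext, subst (1) complex_eq[of a]) (simp add: algebra_simps)
    note s1 = additive_at_scale[OF P(1) a1, of "Re a"] and s2 = additive_at_scale[OF P(1) a2, of "Im a"]
    have "P (\<lambda>z. a * z powi n) = Re a * P (\<lambda>z. z powi n) + Im a * P (\<lambda>z. \<i> * z powi n)"
      unfolding eq using additive_at_add[OF P(1) s2(2)] s1(2) by (simp add: s1(1) s2(1) additive_at_def)
    moreover have "additive_at P (\<lambda>z. a * z powi n)" unfolding eq by (rule additive_at_sum[OF P(1) s1(2) s2(2)])
    ultimately show ?thesis using False by (simp add: c_def)
  qed
  have trigP: "additive_at P (trig_poly I a) \<and> P (trig_poly I a) = Re (\<Sum>n\<in>I. a n * c n)" if "finite I" for I a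
    using that
  proof (induction I rule: finite_induct)
    case empty
    have "trig_poly {} a = (\<lambda>z. 0)" by (simp add: trig_poly_def fun_eq_iff)
    then show ?case using sublinear_zero[OF P(1)] by (simp add: additive_at_def)
  next
    case (insert x I)
    have eq: "trig_poly (insert x I) a = (\<lambda>z. a x * z powi x + trig_poly I a z)" using insert by (simp add: trig_poly_def fun_eq_iff)
    have IH: "additive_at P (trig_poly I a)" "P (trig_poly I a) = Re (\<Sum>n\<in>I. a n * c n)" using insert by auto
    have "P (trig_poly (insert x I) a) = P (\<lambda>z. a x * z powi x) + P (trig_poly I a)"
      unfolding eq by (rule additive_at_add[OF P(1) IH(1) L2_cmult[OF L2_powi]])
    moreover have "additive_at P (trig_poly (insert x I) a)"
      unfolding eq using additive_at_sum[OF P(1) conjunct1[OF mono] IH(1)] .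
    ultimately show ?case using insert IH(2) mono[of "a x" x] by simp
  qed
  have "norm (\<Sum>n\<in>I. a n * c n) \<le> C * (LINT z|\<mu>. norm (trig_poly I a z))" if I: "finite I" for I a
  proof -
    define S where "S = (\<Sum>n\<in>I. a n * c n)"
    define \<omega> where "\<omega> = (if S = 0 then 1 else cnj S / norm S)"
    have \<omega>: "norm \<omega> = 1" "\<omega> * S = of_real (norm S)"
      by (auto simp: \<omega>_def norm_divide complex_norm_square[symmetric] mult.commute[of "cnj S"] power2_eq_square)
    have "norm S = Re (\<Sum>n\<in>I. (\<omega> * a n) * c n)"
      using \<omega>(2) by (simp add: S_def sum_distrib_left[symmetric] mult.assoc)
    also have "\<dots> = P (trig_poly I (\<lambda>n. \<omega> * a n))" using trigP[OF I] by simp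
    also have "\<dots> \<le> p0 (trig_poly I (\<lambda>n. \<omega> * a n))"
      using P(2)[OF trig_L2] p1(2)[OF trig_L2] order_trans by blast
    also have "trig_poly I (\<lambda>n. \<omega> * a n) = (\<lambda>z. \<omega> * trig_poly I a z)" by (simp add: trig_poly_def fun_eq_iff sum_distrib_left mult.assoc)
    also have "p0 \<dots> = C * (LINT z|\<mu>. norm (trig_poly I a z))" by (simp add: p0_def norm_mult \<omega>(1))
    finally show ?thesis by (simp add: S_def)
  qed
  then show ?thesis by (intro exI[of _ c]) (auto simp: c_def)
qed

text \<open>
Testing the functional on the trigonometric polynomial with coefficients \<open>cnj (c n)\<close> shows that \<open>c\<close> is square
summable, so it belongs to a square integrable symbol. Testing it on the partial sums of the Poisson kernel,
whose \<open>L\<^sup>1\<close> norms tend to one, bounds the Poisson integral of that symbol.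
\<close>

lemma bounded_symbol_exists:
  assumes C: "0 \<le> C" and c: "\<And>I a. finite I \<Longrightarrow> norm (\<Sum>n\<in>I. a n * c n) \<le> C * (LINT z|\<mu>. norm (trig_poly I a z))"
  shows "\<exists>\<psi>\<in>Linf. \<forall>n. fourier_coeff \<psi> n = c n"
proof -
  have "(\<Sum>n\<in>I. (norm (c n))\<^sup>2) \<le> C\<^sup>2" if I: "finite I" for I
  proof -
    define s where "s = (\<Sum>n\<in>I. (norm (c n))\<^sup>2)"
    have s0: "0 \<le> s" by (simp add: s_def sum_nonneg)
    have "complex_of_real s = (\<Sum>n\<in>I. cnj (c n) * c n)"
      unfolding s_def of_real_sum by (intro sum.cong refl) (simp add: complex_norm_square mult.commute del: of_real_power)
    then have "s = norm (\<Sum>n\<in>I. cnj (c n) * c n)" using s0 by (metis abs_of_nonneg norm_of_real)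
    also have "\<dots> \<le> C * (LINT z|\<mu>. norm (trig_poly I (\<lambda>n. cnj (c n)) z))" by (rule c[OF I])
    also have "\<dots> \<le> C * L2_norm (trig_poly I (\<lambda>n. cnj (c n)))"
      by (intro mult_left_mono integral_norm_le_L2_norm trig_L2 C)
    also have "L2_norm (trig_poly I (\<lambda>n. cnj (c n))) = sqrt s"
      using L2_norm_trig_square[OF I, of "\<lambda>n. cnj (c n)"] by (simp add: s_def real_sqrt_unique)
    finally have "sqrt s * sqrt s \<le> C * sqrt s" using s0 by simp
    then have "sqrt s \<le> C" using C s0 by (metis mult_right_le_imp_le order_le_less real_sqrt_ge_zero)
    then show ?thesis using power_mono[of "sqrt s" C 2] s0 by (simp add: s_def)
  qed
  then obtain \<psi> where \<psi>: "\<psi> \<in> L2" "\<And>n. fourier_coeff \<psi> n = c n" using riesz_fischer[of c "C\<^sup>2"] by blast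
  have "norm (poisson \<psi> w) \<le> C" if w: "norm w < 1" for w
  proof -
    \<comment> \<open>The Fourier coefficients of the Poisson kernel at \<open>cnj w\<close>; paired with \<open>c\<close> without conjugation, they give the Poisson integral at \<open>w\<close>.\<close>
    define a where "a n = (if n \<ge> 0 then w ^ nat n else cnj w ^ nat (- n))" for n
    define I where "I N = {- int N..<int N}" for N
    have split: "(\<Sum>n\<in>I N. F n) = (\<Sum>k<N. F (int k) + F (- int (Suc k)))" for F :: "int \<Rightarrow> complex" and N
    proof (induction N)
      case (Suc N)
      have "I (Suc N) = insert (- int (Suc N)) (insert (int N) (I N))" by (auto simp: I_def)
      then show ?case using Suc by (simp add: I_def add_ac)
    qed (simp add: I_def)
    have "(\<lambda>N. \<Sum>n\<in>I N. a n * c n) \<longlonglongrightarrow> poisson \<psi> w"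
      using poisson_sums[OF L2_integrable[OF \<psi>(1)] w]
      by (simp add: split sums_def a_def \<psi>(2) nat_add_distrib del: of_nat_Suc)
    moreover have "(\<lambda>N. C * (LINT z|\<mu>. norm (trig_poly (I N) a z))) \<longlonglongrightarrow> C * (LINT z|\<mu>. norm (poisson_kernel w z))"
    proof (intro tendsto_mult tendsto_const)
      have tr: "trig_poly (I N) a z = cnj (\<Sum>k<N. cnj w ^ k * cnj z ^ k + w ^ Suc k * z ^ Suc k)" if "norm z = 1" for N z
        unfolding trig_poly_def split cnj_sum
        by (intro sum.cong refl) (use that in \<open>simp add: a_def powi_uminus_circle nat_add_distrib del: of_nat_Suc\<close>)
      have sums: "(\<lambda>k. cnj w ^ k * cnj z ^ k + w ^ Suc k * z ^ Suc k) sums of_real (poisson_kernel (cnj w) z)" if "norm z = 1" for z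
        using poisson_kernel_sums[OF that, of "cnj w"] w by simp
      have "(\<lambda>N. LINT z|\<mu>. norm (trig_poly (I N) a z)) \<longlonglongrightarrow> (LINT z|\<mu>. norm (poisson_kernel (cnj w) z))"
      proof (rule integral_dominated_convergence[where w="\<lambda>z. 2 / (1 - norm w)"])
        show "AE z in \<mu>. (\<lambda>N. norm (trig_poly (I N) a z)) \<longlonglongrightarrow> norm (poisson_kernel (cnj w) z)"
          using AE_circle_norm
        proof eventually_elim
          case (elim z)
          have "(\<lambda>N. norm (\<Sum>k<N. cnj w ^ k * cnj z ^ k + w ^ Suc k * z ^ Suc k)) \<longlonglongrightarrow> norm (complex_of_real (poisson_kernel (cnj w) z))"
            using sums[OF elim] unfolding sums_def by (rule tendsto_norm)
          then show ?case by (simp only: tr[OF elim] complex_mod_cnj norm_of_real real_norm_def)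
        qed
        fix N
        show "AE z in \<mu>. norm (norm (trig_poly (I N) a z)) \<le> 2 / (1 - norm w)"
          using AE_circle_norm
        proof eventually_elim
          case (elim z)
          have "norm (\<Sum>k<N. cnj w ^ k * cnj z ^ k + w ^ Suc k * z ^ Suc k) \<le> (\<Sum>k<N. 2 * norm w ^ k)"
          proof (rule sum_norm_le)
            fix k
            have "norm (cnj w ^ k * cnj z ^ k + w ^ Suc k * z ^ Suc k) \<le> norm w ^ k + norm w ^ Suc k"
              using elim by (intro order_trans[OF norm_triangle_ineq]) (simp add: norm_mult norm_power)
            also have "\<dots> \<le> 2 * norm w ^ k" using power_decreasing[of k "Suc k" "norm w"] w by simp
            finally show "norm (cnj w ^ k * cnj z ^ k + w ^ Suc k * z ^ Suc k) \<le> 2 * norm w ^ k" .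
          qed
          also have "\<dots> \<le> 2 * (1 / (1 - norm w))"
            unfolding sum_distrib_left[symmetric] using w sum_le_suminf[of "\<lambda>k. norm w ^ k" "{..<N}"]
            by (intro mult_left_mono) (auto simp: suminf_geometric summable_geometric)
          finally show ?case by (simp only: tr[OF elim] complex_mod_cnj real_norm_def abs_norm_cancel times_divide_eq_right mult_1_right)
        qed
        show "(\<lambda>z. norm (trig_poly (I N) a z)) \<in> borel_measurable \<mu>" using L2_measurable[OF trig_L2[of "I N" a]] by simp
        show "(\<lambda>z. norm (poisson_kernel (cnj w) z)) \<in> borel_measurable \<mu>"
          using measurable_poisson_kernel[of "cnj w"] w by simp
      qed simp
      also have "(LINT z|\<mu>. norm (poisson_kernel (cnj w) z)) = 1"
        using poisson_one[of "cnj w"] w by (simp add: poisson_kernel_nonneg)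
      also have "1 = (LINT z|\<mu>. norm (poisson_kernel w z))"
        using poisson_one[of w] w by (simp add: poisson_kernel_nonneg)
      finally show "(\<lambda>N. LINT z|\<mu>. norm (trig_poly (I N) a z)) \<longlonglongrightarrow> (LINT z|\<mu>. norm (poisson_kernel w z))" .
    qed
    ultimately have "norm (poisson \<psi> w) \<le> C * (LINT z|\<mu>. norm (poisson_kernel w z))"
      by (intro LIMSEQ_le[OF tendsto_norm]) (use c in \<open>auto simp: I_def\<close>)
    then show ?thesis using poisson_one[of w] w by (simp add: poisson_kernel_nonneg)
  qed
  then have "AE z in \<mu>. norm (\<psi> z) \<le> C" by (rule poisson_bounded_imp_bounded[OF L2_integrable[OF \<psi>(1)]])
  then have "\<psi> \<in> Linf" using L2_measurable[OF \<psi>(1)] by (auto simp: Linf_def)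
  then show ?thesis using \<psi>(2) by blast
qed

lemma hankel_iterate:
  assumes hank: "\<And>f n. f \<in> H2 \<Longrightarrow> fourier_coeff (D (\<lambda>z. z * f z)) (int n) = fourier_coeff (D f) (int n + 1)"
    and f: "f \<in> H2"
  shows "fourier_coeff (D (\<lambda>z. z ^ k * f z)) (int n) = fourier_coeff (D f) (int (n + k))"
proof (induction k arbitrary: n)
  case (Suc k)
  have "fourier_coeff (D (\<lambda>z. z * (z ^ k * f z))) (int n) = fourier_coeff (D (\<lambda>z. z ^ k * f z)) (int (Suc n))"
    using hank[OF H2_mult_power[OF f], of k n] by (simp add: add.commute)
  then show ?case using Suc[of "Suc n"] by (simp add: mult.assoc)
qed simp

text \<open>
Nehari's theorem: a bounded operator whose matrix entries depend on the sum of the indices has a bounded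
symbol. The entries \<open>d n\<close> determine the coefficients of the symbol for \<open>n \<ge> 0\<close> only. Choosing the other ones
amounts to extending a functional bounded in the \<open>L\<^sup>1\<close> norm.
\<close>

theorem nehari:
  assumes D: "bounded_operator_H2 D"
    and hank: "\<And>f n. f \<in> H2 \<Longrightarrow> fourier_coeff (D (\<lambda>z. z * f z)) (int n) = fourier_coeff (D f) (int n + 1)"
  shows "\<exists>\<psi>\<in>Linf. op_eq D (hankel \<psi>)"
proof -
  obtain C where C: "0 \<le> C" "\<And>f. f \<in> H2 \<Longrightarrow> L2_norm (D f) \<le> C * L2_norm f" using bounded_operator_bound[OF D] by blast
  note it = hankel_iterate[of D, OF hank]
  define d where "d i = fourier_coeff (D (\<lambda>z. 1)) (int i)" for i
  have dk: "fourier_coeff (D (\<lambda>z. z ^ k)) (int n) = d (n + k)" for k n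
    using it[of "\<lambda>z. 1" k n] by (simp add: d_def)
  have Dpoly: "fourier_coeff (D (poly p)) 0 = (\<Sum>i\<le>degree p. coeff p i * d i)" for p
  proof -
    have "poly p = (\<lambda>z. \<Sum>i\<le>degree p. coeff p i * z ^ i)" by (simp add: poly_altdef fun_eq_iff)
    then show ?thesis using fourier_op_sum[OF D, of "{..degree p}" "\<lambda>i z. z ^ i" "coeff p" "int 0"] dk[of _ 0]
      by simp
  qed
  have "norm (\<Sum>i\<le>degree p. coeff p i * d i) \<le> C * (LINT z|\<mu>. norm (poly p z))" for p
    unfolding Dpoly[symmetric] by (rule hankel_functional_bound[OF D C it])
  from extend_to_trig_polynomials[of C d, OF C(1) this] obtain c where c: "\<And>n. c (int n) = d n"
    "\<And>I a. finite I \<Longrightarrow> norm (\<Sum>n\<in>I. a n * c n) \<le> C * (LINT z|\<mu>. norm (trig_poly I a z))" by blast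
  from bounded_symbol_exists[of C c, OF C(1) c(2)] obtain \<psi> where \<psi>: "\<psi> \<in> Linf" "\<And>n. fourier_coeff \<psi> n = c n" by blast
  have "op_eq D (hankel \<psi>)"
  proof (rule op_eqI_power[OF D bounded_hankel[OF \<psi>(1)]])
    fix k n
    have "fourier_coeff (hankel \<psi> (\<lambda>z. z ^ k)) (int n) = fourier_coeff (hankel \<psi> (\<lambda>z. 1)) (int (n + k))"
      using hankel_iterate[of "hankel \<psi>" "\<lambda>z. 1" k n, OF fourier_coeff_hankel_shift[OF \<psi>(1)]] by simp
    also have "\<dots> = fourier_coeff (\<lambda>z. \<psi> z * flip (\<lambda>z. 1) z) (int (n + k))"
      by (rule fourier_coeff_hankel[OF \<psi>(1)]) simp
    also have "\<dots> = d (n + k)" by (simp only: flip_def mult_1_right \<psi>(2) c(1))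
    finally show "fourier_coeff (D (\<lambda>z. z ^ k)) (int n) = fourier_coeff (hankel \<psi> (\<lambda>z. z ^ k)) (int n)"
      by (simp add: dk)
  qed
  then show ?thesis using \<psi>(1) by blast
qed

section \<open>Sums of Toeplitz and Hankel operators\<close>

lemma ker_H2_op_eq:
  assumes "op_eq A B"
  shows "ker_H2 A = ker_H2 B"
proof -
  have "(AE z in \<mu>. A f z = 0) \<longleftrightarrow> (AE z in \<mu>. B f z = 0)" if "f \<in> H2" for f
  proof -
    have "AE z in \<mu>. A f z = B f z" using assms that by (simp add: op_eq_def)
    then have "AE z in \<mu>. (A f z = 0) = (B f z = 0)" by eventually_elim simp
    then show ?thesis by (rule eventually_subst)
  qed
  then show ?thesis unfolding ker_H2_def by blast
qed

lemma fourier_coeff_op_eq: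
  assumes "op_eq A B" "f \<in> H2" "A f \<in> H2" "B f \<in> H2"
  shows "fourier_coeff (A f) n = fourier_coeff (B f) n"
  by (rule fourier_coeff_cong_AE) (use assms L2_measurable H2_subset_L2 in \<open>auto simp: op_eq_def\<close>)

abbreviation shift_defect :: "operator \<Rightarrow> operator" where
  "shift_defect A \<equiv> \<lambda>f z. adjoint_H2 shift (A (shift f)) z - A f z"

lemma bounded_shift_defect: "bounded_operator_H2 A \<Longrightarrow> bounded_operator_H2 (shift_defect A)"
  by (rule bounded_operator_diff[OF bounded_operator_comp[OF bounded_adjoint_shift
        bounded_operator_comp[OF _ bounded_toeplitz[OF Linf_id]]]])

lemma fourier_op_shift:
  assumes A: "bounded_operator_H2 A" and f: "f \<in> H2"
  shows "fourier_coeff (A (shift f)) n = fourier_coeff (A (\<lambda>z. z * f z)) n"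
  by (rule fourier_op_cong[OF A shift_H2[OF f] H2_mult_id[OF f] shift_AE[OF f]])

lemma fourier_coeff_shift_defect:
  assumes A: "bounded_operator_H2 A" and f: "f \<in> H2"
  shows "fourier_coeff (shift_defect A f) (int n) =
    fourier_coeff (A (\<lambda>z. z * f z)) (int n + 1) - fourier_coeff (A f) (int n)"
proof -
  note inA = bounded_operator_H2_in[OF A]
  have "fourier_coeff (shift_defect A f) (int n) = fourier_coeff (adjoint_H2 shift (A (shift f))) (int n) - fourier_coeff (A f) (int n)"
    by (intro fourier_coeff_diff H2_subset_L2 adjoint_shift_H2 inA shift_H2 f)
  then show ?thesis
    by (simp add: fourier_coeff_adjoint_shift inA shift_H2 f fourier_op_shift[OF A f])
qed

lemma fourier_coeff_toeplitz_shift: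
  assumes \<phi>: "\<phi> \<in> Linf" and f: "f \<in> H2"
  shows "fourier_coeff (toeplitz \<phi> (\<lambda>z. z * f z)) (int n + 1) = fourier_coeff (toeplitz \<phi> f) (int n)"
proof -
  have "fourier_coeff (toeplitz \<phi> (\<lambda>z. z * f z)) (int (Suc n)) = fourier_coeff (\<lambda>z. z * (\<phi> z * f z)) (int (Suc n))"
    unfolding fourier_coeff_toeplitz[OF \<phi> H2_mult_id[OF f]] by (simp add: mult.left_commute)
  then show ?thesis by (simp add: fourier_coeff_mult_id fourier_coeff_toeplitz \<phi> f add.commute)
qed

text \<open>
The matrix of a Toeplitz operator is constant along diagonals, so the Toeplitz part cancels. The Hankel part
contributes the differences of the coefficients of \<open>\<psi>\<close> with distance two, which is the Hankel operator with the
symbol \<open>(z\<^sup>-\<^sup>2 - 1) \<psi>\<close>. Its values at \<open>f\<close> have differences of coefficients of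
\<open>hankel \<psi> f\<close> as coefficients, so the kernel can only grow.
\<close>

lemma noninjective_shift_defect:
  assumes A: "bounded_operator_H2 A" and \<phi>: "\<phi> \<in> Linf" and \<psi>: "\<psi> \<in> Linf"
    and AT: "op_eq A (\<lambda>f z. toeplitz \<phi> f z + hankel \<psi> f z)" and ker: "ker_H2 (hankel \<psi>) \<noteq> zero_H2"
  shows "noninjective_hankel (shift_defect A)"
proof -
  note H = bounded_hankel[OF \<psi>]
  have sum: "fourier_coeff (A f) n = fourier_coeff (toeplitz \<phi> f) n + fourier_coeff (hankel \<psi> f) n" if f: "f \<in> H2" for f n
  proof -
    have "fourier_coeff (A f) n = fourier_coeff (\<lambda>z. toeplitz \<phi> f z + hankel \<psi> f z) n"
      using fourier_coeff_op_eq[of A "\<lambda>f z. toeplitz \<phi> f z + hankel \<psi> f z" f n] AT f bounded_operator_H2_in[OF A f]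
        H2_add[OF toeplitz_H2[OF \<phi> f] hankel_H2[OF \<psi> f]] by blast
    then show ?thesis
      by (simp only: fourier_coeff_add[OF H2_subset_L2[OF toeplitz_H2[OF \<phi> f]] H2_subset_L2[OF hankel_H2[OF \<psi> f]]])
  qed
  have B: "fourier_coeff (shift_defect A f) (int n) = fourier_coeff (hankel \<psi> f) (int (n + 2)) - fourier_coeff (hankel \<psi> f) (int n)"
    if f: "f \<in> H2" for f n
    using fourier_coeff_hankel_shift[OF \<psi> f, of "Suc n"] fourier_coeff_toeplitz_shift[OF \<phi> f, of n]
    by (simp add: fourier_coeff_shift_defect[OF A f] sum f H2_mult_id add.commute add.left_commute)
  define \<psi>' where "\<psi>' z = (z powi (-2) - 1) * \<psi> z" for z
  have \<psi>': "\<psi>' \<in> Linf"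
    unfolding \<psi>'_def by (intro Linf_mult Linf_diff Linf_powi Linf_const \<psi>)
  have "op_eq (shift_defect A) (hankel \<psi>')"
    unfolding op_eq_def
  proof (intro ballI H2_eqI bounded_operator_H2_in[OF bounded_shift_defect[OF A]] hankel_H2 \<psi>')
    fix f n assume f: "f \<in> H2"
    have L: "(\<lambda>z. \<psi> z * flip f z) \<in> L2" by (intro L2_mult flip_L2 H2_subset_L2 f \<psi>)
    have "fourier_coeff (hankel \<psi>' f) (int n) = fourier_coeff (\<lambda>z. z powi (-2) * (\<psi> z * flip f z) - \<psi> z * flip f z) (int n)"
      unfolding fourier_coeff_hankel[OF \<psi>' f] by (simp add: \<psi>'_def algebra_simps)
    also have "\<dots> = fourier_coeff (\<lambda>z. \<psi> z * flip f z) (int (n + 2)) - fourier_coeff (\<lambda>z. \<psi> z * flip f z) (int n)"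
      unfolding fourier_coeff_diff[OF L2_mult[OF L Linf_powi[of "-2"]] L] fourier_coeff_mult_powi by (simp add: add.commute)
    also have "\<dots> = fourier_coeff (shift_defect A f) (int n)"
      by (simp only: B[OF f] fourier_coeff_hankel[OF \<psi> f])
    finally show "fourier_coeff (shift_defect A f) (int n) = fourier_coeff (hankel \<psi>' f) (int n)" ..
  qed
  then have "is_hankel (shift_defect A)" using \<psi>' by (auto simp: is_hankel_def)
  moreover have "ker_H2 (shift_defect A) \<noteq> zero_H2"
  proof -
    obtain f where f: "f \<in> ker_H2 (hankel \<psi>)" "\<not> (AE z in \<mu>. f z = 0)" using ker ker_H2_nonzero[OF H] by blast
    have fH: "f \<in> H2" and f0: "fourier_coeff (hankel \<psi> f) (int n) = 0" for n
      using f(1) by (auto simp: ker_H2_iff[OF H])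
    have "fourier_coeff (shift_defect A f) (int n) = 0" for n
      unfolding B[OF fH] f0 by simp
    then have "f \<in> ker_H2 (shift_defect A)"
      using fH by (simp add: ker_H2_iff[OF bounded_shift_defect[OF A]])
    then show ?thesis using f(2) ker_H2_nonzero[OF bounded_shift_defect[OF A]] by blast
  qed
  ultimately show ?thesis by (simp add: noninjective_hankel_def)
qed

text \<open>
The indices \<open>n - k\<close> exhaust the integers, so all coefficients of \<open>e v\<close> vanish, and \<open>v\<close> can be cancelled.
\<close>

lemma symbol_eq_zero:
  assumes e: "e \<in> Linf" and v: "v \<in> H2" "v \<in> Linf" "AE z in \<mu>. norm (v z) = 1"
    and zero: "\<And>k n. fourier_coeff (\<lambda>z. e z * (v z * z ^ k)) (int n) = 0"
  shows "AE z in \<mu>. e z = 0"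
proof -
  have "AE z in \<mu>. e z * v z = 0"
  proof (rule L2_unique)
    fix n :: int
    have "fourier_coeff (\<lambda>z. z ^ nat (- n) * (e z * v z)) (int (nat n)) = 0"
      using zero[of "nat (- n)" "nat n"] by (simp add: mult_ac)
    then have "fourier_coeff (\<lambda>z. e z * v z) (int (nat n) - int (nat (- n))) = 0"
      by (simp only: fourier_coeff_mult_power)
    moreover have "int (nat n) - int (nat (- n)) = n" by simp
    ultimately show "fourier_coeff (\<lambda>z. e z * v z) n = fourier_coeff (\<lambda>z. 0) n" by simp
  qed (use L2_mult[OF H2_subset_L2[OF v(1)] e] in auto)
  then show ?thesis using v(3) by eventually_elim auto
qed

text \<open>
The reconstruction of both summands from \<open>S\<^sup>* A S - A\<close>. The kernel of this Hankel operator determines an inner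
function with boundary function \<open>v\<close>; on \<open>v H\<^sup>2\<close> the operator \<open>A\<close> satisfies the Toeplitz equation, which gives \<open>\<phi>2\<close>
and the Toeplitz summand. The remainder \<open>D\<close> annihilates \<open>v H\<^sup>2\<close>, and this turns the weak information on
\<open>S\<^sup>* D S - D\<close> into \<open>S\<^sup>* D = D S\<close>.
\<close>

theorem toeplitz_plus_hankel:
  assumes A: "bounded_operator_H2 A" and \<psi>1: "\<psi>1 \<in> Linf"
    and BH: "op_eq (shift_defect A) (hankel \<psi>1)" and ker: "ker_H2 (hankel \<psi>1) \<noteq> zero_H2"
  shows "\<exists>\<theta> \<phi>2 \<psi>. inner_function \<theta> \<and> \<phi>2 \<in> Linf \<and> \<psi> \<in> Linf \<and>
    ker_H2 (hankel \<psi>1) = mult_H2 (radial_limit \<theta>) \<and>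
    op_eq (\<lambda>f. A (toeplitz (radial_limit \<theta>) f)) (toeplitz \<phi>2) \<and>
    (\<lambda>w. cnj (radial_limit \<theta> w) * \<phi>2 w) \<in> Linf \<and>
    op_eq A (\<lambda>f z. toeplitz (\<lambda>w. cnj (radial_limit \<theta> w) * \<phi>2 w) f z + hankel \<psi> f z) \<and>
    ker_H2 (hankel \<psi>) \<noteq> zero_H2"
proof -
  note inA = bounded_operator_H2_in[OF A]
  note H1 = bounded_hankel[OF \<psi>1]
  define M where "M = ker_H2 (hankel \<psi>1)"
  have M: "closed_subspace M" "M \<subseteq> H2"
    unfolding M_def by (rule closed_subspace_ker[OF H1]) (auto simp: ker_H2_def)
  have Mshift: "(\<lambda>z. z * f z) \<in> M" if "f \<in> M" for f
  proof -
    have f: "f \<in> H2" "\<And>n. fourier_coeff (hankel \<psi>1 f) (int n) = 0" using that by (auto simp: M_def ker_H2_iff[OF H1])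
    have "fourier_coeff (hankel \<psi>1 (\<lambda>z. z * f z)) (int n) = 0" for n
      using f(2)[of "Suc n"] by (simp add: fourier_coeff_hankel_shift[OF \<psi>1 f(1)] add.commute)
    then show ?thesis using f(1) by (simp add: M_def ker_H2_iff[OF H1] H2_mult_id)
  qed
  obtain f0 where f0: "f0 \<in> M" "\<not> (AE z in \<mu>. f0 z = 0)" using ker ker_H2_nonzero[OF H1] unfolding M_def by blast
  obtain \<theta> where \<theta>: "inner_function \<theta>" "radial_limit \<theta> \<in> Linf" "radial_limit \<theta> \<in> M" "M = mult_H2 (radial_limit \<theta>)"
    using beurling[OF M Mshift f0] by blast
  define v where "v = radial_limit \<theta>"
  have v: "v \<in> Linf" "v \<in> M" "v \<in> H2" "M = mult_H2 v" using \<theta> M(2) by (auto simp: v_def)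
  have vn: "AE z in \<mu>. norm (v z) = 1" using \<theta>(1) by (simp add: inner_function_def v_def)
  have vM: "(\<lambda>z. v z * f z) \<in> M" if "f \<in> H2" for f
    using that L2_mult[OF H2_subset_L2[OF that] v(1)] unfolding v(4) mult_H2_def by auto
  have vH: "(\<lambda>z. v z * f z) \<in> H2" if "f \<in> H2" for f using vM[OF that] M(2) by blast
  have B0: "fourier_coeff (A (\<lambda>z. z * f z)) (int n + 1) - fourier_coeff (A f) (int n) = fourier_coeff (hankel \<psi>1 f) (int n)"
    if f: "f \<in> H2" for f n
  proof -
    have "fourier_coeff (shift_defect A f) (int n) = fourier_coeff (hankel \<psi>1 f) (int n)"
      using fourier_coeff_op_eq[of "shift_defect A" "hankel \<psi>1" f "int n"] BH f
        bounded_operator_H2_in[OF bounded_shift_defect[OF A] f] hankel_H2[OF \<psi>1 f] by blast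
    then show ?thesis by (simp add: fourier_coeff_shift_defect[OF A f])
  qed
  define T where "T f = A (toeplitz v f)" for f
  have T: "bounded_operator_H2 T" unfolding T_def
    by (rule bounded_operator_comp[OF A bounded_toeplitz[OF v(1)]])
  have Tc: "fourier_coeff (T f) n = fourier_coeff (A (\<lambda>z. v z * f z)) n" if f: "f \<in> H2" for f n
    unfolding T_def
    by (rule fourier_op_cong[OF A toeplitz_H2[OF v(1) f] vH[OF f] toeplitz_analytic[OF v(1) f vH[OF f]]])
  have "fourier_coeff (T (\<lambda>z. z * f z)) (int n + 1) = fourier_coeff (T f) (int n)" if f: "f \<in> H2" for f n
  proof -
    have "fourier_coeff (hankel \<psi>1 (\<lambda>z. v z * f z)) (int n) = 0"
      using vM[OF f] by (simp add: M_def ker_H2_iff[OF H1])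
    then show ?thesis
      using B0[OF vH[OF f], of n] by (simp add: Tc f H2_mult_id mult.left_commute)
  qed
  then obtain \<phi>2 where \<phi>2: "\<phi>2 \<in> Linf" "op_eq T (toeplitz \<phi>2)" using brown_halmos[OF T] by blast
  define \<phi> where "\<phi> w = cnj (v w) * \<phi>2 w" for w
  have \<phi>: "\<phi> \<in> Linf"
    unfolding \<phi>_def by (intro Linf_mult Linf_cnj v(1) \<phi>2(1))
  define D where "D f z = A f z - toeplitz \<phi> f z" for f z
  have D: "bounded_operator_H2 D"
    unfolding D_def by (rule bounded_operator_diff[OF A bounded_toeplitz[OF \<phi>]])
  have Dc: "fourier_coeff (D f) n = fourier_coeff (A f) n - fourier_coeff (toeplitz \<phi> f) n" if f: "f \<in> H2" for f n
    unfolding D_def by (intro fourier_coeff_diff H2_subset_L2 inA toeplitz_H2 \<phi> f)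
  \<comment> \<open>Both \<open>A T\<^sub>v\<close> and \<open>T\<^sub>\<phi> T\<^sub>v\<close> equal the Toeplitz operator with symbol \<open>\<phi>2\<close>, since \<open>\<phi> v = \<phi>2\<close>.\<close>
  have Dv: "fourier_coeff (D (\<lambda>z. v z * f z)) (int n) = 0" if f: "f \<in> H2" for f n
  proof -
    have "fourier_coeff (A (\<lambda>z. v z * f z)) (int n) = fourier_coeff (toeplitz \<phi>2 f) (int n)"
      unfolding Tc[OF f, symmetric]
      by (rule fourier_coeff_op_eq[of T "toeplitz \<phi>2" f "int n", OF \<phi>2(2) f bounded_operator_H2_in[OF T f] toeplitz_H2[OF \<phi>2(1) f]])
    also have "\<dots> = fourier_coeff (\<lambda>z. \<phi>2 z * f z) (int n)" by (rule fourier_coeff_toeplitz[OF \<phi>2(1) f])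
    also have "\<dots> = fourier_coeff (\<lambda>z. \<phi> z * (v z * f z)) (int n)"
    proof (rule fourier_coeff_cong_AE)
      show "AE z in \<mu>. \<phi>2 z * f z = \<phi> z * (v z * f z)"
        using vn
      proof eventually_elim
        case (elim z)
        have "\<phi> z * (v z * f z) = (v z * cnj (v z)) * (\<phi>2 z * f z)" by (simp add: \<phi>_def)
        then show ?case by (simp only: circle_mult_cnj(1)[OF elim] mult_1)
      qed
    qed (rule L2_measurable[OF L2_mult[OF H2_subset_L2[OF f] \<phi>2(1)]]
          L2_measurable[OF L2_mult[OF H2_subset_L2[OF vH[OF f]] \<phi>]])+
    also have "\<dots> = fourier_coeff (toeplitz \<phi> (\<lambda>z. v z * f z)) (int n)"
      by (rule fourier_coeff_toeplitz[OF \<phi> vH[OF f], symmetric])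
    finally show ?thesis by (simp add: Dc[OF vH[OF f]])
  qed
  have Dshift: "fourier_coeff (D (\<lambda>z. z * f z)) (int n + 1) = fourier_coeff (D f) (int n) + fourier_coeff (hankel \<psi>1 f) (int n)"
    if f: "f \<in> H2" for f n
    using B0[OF f, of n] fourier_coeff_toeplitz_shift[OF \<phi> f, of n] by (simp add: Dc f H2_mult_id algebra_simps)
  \<comment> \<open>The defect from the Hankel equation is Toeplitz, because the Hankel operator \<open>S\<^sup>* D S - D\<close> does not contribute to \<open>S\<^sup>* E S - E\<close>.\<close>
  define E where "E f z = adjoint_H2 shift (D f) z - D (shift f) z" for f z
  have E: "bounded_operator_H2 E" unfolding E_def
    by (rule bounded_operator_diff[OF bounded_operator_comp[OF bounded_adjoint_shift D]
          bounded_operator_comp[OF D bounded_toeplitz[OF Linf_id]]])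
  have Ec: "fourier_coeff (E f) (int n) = fourier_coeff (D f) (int n + 1) - fourier_coeff (D (\<lambda>z. z * f z)) (int n)" if f: "f \<in> H2" for f n
  proof -
    note inD = bounded_operator_H2_in[OF D]
    have "fourier_coeff (E f) (int n) = fourier_coeff (adjoint_H2 shift (D f)) (int n) - fourier_coeff (D (shift f)) (int n)"
      unfolding E_def by (intro fourier_coeff_diff H2_subset_L2 adjoint_shift_H2 inD shift_H2 f)
    then show ?thesis by (simp add: fourier_coeff_adjoint_shift inD f fourier_op_shift[OF D f])
  qed
  have "fourier_coeff (E (\<lambda>z. z * f z)) (int n + 1) = fourier_coeff (E f) (int n)" if f: "f \<in> H2" for f n
    using Ec[OF H2_mult_id[OF f], of "Suc n"] Dshift[OF f, of "Suc n"] Dshift[OF H2_mult_id[OF f], of n]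
    by (simp add: Ec[OF f] fourier_coeff_hankel_shift[OF \<psi>1 f] add_ac)
  then obtain e where e: "e \<in> Linf" "op_eq E (toeplitz e)" using brown_halmos[OF E] by blast
  have Ee: "fourier_coeff (E f) (int n) = fourier_coeff (\<lambda>z. e z * f z) (int n)" if f: "f \<in> H2" for f n
    unfolding fourier_coeff_toeplitz[OF e(1) f, symmetric]
    by (rule fourier_coeff_op_eq[of E "toeplitz e" f "int n", OF e(2) f bounded_operator_H2_in[OF E f] toeplitz_H2[OF e(1) f]])
  have "AE z in \<mu>. e z = 0"
  proof (rule symbol_eq_zero[OF e(1) v(3,1) vn])
    fix k n
    have zk: "(\<lambda>z. z * z ^ k) \<in> H2" by (rule H2_mult_id[OF H2_power])
    have "fourier_coeff (E (\<lambda>z. v z * z ^ k)) (int n) = 0"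
      using Dv[OF H2_power, of k "Suc n"] Dv[OF zk, of n]
      by (simp add: Ec[OF vH[OF H2_power]] mult.left_commute add.commute)
    then show "fourier_coeff (\<lambda>z. e z * (v z * z ^ k)) (int n) = 0"
      by (simp add: Ee[OF vH[OF H2_power]])
  qed
  then have "fourier_coeff (\<lambda>z. e z * f z) n = fourier_coeff (\<lambda>z. 0) n" if f: "f \<in> H2" for f n
    by (intro fourier_coeff_cong_AE L2_measurable L2_mult[OF H2_subset_L2[OF f] e(1)] L2_const) (auto elim: eventually_mono)
  then have "fourier_coeff (D (\<lambda>z. z * f z)) (int n) = fourier_coeff (D f) (int n + 1)" if f: "f \<in> H2" for f n
    using Ec[OF f, of n] Ee[OF f, of n] f by simp
  then obtain \<psi> where \<psi>: "\<psi> \<in> Linf" "op_eq D (hankel \<psi>)" using nehari[OF D] by blast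
  have "op_eq A (\<lambda>f z. toeplitz \<phi> f z + hankel \<psi> f z)"
    unfolding op_eq_def
  proof
    fix f assume "f \<in> H2"
    then have "AE z in \<mu>. D f z = hankel \<psi> f z" using \<psi>(2) by (simp add: op_eq_def)
    then show "AE z in \<mu>. A f z = toeplitz \<phi> f z + hankel \<psi> f z"
      by eventually_elim (simp add: D_def algebra_simps)
  qed
  moreover have "ker_H2 (hankel \<psi>) \<noteq> zero_H2"
  proof -
    have "v \<in> ker_H2 D" using Dv[of "\<lambda>z. 1"] v(3) by (simp add: ker_H2_iff[OF D])
    then have "v \<in> ker_H2 (hankel \<psi>)" by (simp add: ker_H2_op_eq[OF \<psi>(2)])
    moreover have "\<not> (AE z in \<mu>. v z = 0)"
    proof
      assume "AE z in \<mu>. v z = 0"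
      moreover have "AE z in \<mu>. f0 z = 0 \<or> v z \<noteq> 0"
        using f0(1) unfolding v(4) mult_H2_def by (auto elim: eventually_mono)
      ultimately have "AE z in \<mu>. f0 z = 0" by eventually_elim auto
      then show False using f0(2) by simp
    qed
    ultimately show ?thesis using ker_H2_nonzero[OF bounded_hankel[OF \<psi>(1)]] by blast
  qed
  ultimately show ?thesis
    using \<theta>(1,4) \<phi>2 \<phi> \<psi>(1) unfolding T_def[abs_def] \<phi>_def[abs_def] v_def M_def by blast
qed

theorem theorem1p2:
  fixes A :: operator
  assumes "bounded_operator_H2 A"
  shows "((\<exists>T H. is_toeplitz T \<and> noninjective_hankel H \<and> op_eq A (\<lambda>f z. T f z + H f z)) \<longleftrightarrow>
          noninjective_hankel (\<lambda>f z. adjoint_H2 shift (A (shift f)) z - A f z)) \<and>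
         (\<forall>\<psi>1\<in>Linf.
            op_eq (\<lambda>f z. adjoint_H2 shift (A (shift f)) z - A f z) (hankel \<psi>1) \<and>
            ker_H2 (hankel \<psi>1) \<noteq> zero_H2 \<longrightarrow>
            (\<exists>\<theta> \<phi>2. inner_function \<theta> \<and> \<phi>2 \<in> Linf \<and>
               ker_H2 (hankel \<psi>1) = mult_H2 (radial_limit \<theta>) \<and>
               op_eq (\<lambda>f. A (toeplitz (radial_limit \<theta>) f)) (toeplitz \<phi>2) \<and>
               (\<exists>\<psi>\<in>Linf. op_eq A
                  (\<lambda>f z. toeplitz (\<lambda>w. cnj (radial_limit \<theta> w) * \<phi>2 w) f z + hankel \<psi> f z))))"
proof (intro conjI iffI ballI impI)
  assume "\<exists>T H. is_toeplitz T \<and> noninjective_hankel H \<and> op_eq A (\<lambda>f z. T f z + H f z)"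
  then obtain T H \<phi> \<psi> where \<phi>: "\<phi> \<in> Linf" "op_eq T (toeplitz \<phi>)" and \<psi>: "\<psi> \<in> Linf" "op_eq H (hankel \<psi>)"
    and ker: "ker_H2 H \<noteq> zero_H2" and A: "op_eq A (\<lambda>f z. T f z + H f z)"
    unfolding is_toeplitz_def noninjective_hankel_def is_hankel_def by blast
  have "op_eq A (\<lambda>f z. toeplitz \<phi> f z + hankel \<psi> f z)"
    unfolding op_eq_def
  proof
    fix f assume f: "f \<in> H2"
    show "AE z in \<mu>. A f z = toeplitz \<phi> f z + hankel \<psi> f z"
      using bspec[OF A[unfolded op_eq_def] f] bspec[OF \<phi>(2)[unfolded op_eq_def] f] bspec[OF \<psi>(2)[unfolded op_eq_def] f]
      by eventually_elim simp
  qed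
  moreover have "ker_H2 (hankel \<psi>) \<noteq> zero_H2" using ker ker_H2_op_eq[OF \<psi>(2)] by simp
  ultimately show "noninjective_hankel (shift_defect A)"
    by (rule noninjective_shift_defect[OF assms \<phi>(1) \<psi>(1)])
next
  assume "noninjective_hankel (shift_defect A)"
  then obtain \<psi>1 where \<psi>1: "\<psi>1 \<in> Linf" "op_eq (shift_defect A) (hankel \<psi>1)" "ker_H2 (shift_defect A) \<noteq> zero_H2"
    unfolding noninjective_hankel_def is_hankel_def by blast
  then have "ker_H2 (hankel \<psi>1) \<noteq> zero_H2" using ker_H2_op_eq[OF \<psi>1(2)] by simp
  from toeplitz_plus_hankel[OF assms \<psi>1(1,2) this] obtain \<phi> \<psi> where
    \<phi>: "\<phi> \<in> Linf" and \<psi>: "\<psi> \<in> Linf" "ker_H2 (hankel \<psi>) \<noteq> zero_H2"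
    and A: "op_eq A (\<lambda>f z. toeplitz \<phi> f z + hankel \<psi> f z)" by blast
  have "is_toeplitz (toeplitz \<phi>)" using \<phi> by (auto simp: is_toeplitz_def op_eq_def)
  moreover have "noninjective_hankel (hankel \<psi>)"
    using \<psi> by (auto simp: noninjective_hankel_def is_hankel_def op_eq_def)
  ultimately show "\<exists>T H. is_toeplitz T \<and> noninjective_hankel H \<and> op_eq A (\<lambda>f z. T f z + H f z)"
    using A by blast
next
  fix \<psi>1 assume \<psi>1: "\<psi>1 \<in> Linf"
    and B: "op_eq (shift_defect A) (hankel \<psi>1) \<and> ker_H2 (hankel \<psi>1) \<noteq> zero_H2"
  from toeplitz_plus_hankel[OF assms \<psi>1 conjunct1[OF B] conjunct2[OF B]]
  show "\<exists>\<theta> \<phi>2. inner_function \<theta> \<and> \<phi>2 \<in> Linf \<and>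
     ker_H2 (hankel \<psi>1) = mult_H2 (radial_limit \<theta>) \<and>
     op_eq (\<lambda>f. A (toeplitz (radial_limit \<theta>) f)) (toeplitz \<phi>2) \<and>
     (\<exists>\<psi>\<in>Linf. op_eq A (\<lambda>f z. toeplitz (\<lambda>w. cnj (radial_limit \<theta> w) * \<phi>2 w) f z + hankel \<psi> f z))"
    by blast
qed

end
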